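(* Each of the following two conditions is sufficient for the Jacobian conjecture to hold in every dimension (that is, for $JC(\infty)$ to hold). (i) For every $n$ and every Druzkowski $n\times n$ matrix $A$ all of whose entries are integers, the map $F_A(x)=x+(A.x)^3:\mathbb{C}^n\to\mathbb{C}^n$ has a polynomial inverse. (ii) For every $n$, the set of Druzkowski maps $F_A:\mathbb{C}^n\to\mathbb{C}^n$ which have a polynomial inverse is dense in the set of all Druzkowski maps of $\mathbb{C}^n$.
   Context: For $n\ge 1$, $JC(n)$ is the statement: every polynomial map $F:\mathbb{C}^n\to\mathbb{C}^n$ whose Jacobian matrix is invertible at every point has a polynomial inverse. $JC(\infty)$ is the statement that $JC(n)$ holds for every $n$. For $u\in\mathbb{C}^n$, $u^3$ denotes the coordinatewise cube $(u_1^3,\ldots,u_n^3)$. For a complex $n\times n$ matrix $A$ let $F_A(x)=x+(A.x)^3$. The matrix $A$ is called Druzkowski, and $F_A$ is called a Druzkowski map, if the Jacobian determinant of $F_A$ is identically equal to $1$. A Druzkowski map is identified with its coefficients (a point of an affine space), and density is with respect to the usual (Euclidean) topology. *)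

theory Defs
  imports
    "HOL-Analysis.Function_Topology"
    "HOL-Analysis.Derivative"
    "Jordan_Normal_Form.Determinant"
begin

text \<open>
  The dimension is quantified inside the statement, so the \<open>n\<close>-dimensional complex space is
  \<open>carrier_vec n\<close>.  A map on it is a function on \<^typ>\<open>complex vec\<close>, of which only the values on
  \<open>carrier_vec n\<close> matter.
\<close>

subsection \<open>Polynomial maps and their coefficients\<close>

text \<open>The exponents of the monomials of total degree at most \<open>d\<close> in \<open>n\<close> variables.\<close>

definition multi_indices :: "nat \<Rightarrow> nat \<Rightarrow> nat vec set" where
  "multi_indices n d = {m \<in> carrier_vec n. (\<Sum>j<n. m $ j) \<le> d}"

lemma finite_multi_indices: "finite (multi_indices n d)"
proof (rule finite_subset)
  show "multi_indices n d \<subseteq> vec n ` (\<Pi>\<^sub>E j\<in>{..<n}. {..d})"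
  proof
    fix m assume m: "m \<in> multi_indices n d"
    have "m = vec n (restrict (\<lambda>j. m $ j) {..<n})"
      using m by (auto simp: multi_indices_def)
    moreover have "m $ j \<le> d" if "j < n" for j
    proof -
      have "m $ j \<le> (\<Sum>j<n. m $ j)"
        by (rule member_le_sum) (use that in auto)
      then show ?thesis using m by (simp add: multi_indices_def)
    qed
    ultimately show "m \<in> vec n ` (\<Pi>\<^sub>E j\<in>{..<n}. {..d})"
      by (intro image_eqI[where x = "restrict (\<lambda>j. m $ j) {..<n}"]) auto
  qed
  show "finite (vec n ` (\<Pi>\<^sub>E j\<in>{..<n}. {..d}))"
    by (intro finite_imageI finite_PiE) auto
qed

text \<open>
  \<open>c (i, m)\<close> is the coefficient of the monomial with exponent \<open>m\<close> in the \<open>i\<close>-th component.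
\<close>

definition eval_coeffs ::
    "nat \<Rightarrow> nat \<Rightarrow> (nat \<times> nat vec \<Rightarrow> complex) \<Rightarrow> complex vec \<Rightarrow> complex vec" where
  "eval_coeffs n d c x =
     vec n (\<lambda>i. \<Sum>m\<in>multi_indices n d. c (i, m) * (\<Prod>j<n. (x $ j) ^ (m $ j)))"

definition has_coeffs ::
    "nat \<Rightarrow> nat \<Rightarrow> (complex vec \<Rightarrow> complex vec) \<Rightarrow> (nat \<times> nat vec \<Rightarrow> complex) \<Rightarrow> bool" where
  "has_coeffs n d F c \<longleftrightarrow> (\<forall>x\<in>carrier_vec n. F x = eval_coeffs n d c x)"

definition polynomial_map :: "nat \<Rightarrow> (complex vec \<Rightarrow> complex vec) \<Rightarrow> bool" where
  "polynomial_map n F \<longleftrightarrow> (\<exists>d c. has_coeffs n d F c)"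

definition has_polynomial_inverse :: "nat \<Rightarrow> (complex vec \<Rightarrow> complex vec) \<Rightarrow> bool" where
  "has_polynomial_inverse n F \<longleftrightarrow>
     (\<exists>G. polynomial_map n G \<and> (\<forall>x\<in>carrier_vec n. G (F x) = x \<and> F (G x) = x))"

subsection \<open>The Jacobian conjecture\<close>

text \<open>The \<open>(i, j)\<close> entry is the partial derivative of the \<open>i\<close>-th component in the \<open>j\<close>-th variable.\<close>

definition jacobian_mat :: "nat \<Rightarrow> (complex vec \<Rightarrow> complex vec) \<Rightarrow> complex vec \<Rightarrow> complex mat" where
  "jacobian_mat n F x = mat n n (\<lambda>(i, j). deriv (\<lambda>t. F (x + t \<cdot>\<^sub>v unit_vec n j) $ i) 0)"

definition JC :: "nat \<Rightarrow> bool" where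
  "JC n \<longleftrightarrow>
     (\<forall>F. polynomial_map n F \<and> (\<forall>x\<in>carrier_vec n. invertible_mat (jacobian_mat n F x))
        \<longrightarrow> has_polynomial_inverse n F)"

definition JC_infinity :: bool where
  "JC_infinity \<longleftrightarrow> (\<forall>n\<ge>1. JC n)"

subsection \<open>Druzkowski maps\<close>

definition cube_vec :: "complex vec \<Rightarrow> complex vec" where
  "cube_vec u = map_vec (\<lambda>z. z ^ 3) u"

definition druzkowski_map :: "complex mat \<Rightarrow> complex vec \<Rightarrow> complex vec" where
  "druzkowski_map A x = x + cube_vec (A *\<^sub>v x)"

definition druzkowski_mat :: "nat \<Rightarrow> complex mat \<Rightarrow> bool" where
  "druzkowski_mat n A \<longleftrightarrow>
     A \<in> carrier_mat n n \<and>
     (\<forall>x\<in>carrier_vec n. det (jacobian_mat n (druzkowski_map A) x) = 1)"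

definition druzkowski_maps :: "nat \<Rightarrow> (complex vec \<Rightarrow> complex vec) set" where
  "druzkowski_maps n = {druzkowski_map A | A. druzkowski_mat n A}"

text \<open>
  Every \<open>druzkowski_map A\<close> has degree at most 3, so it is a point of the finite-dimensional space
  of coefficient families indexed by \<open>{..<n} \<times> multi_indices n 3\<close>.  As the index set is finite,
  the product topology is the Euclidean topology of that space.
\<close>

definition coeff_space :: "nat \<Rightarrow> (nat \<times> nat vec \<Rightarrow> complex) topology" where
  "coeff_space n = product_topology (\<lambda>_. euclidean) ({..<n} \<times> multi_indices n 3)"

definition coeff_points ::
    "nat \<Rightarrow> (complex vec \<Rightarrow> complex vec) set \<Rightarrow> (nat \<times> nat vec \<Rightarrow> complex) set" where
  "coeff_points n S = {c \<in> topspace (coeff_space n). \<exists>F\<in>S. has_coeffs n 3 F c}"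

definition dense_in_maps ::
    "nat \<Rightarrow> (complex vec \<Rightarrow> complex vec) set \<Rightarrow> (complex vec \<Rightarrow> complex vec) set \<Rightarrow> bool" where
  "dense_in_maps n S T \<longleftrightarrow>
     S \<subseteq> T \<and> coeff_points n T \<subseteq> coeff_space n closure_of coeff_points n S"

end

theory Submission
  imports Defs "Jordan_Normal_Form.Schur_Decomposition"
begin

text \<open>
  The formal inverse \<open>y + g\<^sub>2(y) + g\<^sub>4(y) + \<dots>\<close> of a cubic homogeneous map \<open>F(x) = x + T(x, x, x)\<close> on
  \<open>n\<close>-space is given by a recursion, so that each \<open>g\<^sub>k\<close> is a polynomial in \<open>y\<close> and in the entries of \<open>T\<close>.
  The map has a polynomial inverse iff \<open>g\<^sub>k = 0\<close> for all large \<open>k\<close>, and then already for all \<open>k\<close> beyond a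
  bound that depends on \<open>n\<close> only: by counting dimensions, \<open>x\<^sub>i\<close> and the components of \<open>F\<close> satisfy an
  algebraic relation of bounded degree, and this relation bounds the degree of the inverse.  Hence the
  invertible maps form a closed set.

  A map with invertible Jacobian matrix is reduced to a cubic homogeneous one with nilpotent derivative
  (Bass, Connell and Wright), and this one is a quotient of a Druzkowski map (Gorni and Zampieri).
  Together with closedness this settles condition (ii).

  For condition (i), suppose that \<open>g\<^sub>k(y) \<noteq> 0\<close> for a cubic homogeneous map with nilpotent derivative and
  some \<open>k\<close> beyond the bound.  The entries of \<open>T\<close> lie in a finitely generated ring, which has a
  homomorphism to a number field \<open>K\<close> that does not kill \<open>g\<^sub>k(y)\<close>: adjoined elements are sent to integers if
  they are transcendental, and otherwise to roots of the image of their minimal polynomial.  Restriction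
  of scalars from \<open>K\<close> to the rationals, a homothety that clears the denominators, and the passage to a
  Druzkowski map lead to an integer matrix.  If its map is invertible, then so is the map over \<open>K\<close>, which
  contradicts the bound.
\<close>

text \<open>Unlike bijectivity, termination of the formal inverse is a system of polynomial
  identities in the entries of \<open>T\<close>. Once the indices are bounded in terms of
  \<open>n\<close> alone, these identities survive limits, and the failure of one of them is a
  single nonzero value that a ring homomorphism can preserve. A homomorphism on a subring fixes the
  naturals but says nothing about arbitrary complex arguments, so identities are transported through
  natural points, which detect every nonzero polynomial. Both constructions that raise the dimension
  come with a surjective linear map \<open>M\<close> carrying the large cubic map to the small one.
  Inverses descend along \<open>M\<close> with the help of a right inverse of \<open>M\<close>.
  Nilpotency has to go up instead, and there the kernel of \<open>M\<close> is the obstacle. For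
  Druzkowski maps the derivative factors through \<open>M\<close>; in the restriction of scalars the
  kernel contains no nonzero rational vector.\<close>

unbundle no vec_syntax

section \<open>Polynomial functions\<close>

text \<open>Functions of sequences make the number \<open>n\<close> of variables a mere parameter: a map in \<open>n\<close> variables
  is also one in \<open>n + 2\<close> variables, which fixes the additional ones.\<close>

inductive poly_fun :: "nat \<Rightarrow> nat \<Rightarrow> ((nat \<Rightarrow> complex) \<Rightarrow> complex) \<Rightarrow> bool" for n where
  const: "poly_fun n d (\<lambda>x. a)"
| var: "i < n \<Longrightarrow> 1 \<le> d \<Longrightarrow> poly_fun n d (\<lambda>x. x i)"
| add: "poly_fun n d f \<Longrightarrow> poly_fun n d g \<Longrightarrow> poly_fun n d (\<lambda>x. f x + g x)"
| mult: "poly_fun n d1 f \<Longrightarrow> poly_fun n d2 g \<Longrightarrow> d1 + d2 \<le> d \<Longrightarrow> poly_fun n d (\<lambda>x. f x * g x)"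

lemma poly_fun_mono:
  assumes "poly_fun n d f" "n \<le> n'" "d \<le> d'"
  shows "poly_fun n' d' f"
  using assms
proof (induction arbitrary: d')
  case (mult d1 f d2 g d)
  have "poly_fun n' d1 f" "poly_fun n' d2 g" using mult by auto
  then show ?case using mult by (intro poly_fun.mult[where ?d1.0 = d1 and ?d2.0 = d2]) auto
qed (auto intro: poly_fun.intros)

lemma poly_fun_cmult: "poly_fun n d f \<Longrightarrow> poly_fun n d (\<lambda>x. a * f x)"
  by (rule poly_fun.mult[OF poly_fun.const[of n 0]]) auto

lemma poly_fun_minus: "poly_fun n d f \<Longrightarrow> poly_fun n d (\<lambda>x. - f x)"
  using poly_fun_cmult[of n d f "-1"] by simp

lemma poly_fun_diff: "poly_fun n d f \<Longrightarrow> poly_fun n d g \<Longrightarrow> poly_fun n d (\<lambda>x. f x - g x)"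
  using poly_fun.add[OF _ poly_fun_minus] by simp

lemma poly_fun_sum: "(\<And>i. i \<in> S \<Longrightarrow> poly_fun n d (f i)) \<Longrightarrow> poly_fun n d (\<lambda>x. \<Sum>i\<in>S. f i x)"
  by (induction S rule: infinite_finite_induct) (auto intro: poly_fun.intros)

lemma poly_fun_power: "poly_fun n d f \<Longrightarrow> k * d \<le> e \<Longrightarrow> poly_fun n e (\<lambda>x. f x ^ k)"
proof (induction k arbitrary: e)
  case 0
  then show ?case by (simp add: poly_fun.const)
next
  case (Suc k)
  have "poly_fun n (k * d) (\<lambda>x. f x ^ k)" using Suc by simp
  then show ?case unfolding power_Suc using Suc.prems by (auto intro: poly_fun.mult)
qed

lemma poly_fun_prod:
  assumes "finite S" "\<And>i. i \<in> S \<Longrightarrow> poly_fun n (d i) (f i)" "(\<Sum>i\<in>S. d i) \<le> e"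
  shows "poly_fun n e (\<lambda>x. \<Prod>i\<in>S. f i x)"
  using assms
proof (induction S arbitrary: e)
  case (insert i S)
  have "poly_fun n (\<Sum>i\<in>S. d i) (\<lambda>x. \<Prod>i\<in>S. f i x)" using insert by simp
  then have "poly_fun n e (\<lambda>x. f i x * (\<Prod>i\<in>S. f i x))"
    using insert by (intro poly_fun.mult[of n "d i" _ "\<Sum>i\<in>S. d i"]) auto
  then show ?case using insert by simp
qed (auto intro: poly_fun.const)

lemma poly_fun_cong:
  assumes "poly_fun n d f" "\<And>j. j < n \<Longrightarrow> x j = y j"
  shows "f x = f y"
  using assms by induction auto

lemma poly_fun_compose:
  assumes "poly_fun n d f" "\<And>i. i < n \<Longrightarrow> \<exists>e. poly_fun m e (\<lambda>x. E x i)"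
  shows "\<exists>e. poly_fun m e (\<lambda>x. f (E x))"
  using assms
proof induction
  case (add d f g)
  then obtain e1 e2 where "poly_fun m e1 (\<lambda>x. f (E x))" "poly_fun m e2 (\<lambda>x. g (E x))" by blast
  then have "poly_fun m (max e1 e2) (\<lambda>x. f (E x))" "poly_fun m (max e1 e2) (\<lambda>x. g (E x))"
    by (auto elim: poly_fun_mono)
  then show ?case by (auto intro: poly_fun.add)
next
  case (mult d1 f d2 g d)
  then obtain e1 e2 where "poly_fun m e1 (\<lambda>x. f (E x))" "poly_fun m e2 (\<lambda>x. g (E x))" by blast
  then have "poly_fun m (e1 + e2) (\<lambda>x. f (E x) * g (E x))" by (rule poly_fun.mult) simp
  then show ?case by blast
qed (auto intro: poly_fun.const)

text \<open>Restriction to a line brings questions on several variables down to one-variable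
  polynomials and respects the degree bound.\<close>

lemma poly_fun_line:
  assumes "poly_fun n d f"
  shows "\<exists>p. degree p \<le> d \<and> (\<forall>s. poly p s = f (\<lambda>j. x j + s * y j))"
  using assms
proof induction
  case (const d a)
  show ?case by (rule exI[of _ "[:a:]"]) auto
next
  case (var i d)
  then show ?case by (intro exI[of _ "[:x i, y i:]"]) auto
next
  case (add d f g)
  then obtain p q where "degree p \<le> d" "\<forall>s. poly p s = f (\<lambda>j. x j + s * y j)"
    "degree q \<le> d" "\<forall>s. poly q s = g (\<lambda>j. x j + s * y j)" by auto
  then show ?case by (intro exI[of _ "p + q"]) (auto intro: degree_add_le)
next
  case (mult d1 f d2 g d)
  then obtain p q where "degree p \<le> d1" "\<forall>s. poly p s = f (\<lambda>j. x j + s * y j)"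
    "degree q \<le> d2" "\<forall>s. poly q s = g (\<lambda>j. x j + s * y j)" by auto
  then show ?case using degree_mult_le[of p q] mult.hyps
    by (intro exI[of _ "p * q"]) auto
qed

section \<open>Zeros of polynomial functions, independence of monomials and dimension counts\<close>

lemma poly_eq_0_if_nat_roots:
  fixes p :: "complex poly"
  assumes "\<And>m::nat. poly p (of_nat m) = 0"
  shows "p = 0"
proof (rule ccontr)
  assume "p \<noteq> 0"
  then have "finite {x. poly p x = 0}" by (rule poly_roots_finite)
  moreover have "range (of_nat :: nat \<Rightarrow> complex) \<subseteq> {x. poly p x = 0}" using assms by auto
  ultimately have "finite (range (of_nat :: nat \<Rightarrow> complex))" by (rule rev_finite_subset)
  moreover have "infinite (range (of_nat :: nat \<Rightarrow> complex))"
    by (rule range_inj_infinite) (simp add: inj_on_def)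
  ultimately show False by contradiction
qed

text \<open>The coordinates are released from the naturals one at a time: in each of them the
  function is a one-variable polynomial that vanishes at all naturals.\<close>

lemma poly_fun_eq_0_if_nat_zeros:
  assumes f: "poly_fun n d f" and 0: "\<And>x. (\<forall>j. x j \<in> \<nat>) \<Longrightarrow> f x = 0"
  shows "f x = 0"
proof -
  have *: "(\<forall>j\<ge>k. x j \<in> \<nat>) \<Longrightarrow> f x = 0" for k x
  proof (induction k arbitrary: x)
    case 0
    then show ?case using assms by simp
  next
    case (Suc k)
    obtain p where p: "poly p s = f (\<lambda>j. (x(k := 0)) j + s * ((\<lambda>_. 0)(k := 1)) j)" for s
      using poly_fun_line[OF f, of "x(k := 0)" "(\<lambda>_. 0)(k := 1)"] by metis
    have p': "poly p s = f (x(k := s))" for s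
      unfolding p by (rule arg_cong[of _ _ f]) auto
    have "poly p (of_nat m) = 0" for m
      unfolding p' by (rule Suc.IH) (use Suc.prems in \<open>auto simp: Suc_le_eq\<close>)
    then have "p = 0" by (rule poly_eq_0_if_nat_roots)
    then show ?case using p'[of "x k"] by simp
  qed
  have "f x = f (\<lambda>j. if j < n then x j else 0)"
    by (rule poly_fun_cong[OF f]) auto
  also have "\<dots> = 0" by (rule *[of n]) auto
  finally show ?thesis .
qed

text \<open>On the line from \<open>a\<close> to \<open>x\<close> this is the absence of zero
  divisors among one-variable polynomials.\<close>

lemma poly_fun_mult_eq_0:
  assumes f: "poly_fun n d f" and g: "poly_fun n e g" and "\<And>x. f x * g x = 0" "f a \<noteq> 0"
  shows "g x = 0"
proof -
  obtain p where p: "poly p s = f (\<lambda>j. a j + s * (x j - a j))" for s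
    using poly_fun_line[OF f, of a "\<lambda>j. x j - a j"] by metis
  obtain q where q: "poly q s = g (\<lambda>j. a j + s * (x j - a j))" for s
    using poly_fun_line[OF g, of a "\<lambda>j. x j - a j"] by metis
  have "poly (p * q) s = 0" for s by (simp add: p q assms)
  then have "p * q = 0" using poly_all_0_iff_0 by blast
  moreover have "p \<noteq> 0" using p[of 0] assms(4) by auto
  ultimately have "q = 0" by simp
  then show ?thesis using q[of 1] by simp
qed

text \<open>Comparing coefficients in the last variable singles out the exponents with a given last
  entry; on these, the remaining entries still tell the exponents apart.\<close>

lemma monomials_independent:
  fixes e :: "'a \<Rightarrow> nat \<Rightarrow> nat"
  assumes "finite S" "\<And>i i'. i \<in> S \<Longrightarrow> i' \<in> S \<Longrightarrow> (\<forall>j<n. e i j = e i' j) \<Longrightarrow> i = i'"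
    and "\<And>x :: nat \<Rightarrow> complex. (\<Sum>i\<in>S. c i * (\<Prod>j<n. x j ^ e i j)) = 0"
  shows "\<forall>i\<in>S. c i = 0"
  using assms
proof (induction n arbitrary: S)
  case 0
  show ?case
  proof
    fix i assume i: "i \<in> S"
    then have "S = {i}" using 0(2) by blast
    then show "c i = 0" using 0(3)[of "\<lambda>_. 0"] by simp
  qed
next
  case (Suc n)
  show ?case
  proof
    fix i assume i: "i \<in> S"
    define r where "r = e i n"
    have "\<forall>i\<in>{i\<in>S. e i n = r}. c i = 0"
    proof (rule Suc.IH)
      show "finite {i\<in>S. e i n = r}" using Suc.prems by auto
      show "i = i'" if "i \<in> {i\<in>S. e i n = r}" "i' \<in> {i\<in>S. e i n = r}" "\<forall>j<n. e i j = e i' j" for i i'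
        using that Suc.prems(2)[of i i'] by (auto simp: less_Suc_eq)
      fix x :: "nat \<Rightarrow> complex"
      define p where "p = (\<Sum>i\<in>S. monom (c i * (\<Prod>j<n. x j ^ e i j)) (e i n))"
      have "poly p s = 0" for s
      proof -
        have "poly p s = (\<Sum>i\<in>S. c i * (\<Prod>j<Suc n. (x(n := s)) j ^ e i j))"
          by (simp add: p_def poly_sum poly_monom mult.assoc)
        from trans[OF this Suc.prems(3)] show ?thesis .
      qed
      then have "p = 0" using poly_all_0_iff_0 by blast
      then have "0 = coeff p r" by simp
      also have "\<dots> = (\<Sum>i\<in>S. if e i n = r then c i * (\<Prod>j<n. x j ^ e i j) else 0)"
        by (simp add: p_def coeff_sum)
      also have "\<dots> = (\<Sum>i\<in>{i\<in>S. e i n = r}. c i * (\<Prod>j<n. x j ^ e i j))"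
        using Suc.prems(1) by (simp add: sum.If_cases Int_def)
      finally show "(\<Sum>i\<in>{i\<in>S. e i n = r}. c i * (\<Prod>j<n. x j ^ e i j)) = 0" by simp
    qed
    then show "c i = 0" using i by (simp add: r_def)
  qed
qed

text \<open>Elimination: if equation \<open>b\<close> involves the unknown \<open>i0\<close>, a
  multiple of row \<open>i0\<close> is subtracted from every other row so that \<open>b\<close>
  disappears, and equation \<open>b\<close> finally determines the value \<open>t\<close> at
  \<open>i0\<close>.\<close>

lemma homogeneous_system_nontrivial:
  fixes M :: "'a \<Rightarrow> 'b \<Rightarrow> 'c::field"
  assumes "finite B" "finite I" "card B < card I"
  shows "\<exists>c. (\<exists>i\<in>I. c i \<noteq> 0) \<and> (\<forall>b\<in>B. (\<Sum>i\<in>I. c i * M i b) = 0)"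
  using assms
proof (induction B arbitrary: I M)
  case empty
  then have "I \<noteq> {}" by auto
  then show ?case by (intro exI[of _ "\<lambda>_. 1"]) auto
next
  case (insert b B)
  show ?case
  proof (cases "\<forall>i\<in>I. M i b = 0")
    case True
    have "card B < card I" using insert by simp
    from insert.IH[OF insert.prems(1) this, of M] True show ?thesis by auto
  next
    case False
    then obtain i0 where i0: "i0 \<in> I" "M i0 b \<noteq> 0" by auto
    let ?I = "I - {i0}"
    have "card B < card ?I" using insert i0 by (simp add: card_Diff_singleton)
    from insert.IH[OF _ this, of "\<lambda>i b'. M i b' - M i b / M i0 b * M i0 b'"] insert.prems
    obtain c where c: "\<exists>i\<in>?I. c i \<noteq> 0"
      "\<forall>b'\<in>B. (\<Sum>i\<in>?I. c i * (M i b' - M i b / M i0 b * M i0 b')) = 0" by auto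
    define t where "t = - (\<Sum>i\<in>?I. c i * M i b / M i0 b)"
    have split: "(\<Sum>i\<in>I. (c(i0 := t)) i * M i b') = t * M i0 b' + (\<Sum>i\<in>?I. c i * M i b')" for b'
    proof -
      have "(\<Sum>i\<in>I. (c(i0 := t)) i * M i b')
          = (c(i0 := t)) i0 * M i0 b' + (\<Sum>i\<in>?I. (c(i0 := t)) i * M i b')"
        using i0 insert.prems by (intro sum.remove) auto
      also have "(\<Sum>i\<in>?I. (c(i0 := t)) i * M i b') = (\<Sum>i\<in>?I. c i * M i b')"
        by (intro sum.cong) auto
      finally show ?thesis by simp
    qed
    have "(\<Sum>i\<in>I. (c(i0 := t)) i * M i b') = 0" if "b' \<in> insert b B" for b'
    proof (cases "b' = b")
      case True
      then show ?thesis unfolding split using i0 by (simp add: t_def flip: sum_divide_distrib)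
    next
      case False
      then have "0 = (\<Sum>i\<in>?I. c i * (M i b' - M i b / M i0 b * M i0 b'))" using c that by simp
      also have "\<dots> = (\<Sum>i\<in>?I. c i * M i b') - (\<Sum>i\<in>?I. c i * M i b / M i0 b) * M i0 b'"
        by (simp add: sum_subtractf right_diff_distrib sum_distrib_right mult.assoc)
      finally show ?thesis unfolding split by (simp add: t_def)
    qed
    moreover have "\<exists>i\<in>I. (c(i0 := t)) i \<noteq> 0"
      using c(1) by (metis DiffE fun_upd_other singletonI)
    ultimately show ?thesis by (intro exI[of _ "c(i0 := t)"]) blast
  qed
qed

definition monomial_fun :: "nat \<Rightarrow> nat Matrix.vec \<Rightarrow> (nat \<Rightarrow> complex) \<Rightarrow> complex" where
  "monomial_fun n m x = (\<Prod>j<n. x j ^ (m $ j))"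

lemma poly_fun_imp_sum_monomials:
  assumes "poly_fun n d f"
  shows "\<exists>c. \<forall>x. f x = (\<Sum>m\<in>multi_indices n d. c m * monomial_fun n m x)"
  using assms
proof induction
  case (const d a)
  have "0\<^sub>v n \<in> multi_indices n d" by (auto simp: multi_indices_def)
  moreover have "(\<Sum>m\<in>multi_indices n d. (if m = 0\<^sub>v n then a else 0) * monomial_fun n m x)
     = (\<Sum>m\<in>multi_indices n d. if m = 0\<^sub>v n then a else 0)" for x
    by (intro sum.cong) (auto simp: monomial_fun_def)
  ultimately show ?case
    by (intro exI[of _ "\<lambda>m. if m = 0\<^sub>v n then a else 0"]) (auto simp: finite_multi_indices)
next
  case (var i d)
  have s: "(\<Sum>j<n. unit_vec n i $ j) = (1::nat)"
    using var by (simp add: unit_vec_def)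
  then have "unit_vec n i \<in> multi_indices n d" using var by (auto simp: multi_indices_def)
  moreover have "monomial_fun n (unit_vec n i) x = x i" for x
  proof -
    have "monomial_fun n (unit_vec n i) x = (\<Prod>j<n. if j = i then x j else 1)"
      unfolding monomial_fun_def by (intro prod.cong) (auto simp: unit_vec_def)
    then show ?thesis using var by simp
  qed
  then have "(\<Sum>m\<in>multi_indices n d. (if m = unit_vec n i then 1 else 0) * monomial_fun n m x)
     = (\<Sum>m\<in>multi_indices n d. if m = unit_vec n i then x i else 0)" for x
    by (intro sum.cong) auto
  ultimately show ?case
    by (intro exI[of _ "\<lambda>m. if m = unit_vec n i then 1 else 0"]) (auto simp: finite_multi_indices)
next
  case (add d f g)
  then obtain b c where "\<forall>x. f x = (\<Sum>m\<in>multi_indices n d. b m * monomial_fun n m x)"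
    "\<forall>x. g x = (\<Sum>m\<in>multi_indices n d. c m * monomial_fun n m x)" by auto
  then show ?case
    by (intro exI[of _ "\<lambda>m. b m + c m"]) (auto simp: distrib_right sum.distrib)
next
  case (mult d1 f d2 g d)
  then obtain b c where bc: "\<And>x. f x = (\<Sum>m\<in>multi_indices n d1. b m * monomial_fun n m x)"
    "\<And>x. g x = (\<Sum>m\<in>multi_indices n d2. c m * monomial_fun n m x)" by blast
  let ?P = "multi_indices n d1 \<times> multi_indices n d2"
  define h where "h m = (\<Sum>p\<in>{p\<in>?P. fst p + snd p = m}. b (fst p) * c (snd p))" for m
  have mf: "monomial_fun n (m + m') x = monomial_fun n m x * monomial_fun n m' x"
    if "m' \<in> carrier_vec n" for m m' x
    using that by (simp add: monomial_fun_def power_add prod.distrib)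
  have "f x * g x = (\<Sum>m\<in>multi_indices n d. h m * monomial_fun n m x)" for x
  proof -
    have "f x * g x = (\<Sum>p\<in>?P. (b (fst p) * monomial_fun n (fst p) x) * (c (snd p) * monomial_fun n (snd p) x))"
      by (simp add: bc sum_product sum.cartesian_product case_prod_unfold)
    also have "\<dots> = (\<Sum>p\<in>?P. b (fst p) * c (snd p) * monomial_fun n (fst p + snd p) x)"
      by (intro sum.cong) (auto simp: mf multi_indices_def)
    also have "\<dots> = (\<Sum>m\<in>multi_indices n d. \<Sum>p\<in>{p\<in>?P. fst p + snd p = m}.
        b (fst p) * c (snd p) * monomial_fun n (fst p + snd p) x)"
    proof (rule sum.group[symmetric])
      show "(\<lambda>p. fst p + snd p) ` ?P \<subseteq> multi_indices n d"
        using mult.hyps by (auto simp: multi_indices_def sum.distrib)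
    qed (auto simp: finite_multi_indices)
    also have "\<dots> = (\<Sum>m\<in>multi_indices n d. h m * monomial_fun n m x)"
      by (auto simp: h_def sum_distrib_right intro!: sum.cong)
    finally show ?thesis .
  qed
  then show ?case by blast
qed

lemma poly_fun_monomial_fun:
  assumes "(\<Sum>j<n. m $ j) \<le> d"
  shows "poly_fun n d (monomial_fun n m)"
  unfolding monomial_fun_def[abs_def]
  by (rule poly_fun_prod[where d = "\<lambda>j. m $ j"]) (use assms in \<open>auto intro: poly_fun_power poly_fun.var\<close>)

lemma poly_fun_sum_monomials:
  "poly_fun n d (\<lambda>x. \<Sum>m\<in>multi_indices n d. c m * monomial_fun n m x)"
  by (intro poly_fun_sum poly_fun_cmult poly_fun_monomial_fun) (auto simp: multi_indices_def)

lemma card_multi_indices_le: "card (multi_indices n d) \<le> Suc d ^ n"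
proof -
  have "multi_indices n d \<subseteq> Matrix.vec n ` (\<Pi>\<^sub>E j\<in>{..<n}. {..d})"
  proof
    fix m assume m: "m \<in> multi_indices n d"
    have "m = Matrix.vec n (restrict (\<lambda>j. m $ j) {..<n})"
      using m by (auto simp: multi_indices_def)
    moreover have "m $ j \<le> d" if "j < n" for j
      using m member_le_sum[of j "{..<n}" "\<lambda>j. m $ j"] that by (simp add: multi_indices_def)
    ultimately show "m \<in> Matrix.vec n ` (\<Pi>\<^sub>E j\<in>{..<n}. {..d})"
      by (intro image_eqI[where x = "restrict (\<lambda>j. m $ j) {..<n}"]) auto
  qed
  then have "card (multi_indices n d) \<le> card (Matrix.vec n ` (\<Pi>\<^sub>E j\<in>{..<n}. {..d}))"
    by (intro card_mono finite_imageI finite_PiE) auto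
  also have "\<dots> \<le> card (\<Pi>\<^sub>E j\<in>{..<n}. {..d})" by (intro card_image_le finite_PiE) auto
  also have "\<dots> = Suc d ^ n" by (simp add: card_PiE)
  finally show ?thesis .
qed

text \<open>The gradient \<open>D\<close> is chosen before the curve, so that inserting coordinate
  lines later identifies it with a row of the Jacobian matrix. Curves, taken coordinatewise, avoid
  derivatives on a space of sequences.\<close>

lemma poly_fun_chain_rule:
  assumes "poly_fun n d f"
  shows "\<exists>D. \<forall>\<gamma> \<gamma>'. (\<forall>j<n. \<gamma> 0 j = x j \<and> ((\<lambda>t. \<gamma> t j) has_field_derivative \<gamma>' j) (at 0)) \<longrightarrow>
    ((\<lambda>t::complex. f (\<gamma> t)) has_field_derivative (\<Sum>j<n. D j * \<gamma>' j)) (at 0)"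
  using assms
proof induction
  case (const d a)
  show ?case by (intro exI[of _ "\<lambda>_. 0"]) auto
next
  case (var i d)
  have "(\<Sum>j<n. (if j = i then 1 else 0) * \<gamma>' j) = \<gamma>' i" for \<gamma>' :: "nat \<Rightarrow> complex"
    using var by (simp add: if_distrib[of "\<lambda>x. x * _"] cong: if_cong)
  then show ?case using var by (intro exI[of _ "\<lambda>j. if j = i then 1 else 0"]) auto
next
  case (add d f g)
  obtain D E where D: "\<forall>\<gamma> \<gamma>'. (\<forall>j<n. \<gamma> 0 j = x j \<and> ((\<lambda>t. \<gamma> t j) has_field_derivative \<gamma>' j) (at 0)) \<longrightarrow>
    ((\<lambda>t::complex. f (\<gamma> t)) has_field_derivative (\<Sum>j<n. D j * \<gamma>' j)) (at 0)"
    and E: "\<forall>\<gamma> \<gamma>'. (\<forall>j<n. \<gamma> 0 j = x j \<and> ((\<lambda>t. \<gamma> t j) has_field_derivative \<gamma>' j) (at 0)) \<longrightarrow>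
    ((\<lambda>t::complex. g (\<gamma> t)) has_field_derivative (\<Sum>j<n. E j * \<gamma>' j)) (at 0)"
    using add.IH by blast
  show ?case
    by (intro exI[of _ "\<lambda>j. D j + E j"] allI impI)
      (use D E in \<open>auto simp: distrib_right sum.distrib intro!: DERIV_add\<close>)
next
  case (mult d1 f d2 g d)
  obtain D E where D: "\<forall>\<gamma> \<gamma>'. (\<forall>j<n. \<gamma> 0 j = x j \<and> ((\<lambda>t. \<gamma> t j) has_field_derivative \<gamma>' j) (at 0)) \<longrightarrow>
    ((\<lambda>t::complex. f (\<gamma> t)) has_field_derivative (\<Sum>j<n. D j * \<gamma>' j)) (at 0)"
    and E: "\<forall>\<gamma> \<gamma>'. (\<forall>j<n. \<gamma> 0 j = x j \<and> ((\<lambda>t. \<gamma> t j) has_field_derivative \<gamma>' j) (at 0)) \<longrightarrow>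
    ((\<lambda>t::complex. g (\<gamma> t)) has_field_derivative (\<Sum>j<n. E j * \<gamma>' j)) (at 0)"
    using mult.IH by blast
  show ?case
  proof (intro exI[of _ "\<lambda>j. D j * g x + E j * f x"] allI impI)
    fix \<gamma> :: "complex \<Rightarrow> nat \<Rightarrow> complex" and \<gamma>'
    assume \<gamma>: "\<forall>j<n. \<gamma> 0 j = x j \<and> ((\<lambda>t. \<gamma> t j) has_field_derivative \<gamma>' j) (at 0)"
    have "f (\<gamma> 0) = f x" "g (\<gamma> 0) = g x"
      using \<gamma> poly_fun_cong[OF mult.hyps(1)] poly_fun_cong[OF mult.hyps(2)] by blast+
    with DERIV_mult[OF D[rule_format, of \<gamma> \<gamma>'] E[rule_format, of \<gamma> \<gamma>']] \<gamma>
    have "((\<lambda>t. f (\<gamma> t) * g (\<gamma> t)) has_field_derivative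
      (\<Sum>j<n. D j * \<gamma>' j) * g x + (\<Sum>j<n. E j * \<gamma>' j) * f x) (at 0)" by simp
    moreover have "(\<Sum>j<n. D j * \<gamma>' j) * g x + (\<Sum>j<n. E j * \<gamma>' j) * f x
        = (\<Sum>j<n. (D j * g x + E j * f x) * \<gamma>' j)"
      unfolding sum_distrib_right sum.distrib[symmetric] by (intro sum.cong refl) (simp add: algebra_simps)
    ultimately show "((\<lambda>t. f (\<gamma> t) * g (\<gamma> t)) has_field_derivative
       (\<Sum>j<n. (D j * g x + E j * f x) * \<gamma>' j)) (at 0)" by simp
  qed
qed

section \<open>The formal inverse of a cubic map\<close>

type_synonym tensor = "nat \<Rightarrow> nat \<Rightarrow> nat \<Rightarrow> nat \<Rightarrow> complex"

text \<open>The trilinear map \<open>T(u, v, w)\<close>; the tensor need not be symmetric, so the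
  three slots are kept apart.\<close>

definition tri :: "nat \<Rightarrow> tensor \<Rightarrow> (nat \<Rightarrow> complex) \<Rightarrow> (nat \<Rightarrow> complex) \<Rightarrow> (nat \<Rightarrow> complex) \<Rightarrow> nat \<Rightarrow> complex" where
  "tri n \<tau> u v w i = (\<Sum>j<n. \<Sum>k<n. \<Sum>l<n. \<tau> i j k l * (u j * (v k * w l)))"

text \<open>Coordinates from \<open>n\<close> on are left alone, so that inverses are equations
  between whole sequences and maps in different numbers of variables can be composed.\<close>

definition cubic_map :: "nat \<Rightarrow> tensor \<Rightarrow> (nat \<Rightarrow> complex) \<Rightarrow> nat \<Rightarrow> complex" where
  "cubic_map n \<tau> x i = (if i < n then x i + tri n \<tau> x x x i else x i)"

text \<open>Index \<open>k\<close> carries the part of degree \<open>k + 1\<close> of the solution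
  of \<open>G = y - T(G, G, G)\<close>: parts of degrees \<open>p + 1\<close>, \<open>r + 1\<close>,
  \<open>k - p - r + 1\<close> multiply to degree \<open>k + 3\<close>, which is index
  \<open>k + 2\<close>.\<close>

fun formal_inverse :: "nat \<Rightarrow> tensor \<Rightarrow> (nat \<Rightarrow> complex) \<Rightarrow> nat \<Rightarrow> nat \<Rightarrow> complex" where
  "formal_inverse n \<tau> y 0 = y"
| "formal_inverse n \<tau> y (Suc 0) = (\<lambda>i. 0)"
| "formal_inverse n \<tau> y (Suc (Suc k)) = (\<lambda>i. - (\<Sum>p\<le>k. \<Sum>r\<le>k - p.
     tri n \<tau> (formal_inverse n \<tau> y p) (formal_inverse n \<tau> y r) (formal_inverse n \<tau> y (k - p - r)) i))"

lemma tri_cong: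
  assumes "\<And>j. j < n \<Longrightarrow> u j = u' j" "\<And>j. j < n \<Longrightarrow> v j = v' j" "\<And>j. j < n \<Longrightarrow> w j = w' j"
  shows "tri n \<tau> u v w i = tri n \<tau> u' v' w' i"
  unfolding tri_def using assms by (intro sum.cong) auto

lemma tri_scale: "tri n \<tau> (\<lambda>j. a * u j) (\<lambda>j. b * v j) (\<lambda>j. c * w j) i = a * b * c * tri n \<tau> u v w i"
  unfolding tri_def by (simp add: sum_distrib_left mult_ac)

lemma poly_fun_tri:
  assumes "\<And>j. j < n \<Longrightarrow> poly_fun m d1 (\<lambda>x. u x j)" "\<And>j. j < n \<Longrightarrow> poly_fun m d2 (\<lambda>x. v x j)"
    "\<And>j. j < n \<Longrightarrow> poly_fun m d3 (\<lambda>x. w x j)" "d1 + d2 + d3 \<le> d"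
  shows "poly_fun m d (\<lambda>x. tri n \<tau> (u x) (v x) (w x) i)"
  unfolding tri_def
proof (intro poly_fun_sum poly_fun_cmult)
  fix j k l assume *: "j \<in> {..<n}" "k \<in> {..<n}" "l \<in> {..<n}"
  have "poly_fun m (d2 + d3) (\<lambda>x. v x k * w x l)"
    using * assms by (intro poly_fun.mult[of m d2 _ d3]) auto
  with poly_fun.mult[OF assms(1) this, of j d] * assms(4)
  show "poly_fun m d (\<lambda>x. u x j * (v x k * w x l))" by simp
qed

lemma poly_fun_cubic_map: "i < n \<Longrightarrow> poly_fun n 3 (\<lambda>x. cubic_map n \<tau> x i)"
  unfolding cubic_map_def
  by (auto intro!: poly_fun.add poly_fun.var poly_fun_tri[of _ _ 1 _ 1 _ 1])

lemma poly_fun_formal_inverse: "i < n \<Longrightarrow> poly_fun n (Suc k) (\<lambda>y. formal_inverse n \<tau> y k i)"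
proof (induction k arbitrary: i rule: less_induct)
  case (less k)
  consider "k = 0" | "k = 1" | k' where "k = Suc (Suc k')"
    by (metis One_nat_def old.nat.exhaust)
  then show ?case
  proof cases
    case 3
    show ?thesis unfolding 3 formal_inverse.simps
    proof (intro poly_fun_minus poly_fun_sum)
      fix p r assume "p \<in> {..k'}" "r \<in> {..k' - p}"
      then show "poly_fun n (Suc (Suc (Suc k'))) (\<lambda>y. tri n \<tau> (formal_inverse n \<tau> y p)
          (formal_inverse n \<tau> y r) (formal_inverse n \<tau> y (k' - p - r)) i)"
        by (intro poly_fun_tri[of _ _ "Suc p" _ "Suc r" _ "Suc (k' - p - r)"] less.IH) (auto simp: 3)
    qed
  qed (use less.prems in \<open>auto intro: poly_fun.intros\<close>)
qed

definition tri_poly :: "nat \<Rightarrow> tensor \<Rightarrow> (nat \<Rightarrow> complex poly) \<Rightarrow> nat \<Rightarrow> complex poly" where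
  "tri_poly n \<tau> q i = (\<Sum>j<n. \<Sum>k<n. \<Sum>l<n. smult (\<tau> i j k l) (q j * (q k * q l)))"

lemma poly_tri_poly: "poly (tri_poly n \<tau> q i) s =
    tri n \<tau> (\<lambda>j. poly (q j) s) (\<lambda>j. poly (q j) s) (\<lambda>j. poly (q j) s) i"
  by (simp add: tri_poly_def tri_def poly_sum)

lemma coeff_tri_poly: "coeff (tri_poly n \<tau> q i) m = (\<Sum>p\<le>m. \<Sum>r\<le>m - p.
    tri n \<tau> (\<lambda>j. coeff (q j) p) (\<lambda>j. coeff (q j) r) (\<lambda>j. coeff (q j) (m - p - r)) i)"
proof -
  have swap: "(\<Sum>l<n. \<Sum>p\<le>m. \<Sum>r\<le>m - p. f l p r) = (\<Sum>p\<le>m. \<Sum>r\<le>m - p. \<Sum>l<n. f l p r)"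
    for f :: "nat \<Rightarrow> nat \<Rightarrow> nat \<Rightarrow> complex"
  proof -
    have "(\<Sum>l<n. \<Sum>p\<le>m. \<Sum>r\<le>m - p. f l p r) = (\<Sum>p\<le>m. \<Sum>l<n. \<Sum>r\<le>m - p. f l p r)"
      by (rule sum.swap)
    also have "\<dots> = (\<Sum>p\<le>m. \<Sum>r\<le>m - p. \<Sum>l<n. f l p r)"
      by (intro sum.cong refl sum.swap)
    finally show ?thesis .
  qed
  have "coeff (tri_poly n \<tau> q i) m = (\<Sum>j<n. \<Sum>k<n. \<Sum>l<n. \<Sum>p\<le>m. \<Sum>r\<le>m - p.
      \<tau> i j k l * (coeff (q j) p * (coeff (q k) r * coeff (q l) (m - p - r))))"
    by (simp add: tri_poly_def coeff_sum coeff_mult sum_distrib_left)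
  also have "\<dots> = (\<Sum>p\<le>m. \<Sum>r\<le>m - p. \<Sum>j<n. \<Sum>k<n. \<Sum>l<n.
      \<tau> i j k l * (coeff (q j) p * (coeff (q k) r * coeff (q l) (m - p - r))))"
    by (simp only: swap)
  finally show ?thesis by (simp only: tri_def)
qed

text \<open>The terms of the formal inverse are the coefficients of the solution of
  \<open>q + X\<^sup>2 T(q, q, q) = y\<close>, which is \<open>G(Xy) / X\<close> for the inverse \<open>G\<close> of \<open>x + T(x, x, x)\<close>.\<close>

lemma formal_inverse_iff:
  "(\<forall>i<n. q i + monom 1 2 * tri_poly n \<tau> q i = [:y i:]) \<longleftrightarrow>
   (\<forall>k. \<forall>i<n. coeff (q i) k = formal_inverse n \<tau> y k i)" (is "?L \<longleftrightarrow> ?R")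
proof
  assume L: ?L
  show ?R
  proof
    fix k
    show "\<forall>i<n. coeff (q i) k = formal_inverse n \<tau> y k i"
    proof (induction k rule: less_induct)
      case (less k)
      show ?case
      proof (intro allI impI)
        fix i assume i: "i < n"
        from L i have "q i + monom 1 2 * tri_poly n \<tau> q i = [:y i:]" by simp
        from arg_cong[OF this, of "\<lambda>p. coeff p k"]
        have e: "coeff (q i) k + (if k < 2 then 0 else coeff (tri_poly n \<tau> q i) (k - 2)) = coeff [:y i:] k"
          by (auto simp: coeff_monom_mult split: if_splits)
        consider "k = 0" | "k = 1" | k' where "k = Suc (Suc k')"
          by (metis One_nat_def old.nat.exhaust)
        then show "coeff (q i) k = formal_inverse n \<tau> y k i"
        proof cases
          case 3
          have "coeff (tri_poly n \<tau> q i) k' = - formal_inverse n \<tau> y k i"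
            unfolding coeff_tri_poly 3 formal_inverse.simps minus_minus
            by (intro sum.cong refl tri_cong) (use less.IH 3 in auto)
          then show ?thesis using e 3 by (simp add: coeff_pCons eq_neg_iff_add_eq_0 add.commute)
        qed (use e in \<open>auto simp: coeff_pCons\<close>)
      qed
    qed
  qed
next
  assume R: ?R
  show ?L
  proof (intro allI impI poly_eqI)
    fix i k assume i: "i < n"
    consider "k = 0" | "k = 1" | k' where "k = Suc (Suc k')"
      by (metis One_nat_def old.nat.exhaust)
    then show "coeff (q i + monom 1 2 * tri_poly n \<tau> q i) k = coeff [:y i:] k"
    proof cases
      case 3
      have "coeff (tri_poly n \<tau> q i) k' = - formal_inverse n \<tau> y k i"
        unfolding coeff_tri_poly 3 formal_inverse.simps minus_minus
        by (intro sum.cong refl tri_cong) (use R in auto)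
      then show ?thesis using i R 3 by (simp add: coeff_monom_mult coeff_pCons)
    qed (use i R in \<open>auto simp: coeff_monom_mult coeff_pCons\<close>)
  qed
qed

lemma formal_inverse_0: "i < n \<Longrightarrow> formal_inverse n \<tau> (\<lambda>_. 0) k i = 0"
proof -
  have "\<forall>i<n. 0 + monom 1 2 * tri_poly n \<tau> (\<lambda>_. 0) i = [:0:]" by (simp add: tri_poly_def)
  then have "\<forall>k. \<forall>i<n. coeff 0 k = formal_inverse n \<tau> (\<lambda>_. 0) k i"
    by (subst (asm) formal_inverse_iff[of n "\<lambda>_. 0" \<tau> "\<lambda>_. 0"])
  then show "i < n \<Longrightarrow> formal_inverse n \<tau> (\<lambda>_. 0) k i = 0" by simp
qed

text \<open>On the line through \<open>y\<close> the right inverse satisfies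
  \<open>F (G (s y)) = s y\<close>. As \<open>G\<close> fixes the origin, a factor \<open>s\<close>
  splits off from \<open>G (s y)\<close>, and the quotient solves the equation behind the recursion.
  This factor is the shift to \<open>Suc k\<close>.\<close>

lemma inverse_line_coeffs:
  assumes G: "\<And>i. i < n \<Longrightarrow> poly_fun m d (\<lambda>y. G y i)"
    and FG: "\<And>y i. i < n \<Longrightarrow> cubic_map n \<tau> (G y) i = y i"
    and G0: "\<And>i. i < n \<Longrightarrow> G (\<lambda>_. 0) i = 0"
  shows "\<exists>q. \<forall>i<n. degree (q i) \<le> d \<and> (\<forall>s. poly (q i) s = G (\<lambda>j. s * y j) i) \<and>
    (\<forall>k. coeff (q i) (Suc k) = formal_inverse n \<tau> y k i)"
proof -
  have "\<forall>i. \<exists>q. i < n \<longrightarrow> degree q \<le> d \<and> (\<forall>s. poly q s = G (\<lambda>j. s * y j) i)"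
    using poly_fun_line[OF G, of _ "\<lambda>_. 0" y] by fastforce
  then obtain q where q: "\<And>i. i < n \<Longrightarrow> degree (q i) \<le> d"
    "\<And>i s. i < n \<Longrightarrow> poly (q i) s = G (\<lambda>j. s * y j) i" by metis
  have "\<forall>i. \<exists>p. i < n \<longrightarrow> q i = pCons 0 p"
  proof
    fix i
    show "\<exists>p. i < n \<longrightarrow> q i = pCons 0 p"
    proof (cases "i < n")
      case True
      then have "poly (q i) 0 = 0" using q(2)[OF True, of 0] G0 by simp
      then show ?thesis by (metis pCons_cases poly_pCons mult_zero_left add.right_neutral)
    qed auto
  qed
  then obtain p where p: "\<And>i. i < n \<Longrightarrow> q i = pCons 0 (p i)" by metis
  have "\<forall>i<n. p i + monom 1 2 * tri_poly n \<tau> p i = [:y i:]"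
  proof (intro allI impI)
    fix i assume i: "i < n"
    \<comment> \<open>The equation for \<open>p\<close> is multiplied by the variable, so that it
      can be checked pointwise at \<open>s = 0\<close> as well.\<close>
    let ?r = "pCons 0 (p i + monom 1 2 * tri_poly n \<tau> p i - [:y i:])"
    have "poly ?r s = 0" for s
    proof -
      have "tri n \<tau> (G (\<lambda>j. s * y j)) (G (\<lambda>j. s * y j)) (G (\<lambda>j. s * y j)) i
        = tri n \<tau> (\<lambda>j. s * poly (p j) s) (\<lambda>j. s * poly (p j) s) (\<lambda>j. s * poly (p j) s) i"
        by (rule tri_cong) (use q(2) p in \<open>auto simp flip: q(2)\<close>)
      then have "G (\<lambda>j. s * y j) i + s ^ 3 * poly (tri_poly n \<tau> p i) s = s * y i"
        using FG[OF i, of "\<lambda>j. s * y j"] i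
        by (simp add: cubic_map_def tri_scale poly_tri_poly power3_eq_cube)
      moreover have "G (\<lambda>j. s * y j) i = s * poly (p i) s"
        using q(2)[OF i] p[OF i] by (metis add_0 poly_pCons)
      ultimately show ?thesis by (simp add: poly_monom algebra_simps power2_eq_square power3_eq_cube)
    qed
    then have "?r = 0" using poly_all_0_iff_0 by blast
    then show "p i + monom 1 2 * tri_poly n \<tau> p i = [:y i:]" by simp
  qed
  then have "\<forall>k. \<forall>i<n. coeff (p i) k = formal_inverse n \<tau> y k i"
    by (subst (asm) formal_inverse_iff)
  then show ?thesis using q p by (intro exI[of _ q]) auto
qed

definition formal_inverse_terminates :: "nat \<Rightarrow> tensor \<Rightarrow> bool" where
  "formal_inverse_terminates n \<tau> \<longleftrightarrow> (\<exists>b. \<forall>y. \<forall>k\<ge>b. \<forall>i<n. formal_inverse n \<tau> y k i = 0)"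

lemma formal_inverse_terminates_if_inverse:
  assumes "\<And>i. i < n \<Longrightarrow> poly_fun m d (\<lambda>y. G y i)"
    and "\<And>y i. i < n \<Longrightarrow> cubic_map n \<tau> (G y) i = y i"
    and "\<And>i. i < n \<Longrightarrow> G (\<lambda>_. 0) i = 0"
  shows "formal_inverse_terminates n \<tau>"
  unfolding formal_inverse_terminates_def
proof (intro exI[of _ d] allI impI)
  fix y k i assume "d \<le> k" "i < n"
  obtain q where "\<forall>i<n. degree (q i) \<le> d \<and> (\<forall>k. coeff (q i) (Suc k) = formal_inverse n \<tau> y k i)"
    using inverse_line_coeffs[OF assms, of y] by blast
  then show "formal_inverse n \<tau> y k i = 0"
    using \<open>d \<le> k\<close> \<open>i < n\<close> coeff_eq_0[of "q i" "Suc k"] by fastforce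
qed

text \<open>If two curves through the origin agree modulo \<open>X ^ m\<close>, their cubic parts
  agree modulo \<open>X ^ Suc m\<close>: in the telescoped difference of two triple products each
  summand has a further factor divisible by \<open>X\<close>. Hence the difference of the curves is
  divisible by all powers of \<open>X\<close>. This is the injectivity that turns a right inverse
  into a two-sided one.\<close>

lemma poly_cubic_unique:
  fixes p q :: "nat \<Rightarrow> complex poly"
  assumes eq: "\<And>i. i < n \<Longrightarrow> p i + tri_poly n \<tau> p i = q i + tri_poly n \<tau> q i"
    and 0: "\<And>i. i < n \<Longrightarrow> poly (p i) 0 = 0" "\<And>i. i < n \<Longrightarrow> poly (q i) 0 = 0"
    and i: "i < n"
  shows "p i = q i"
proof -
  have X: "[:0, 1:] dvd p i" "[:0, 1:] dvd q i" if "i < n" for i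
    using 0 that by (auto simp: dvd_iff_poly_eq_0)
  have dvd: "[:0, 1:] ^ m dvd p i - q i" if "i < n" for m i
    using that
  proof (induction m arbitrary: i)
    case (Suc m)
    have "[:0, 1:] ^ Suc m dvd smult (\<tau> i j k l) (q j * (q k * q l) - p j * (p k * p l))"
      if *: "j < n" "k < n" "l < n" for j k l
    proof (rule dvd_smult)
      have d: "[:0, 1:] ^ m dvd q j - p j" if "j < n" for j
        using Suc.IH[OF that] by (simp only: dvd_diff_commute)
      have "[:0, 1:] * [:0, 1:] ^ m dvd (q k * q l) * (q j - p j)"
        "[:0, 1:] * [:0, 1:] ^ m dvd (p j * q l) * (q k - p k)"
        "[:0, 1:] * [:0, 1:] ^ m dvd (p j * p k) * (q l - p l)"
        by (rule mult_dvd_mono, rule dvd_mult2, rule X, rule *, rule d, rule *)+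
      from dvd_add[OF dvd_add[OF this(1,2)] this(3)]
      show "[:0, 1:] ^ Suc m dvd q j * (q k * q l) - p j * (p k * p l)"
        by (simp add: algebra_simps del: mult_pCons_left mult_pCons_right)
    qed
    then have "[:0, 1:] ^ Suc m dvd (\<Sum>j<n. \<Sum>k<n. \<Sum>l<n. smult (\<tau> i j k l) (q j * (q k * q l) - p j * (p k * p l)))"
      by (intro dvd_sum) auto
    also have "\<dots> = tri_poly n \<tau> q i - tri_poly n \<tau> p i"
      by (simp add: tri_poly_def smult_diff_right sum_subtractf)
    also have "\<dots> = p i - q i" using eq[OF Suc.prems] by (simp add: algebra_simps)
    finally show ?case .
  qed simp
  have "p i - q i = 0"
  proof (rule ccontr)
    assume "p i - q i \<noteq> 0"
    from dvd_imp_degree_le[OF dvd[OF i, of "Suc (degree (p i - q i))"] this]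
    show False by (simp add: degree_linear_power)
  qed
  then show ?thesis by simp
qed

lemma cubic_map_0: "cubic_map n \<tau> (\<lambda>_. 0) = (\<lambda>_. 0)"
  by (auto simp: cubic_map_def tri_def)

definition truncated_inverse :: "nat \<Rightarrow> tensor \<Rightarrow> nat \<Rightarrow> (nat \<Rightarrow> complex) \<Rightarrow> nat \<Rightarrow> complex" where
  "truncated_inverse n \<tau> b y i = (if i < n then \<Sum>k<b. formal_inverse n \<tau> y k i else y i)"

lemma poly_fun_truncated_inverse: "i < n \<Longrightarrow> poly_fun n b (\<lambda>y. truncated_inverse n \<tau> b y i)"
  unfolding truncated_inverse_def
  by (auto intro!: poly_fun_sum poly_fun_mono[OF poly_fun_formal_inverse])

text \<open>When the terms from \<open>b\<close> on vanish, the others are the coefficients of a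
  polynomial solution \<open>q\<close>, which is evaluated at \<open>1\<close>.\<close>

lemma cubic_map_truncated_inverse:
  assumes 0: "\<And>y k i. b \<le> k \<Longrightarrow> i < n \<Longrightarrow> formal_inverse n \<tau> y k i = 0"
  shows "cubic_map n \<tau> (truncated_inverse n \<tau> b y) = y"
proof
  fix i
  define q where "q i = (\<Sum>k<b. monom (formal_inverse n \<tau> y k i) k)" for i
  have "\<forall>k. \<forall>i<n. coeff (q i) k = formal_inverse n \<tau> y k i"
    using 0 by (auto simp: q_def coeff_sum)
  then have "\<forall>i<n. q i + monom 1 2 * tri_poly n \<tau> q i = [:y i:]"
    by (subst formal_inverse_iff)
  then have e: "poly (q i) 1 + poly (tri_poly n \<tau> q i) 1 = y i" if "i < n" for i
  proof -
    from \<open>\<forall>i<n. q i + monom 1 2 * tri_poly n \<tau> q i = [:y i:]\<close> that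
    have "q i + monom 1 2 * tri_poly n \<tau> q i = [:y i:]" by simp
    from arg_cong[OF this, of "\<lambda>p. poly p 1"] show ?thesis by (simp add: poly_monom)
  qed
  have q1: "poly (q i) 1 = truncated_inverse n \<tau> b y i" if "i < n" for i
    using that by (simp add: q_def poly_sum poly_monom truncated_inverse_def)
  show "cubic_map n \<tau> (truncated_inverse n \<tau> b y) i = y i"
  proof (cases "i < n")
    case True
    have "poly (tri_poly n \<tau> q i) 1 = tri n \<tau> (truncated_inverse n \<tau> b y)
        (truncated_inverse n \<tau> b y) (truncated_inverse n \<tau> b y) i"
      unfolding poly_tri_poly by (rule tri_cong) (auto simp: q1)
    then show ?thesis using e[OF True] True by (simp add: cubic_map_def q1)
  qed (auto simp: cubic_map_def truncated_inverse_def)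
qed

text \<open>With \<open>G\<close> the truncation, the curve \<open>G (F (s x))\<close> and the line
  \<open>s x\<close> have the same image under \<open>F\<close>, because \<open>G\<close> is a right
  inverse, and both pass through the origin.\<close>

lemma truncated_inverse_cubic_map:
  assumes 0: "\<And>y k i. b \<le> k \<Longrightarrow> i < n \<Longrightarrow> formal_inverse n \<tau> y k i = 0"
  shows "truncated_inverse n \<tau> b (cubic_map n \<tau> x) = x"
proof
  fix i
  let ?G = "truncated_inverse n \<tau> b" and ?F = "cubic_map n \<tau>"
  have "\<exists>d. poly_fun n d (\<lambda>x. ?G (?F x) i)" if "i < n" for i
    using poly_fun_compose[OF poly_fun_truncated_inverse[OF that]] poly_fun_cubic_map by blast
  then have "\<forall>i. \<exists>p. i < n \<longrightarrow> (\<forall>s. poly p s = ?G (?F (\<lambda>j. s * x j)) i)"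
    using poly_fun_line[of n _ _ "\<lambda>_. 0" x] by fastforce
  then obtain p where p: "\<And>i s. i < n \<Longrightarrow> poly (p i) s = ?G (?F (\<lambda>j. s * x j)) i" by metis
  show "?G (?F x) i = x i"
  proof (cases "i < n")
    case True
    have "p i = monom (x i) 1"
    proof (rule poly_cubic_unique[where \<tau> = \<tau> and q = "\<lambda>i. monom (x i) 1", OF _ _ _ True])
      show "poly (p i) 0 = 0" if "i < n" for i
        using that by (simp add: p cubic_map_0 truncated_inverse_def formal_inverse_0)
      show "p i + tri_poly n \<tau> p i = monom (x i) 1 + tri_poly n \<tau> (\<lambda>i. monom (x i) 1) i" if i: "i < n" for i
      proof -
        have "poly (p i + tri_poly n \<tau> p i - (monom (x i) 1 + tri_poly n \<tau> (\<lambda>i. monom (x i) 1) i)) s = 0" for s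
        proof -
          have "poly (p i + tri_poly n \<tau> p i) s = ?F (?G (?F (\<lambda>j. s * x j))) i"
            using i by (simp add: poly_tri_poly cubic_map_def[of n \<tau> "?G _"] p cong: tri_cong)
          also have "\<dots> = ?F (\<lambda>j. s * x j) i" using cubic_map_truncated_inverse[OF 0] by simp
          also have "\<dots> = poly (monom (x i) 1 + tri_poly n \<tau> (\<lambda>i. monom (x i) 1) i) s"
            using i by (simp add: poly_tri_poly cubic_map_def poly_monom mult.commute)
          finally show ?thesis by simp
        qed
        then have "p i + tri_poly n \<tau> p i - (monom (x i) 1 + tri_poly n \<tau> (\<lambda>i. monom (x i) 1) i) = 0"
          using poly_all_0_iff_0 by blast
        then show ?thesis by simp
      qed
    qed (simp add: poly_monom)
    then have "poly (p i) 1 = x i" by (simp add: poly_monom)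
    then show ?thesis using p[OF True, of 1] by simp
  qed (auto simp: cubic_map_def truncated_inverse_def)
qed

section \<open>A bound on the degree of the inverse in terms of the dimension\<close>

lemma poly_expansion_unique:
  fixes q :: "'a::field poly"
  assumes "(\<Sum>a<m. q ^ a * p a) = 0" "\<And>a. a < m \<Longrightarrow> degree (p a) < degree q"
  shows "\<forall>a<m. p a = 0"
  using assms
proof (induction m arbitrary: p)
  case (Suc m)
  have e: "p 0 + q * (\<Sum>a<m. q ^ a * p (Suc a)) = 0"
    using Suc.prems(1) unfolding sum.lessThan_Suc_shift by (simp add: sum_distrib_left mult.assoc)
  then have "q dvd p 0" by (metis add_eq_0_iff dvd_minus_iff dvd_triv_left)
  then have p0: "p 0 = 0" using Suc.prems(2)[of 0] by (meson dvd_imp_degree_le not_less zero_less_Suc)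
  have "q \<noteq> 0" using Suc.prems(2)[of 0] by auto
  with e p0 have "(\<Sum>a<m. q ^ a * p (Suc a)) = 0" by simp
  then have "\<forall>a<m. p (Suc a) = 0" using Suc.prems(2) by (intro Suc.IH) auto
  then show ?case using p0 by (auto simp: less_Suc_eq_0_disj)
qed simp

text \<open>The value is \<open>n * K\<close> with \<open>K\<close> just above
  \<open>(6 * n) ^ n\<close>. Then the \<open>3 * n * K * K ^ n\<close> products of powers outnumber
  the monomials of degree below \<open>6 * n * K\<close>, of which there are at most
  \<open>(6 * n * K) ^ n\<close>.\<close>

definition inverse_bound :: "nat \<Rightarrow> nat" where
  "inverse_bound n = n * Suc ((6 * n) ^ n)"

text \<open>The \<open>n + 1\<close> functions \<open>x i, F 0, \<dots>, F (n - 1)\<close> of \<open>n\<close> variables satisfy an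
  algebraic relation whose degree is bounded by a dimension count.  After the substitution
  \<open>x = G (s y)\<close> the relation forces \<open>deg G \<le> inverse_bound n\<close>.\<close>

lemma formal_inverse_bound:
  assumes "formal_inverse_terminates n \<tau>" and k: "inverse_bound n \<le> k" and i: "i < n"
  shows "formal_inverse n \<tau> y k i = 0"
proof (rule ccontr)
  assume nz: "formal_inverse n \<tau> y k i \<noteq> 0"
  obtain b where 0: "\<And>y k i. b \<le> k \<Longrightarrow> i < n \<Longrightarrow> formal_inverse n \<tau> y k i = 0"
    using assms(1) unfolding formal_inverse_terminates_def by blast
  let ?G = "truncated_inverse n \<tau> b" and ?F = "cubic_map n \<tau>"
  define K where "K = Suc ((6 * n) ^ n)"
  define E where "E = (\<Pi>\<^sub>E j\<in>{..<n}. {..<K})"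
  \<comment> \<open>The exponent of \<open>x i\<close> is at most \<open>3 * n * K - 1\<close>, and
    \<open>n\<close> cubic components with exponents below \<open>K\<close> add at most
    \<open>3 * n * (K - 1)\<close> to the degree.\<close>
  define D where "D = 6 * n * K - 1"
  have K: "0 < K" "(6 * n) ^ n < K" by (auto simp: K_def)
  have fE: "finite E" by (auto simp: E_def intro: finite_PiE)
  have cE: "card E = K ^ n" by (simp add: E_def card_PiE)
  let ?I = "{..<3 * n * K} \<times> E"
  define h where "h am x = x i ^ fst am * (\<Prod>j<n. ?F x j ^ snd am j)" for am :: "nat \<times> (nat \<Rightarrow> nat)" and x
  have h: "poly_fun n D (h am)" if "am \<in> ?I" for am
  proof -
    have "snd am j < K" if "j < n" for j
      using \<open>am \<in> ?I\<close> that by (auto simp: E_def PiE_def Pi_def)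
    then have "(\<Sum>j<n. snd am j) \<le> (\<Sum>j<n. K - 1)"
      by (intro sum_mono) fastforce
    then have "(\<Sum>j<n. snd am j * 3) \<le> 3 * n * (K - 1)" by (simp flip: sum_distrib_right)
    moreover have "fst am < 3 * n * K" using that by auto
    moreover have "3 * n * (K - 1) \<le> 3 * n * K" "3 * n * K + 3 * n * K = 6 * n * K" by simp_all
    ultimately have "fst am + (\<Sum>j<n. snd am j * 3) \<le> D" unfolding D_def by linarith
    then show ?thesis unfolding h_def[abs_def]
      by (intro poly_fun.mult[of n "fst am" _ "\<Sum>j<n. snd am j * 3"] poly_fun_power[OF poly_fun.var[of i n 1]]
          poly_fun_prod[where d = "\<lambda>j. snd am j * 3"] poly_fun_power[OF poly_fun_cubic_map]) (auto simp: i)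
  qed
  then have "\<forall>am. \<exists>c. am \<in> ?I \<longrightarrow> (\<forall>x. h am x = (\<Sum>m\<in>multi_indices n D. c m * monomial_fun n m x))"
    using poly_fun_imp_sum_monomials by blast
  then obtain M where M: "\<And>am x. am \<in> ?I \<Longrightarrow> h am x = (\<Sum>m\<in>multi_indices n D. M am m * monomial_fun n m x)"
    by metis
  have "Suc D = 6 * n * K" using i K by (simp add: D_def)
  then have "card (multi_indices n D) \<le> (6 * n) ^ n * K ^ n"
    using card_multi_indices_le[of n D] by (simp add: power_mult_distrib)
  also have "\<dots> < K * K ^ n" using K by simp
  also have "\<dots> \<le> 3 * n * K * K ^ n" using i by simp
  also have "\<dots> = card ?I" by (simp add: card_cartesian_product cE)
  finally obtain c where c: "\<exists>am\<in>?I. c am \<noteq> 0"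
    "\<forall>m\<in>multi_indices n D. (\<Sum>am\<in>?I. c am * M am m) = 0"
    using homogeneous_system_nontrivial[of "multi_indices n D" ?I M] fE finite_multi_indices by blast
  have rel: "(\<Sum>am\<in>?I. c am * h am x) = 0" for x
  proof -
    have "(\<Sum>am\<in>?I. c am * h am x) = (\<Sum>am\<in>?I. \<Sum>m\<in>multi_indices n D. c am * M am m * monomial_fun n m x)"
      by (intro sum.cong refl) (simp add: M sum_distrib_left mult.assoc)
    also have "\<dots> = (\<Sum>m\<in>multi_indices n D. (\<Sum>am\<in>?I. c am * M am m) * monomial_fun n m x)"
      by (subst sum.swap) (simp add: sum_distrib_right)
    finally show ?thesis using c(2) by simp
  qed
  \<comment> \<open>\<open>P a\<close> is the coefficient of \<open>x i ^ a\<close> in the relation,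
    as a polynomial in the values of the components. Substituting \<open>G (s z)\<close> turns the
    relation into an expansion in powers of \<open>q\<close> whose coefficients have degree at most
    \<open>n * K\<close>, hence below the degree of \<open>q\<close>; so they all vanish.\<close>
  define P where "P a z = (\<Sum>m\<in>E. c (a, m) * (\<Prod>j<n. z j ^ m j))" for a z
  have P: "P a z = 0" if a: "a < 3 * n * K" and nz: "formal_inverse n \<tau> z k i \<noteq> 0" for a z
  proof -
    have "\<exists>q. \<forall>i<n. degree (q i) \<le> b \<and> (\<forall>s. poly (q i) s = ?G (\<lambda>j. s * z j) i) \<and>
        (\<forall>k. coeff (q i) (Suc k) = formal_inverse n \<tau> z k i)"
      by (rule inverse_line_coeffs[OF poly_fun_truncated_inverse])
         (simp_all add: cubic_map_truncated_inverse[OF 0], simp add: truncated_inverse_def formal_inverse_0)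
    then obtain q where q: "\<And>s. poly q s = ?G (\<lambda>j. s * z j) i"
      "\<And>k. coeff q (Suc k) = formal_inverse n \<tau> z k i" using i by blast
    have "Suc k \<le> degree q" by (rule le_degree) (use q nz in auto)
    then have deg: "n * K < degree q" using k by (simp add: inverse_bound_def K_def)
    define p where "p a = (\<Sum>m\<in>E. monom (c (a, m) * (\<Prod>j<n. z j ^ m j)) (\<Sum>j<n. m j))" for a
    have "poly (\<Sum>a<3 * n * K. q ^ a * p a) s = 0" for s
    proof -
      let ?x = "?G (\<lambda>j. s * z j)"
      have "(\<Prod>j<n. ?F ?x j ^ m j) = s ^ (\<Sum>j<n. m j) * (\<Prod>j<n. z j ^ m j)" for m
        using cubic_map_truncated_inverse[OF 0] by (simp add: power_mult_distrib prod.distrib power_sum)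
      then have "(\<Sum>am\<in>?I. c am * h am ?x)
          = (\<Sum>a<3 * n * K. \<Sum>m\<in>E. c (a, m) * (poly q s ^ a * (s ^ (\<Sum>j<n. m j) * (\<Prod>j<n. z j ^ m j))))"
        by (simp add: h_def sum.cartesian_product case_prod_unfold q)
      also have "\<dots> = poly (\<Sum>a<3 * n * K. q ^ a * p a) s"
        by (simp add: p_def poly_sum poly_monom sum_distrib_left mult_ac)
      finally show ?thesis using rel by simp
    qed
    then have "(\<Sum>a<3 * n * K. q ^ a * p a) = 0" using poly_all_0_iff_0 by blast
    moreover have "degree (p a) < degree q" for a
    proof -
      have "degree (p a) \<le> n * K" unfolding p_def
      proof (rule degree_sum_le[OF fE])
        fix m assume m: "m \<in> E"
        have "(\<Sum>j<n. m j) \<le> (\<Sum>j<n. K)"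
          by (intro sum_mono) (use m in \<open>auto simp: E_def PiE_def Pi_def intro: less_imp_le\<close>)
        then show "degree (monom (c (a, m) * (\<Prod>j<n. z j ^ m j)) (\<Sum>j<n. m j)) \<le> n * K"
          by (intro order.trans[OF degree_monom_le]) simp
      qed
      then show ?thesis using deg by simp
    qed
    ultimately have "p a = 0" using a poly_expansion_unique by blast
    then have "poly (p a) 1 = 0" by simp
    then show ?thesis by (simp add: p_def P_def poly_sum poly_monom)
  qed
  obtain a m where am: "a < 3 * n * K" "m \<in> E" "c (a, m) \<noteq> 0" using c(1) by auto
  have "P a z = 0" for z
  proof -
    have PK: "poly_fun n (n * K) (P a)" unfolding P_def[abs_def]
    proof (intro poly_fun_sum poly_fun_cmult)
      fix m assume m: "m \<in> E"
      have "(\<Sum>j<n. m j) \<le> (\<Sum>j<n. K)"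
        by (intro sum_mono) (use m in \<open>auto simp: E_def PiE_def Pi_def intro: less_imp_le\<close>)
      then show "poly_fun n (n * K) (\<lambda>z. \<Prod>j<n. z j ^ m j)"
        by (intro poly_fun_prod[where d = m]) (auto intro: poly_fun_power poly_fun.var)
    qed
    \<comment> \<open>\<open>P a\<close> vanishes wherever the term of index \<open>k\<close> does
      not. That term is not the zero polynomial, so \<open>P a\<close> vanishes everywhere.\<close>
    have "formal_inverse n \<tau> z k i * P a z = 0" for z using P[OF am(1)] by auto
    from poly_fun_mult_eq_0[OF poly_fun_formal_inverse[OF i] PK this nz] show ?thesis .
  qed
  then have Pa: "(\<Sum>m\<in>E. c (a, m) * (\<Prod>j<n. z j ^ m j)) = 0" for z by (simp add: P_def)
  have "\<forall>m\<in>E. c (a, m) = 0"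
  proof (rule monomials_independent[where S = E and n = n and e = "\<lambda>m. m" and c = "\<lambda>m. c (a, m)"])
    show "m = m'" if "m \<in> E" "m' \<in> E" "\<forall>j<n. m j = m' j" for m m'
      using that unfolding E_def by (intro PiE_ext[of m _ _ m']) auto
  qed (use fE Pa in auto)
  then show False using am by blast
qed

section \<open>Nilpotent derivatives\<close>

lemma strictly_upper_triangular_pow:
  fixes B :: "'a::comm_ring_1 mat"
  assumes B: "B \<in> carrier_mat n n" "\<And>i j. i < n \<Longrightarrow> j \<le> i \<Longrightarrow> B $$ (i, j) = 0"
  shows "i < n \<Longrightarrow> j < n \<Longrightarrow> j < i + k \<Longrightarrow> (B ^\<^sub>m k) $$ (i, j) = 0"
proof (induction k arbitrary: j)
  case (Suc k)
  have Bk: "B ^\<^sub>m k \<in> carrier_mat n n" using B by simp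
  have "(B ^\<^sub>m Suc k) $$ (i, j) = (\<Sum>l<n. (B ^\<^sub>m k) $$ (i, l) * B $$ (l, j))"
    using Suc.prems B(1) Bk by (simp add: scalar_prod_def atLeast0LessThan)
  also have "\<dots> = 0"
  proof (rule sum.neutral, rule ballI)
    fix l assume "l \<in> {..<n}"
    then show "(B ^\<^sub>m k) $$ (i, l) * B $$ (l, j) = 0"
      using Suc.IH[of l] Suc.prems B(2)[of l j] by (cases "l < i + k") auto
  qed
  finally show ?case .
qed (use B in auto)

text \<open>In a similar triangular matrix the diagonal consists of eigenvalues, so the matrix is
  strictly triangular.\<close>

lemma mat_pow_eq_0_if_eigenvalues_0:
  fixes A :: "complex mat"
  assumes A: "A \<in> carrier_mat n n" and ev: "\<And>k. eigenvalue A k \<Longrightarrow> k = 0"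
  shows "A ^\<^sub>m n = 0\<^sub>m n n"
proof -
  from char_poly_factorized[OF A] obtain es where es: "char_poly A = (\<Prod>a\<leftarrow>es. [:- a, 1:])" by blast
  from schur_decomposition_exists[OF A es] obtain B where
    B: "B \<in> carrier_mat n n" "upper_triangular B" "similar_mat A B" by blast
  from B(3) obtain P Q where PQ: "similar_mat_wit A B P Q" unfolding similar_mat_def by blast
  note PQc = similar_mat_witD2[OF A PQ]
  have "B $$ (i, i) = 0" if "i < n" for i
  proof (rule ev)
    have "B $$ (i, i) \<in> set (diag_mat B)" using that B(1) by (auto simp: diag_mat_def)
    then have "poly (char_poly B) (B $$ (i, i)) = 0"
      unfolding char_poly_upper_triangular[OF B(1,2)]
      by (auto simp: poly_prod_list prod_list_zero_iff o_def)
    then show "eigenvalue A (B $$ (i, i))"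
      by (simp add: eigenvalue_root_char_poly[OF A] char_poly_similar[OF B(3)])
  qed
  then have "B $$ (i, j) = 0" if "i < n" "j \<le> i" for i j
    using that B by (cases "j = i") (auto simp: upper_triangular_def)
  from strictly_upper_triangular_pow[OF B(1) this] have "B ^\<^sub>m n = 0\<^sub>m n n"
    using B(1) by (intro eq_matI) auto
  then show ?thesis
    using similar_mat_wit_pow_id[OF PQ, of n] PQc by simp
qed

text \<open>The determinant is the value at \<open>1\<close> of the characteristic polynomial of
  \<open>- A\<close>, which is a power of the variable.\<close>

lemma det_one_plus_if_eigenvalues_0:
  fixes A :: "complex mat"
  assumes A: "A \<in> carrier_mat n n" and ev: "\<And>k. eigenvalue (- A) k \<Longrightarrow> k = 0"
  shows "det (1\<^sub>m n + A) = 1"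
proof -
  have A': "- A \<in> carrier_mat n n" using A by simp
  from char_poly_factorized[OF A'] obtain es where es: "char_poly (- A) = (\<Prod>a\<leftarrow>es. [:- a, 1:])" by blast
  have "a = 0" if "a \<in> set es" for a
    by (rule ev) (use that in \<open>auto simp: eigenvalue_root_char_poly[OF A'] es poly_prod_list prod_list_zero_iff o_def\<close>)
  then have "map (\<lambda>a. [:- a, 1:]) es = map (\<lambda>a. [:0, 1:]) es" by auto
  then have "char_poly (- A) = [:0, 1:] ^ length es" by (simp only: es) (simp add: map_replicate_const)
  then have "poly (char_poly (- A)) 1 = 1" by simp
  moreover have "- char_matrix (- A) 1 = 1\<^sub>m n + A"
    using A by (intro eq_matI) (auto simp: char_matrix_def)
  ultimately show ?thesis using char_poly_matrix[OF A', of 1] by simp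
qed

text \<open>The derivative of \<open>T(x, x, x)\<close> at \<open>x\<close> in direction
  \<open>v\<close>, with one summand for each slot.\<close>

definition jac :: "nat \<Rightarrow> tensor \<Rightarrow> (nat \<Rightarrow> complex) \<Rightarrow> (nat \<Rightarrow> complex) \<Rightarrow> nat \<Rightarrow> complex" where
  "jac n \<tau> x v i = tri n \<tau> v x x i + tri n \<tau> x v x i + tri n \<tau> x x v i"

text \<open>Iterates on vectors, rather than powers of a matrix, can be followed through linear maps
  and ring homomorphisms.\<close>

definition nilpotent :: "nat \<Rightarrow> tensor \<Rightarrow> bool" where
  "nilpotent n \<tau> \<longleftrightarrow> (\<exists>p. \<forall>x v. \<forall>i<n. (jac n \<tau> x ^^ p) v i = 0)"

lemma tri_add:
  "tri n \<tau> (\<lambda>j. u j + u' j) v w i = tri n \<tau> u v w i + tri n \<tau> u' v w i"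
  "tri n \<tau> u (\<lambda>j. v j + v' j) w i = tri n \<tau> u v w i + tri n \<tau> u v' w i"
  "tri n \<tau> u v (\<lambda>j. w j + w' j) i = tri n \<tau> u v w i + tri n \<tau> u v w' i"
  by (simp_all add: tri_def distrib_left distrib_right sum.distrib)

lemma tri_cmult:
  "tri n \<tau> (\<lambda>j. a * u j) v w i = a * tri n \<tau> u v w i"
  "tri n \<tau> u (\<lambda>j. a * v j) w i = a * tri n \<tau> u v w i"
  "tri n \<tau> u v (\<lambda>j. a * w j) i = a * tri n \<tau> u v w i"
  by (simp_all add: tri_def sum_distrib_left mult.left_commute mult.assoc)

lemma tri_line: "tri n \<tau> (\<lambda>j. x j + t * v j) (\<lambda>j. x j + t * v j) (\<lambda>j. x j + t * v j) i =
    tri n \<tau> x x x i + t * jac n \<tau> x v i + t\<^sup>2 * jac n \<tau> v x i + t ^ 3 * tri n \<tau> v v v i"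
  unfolding jac_def tri_add tri_cmult by (simp add: algebra_simps power2_eq_square power3_eq_cube)

text \<open>Polarization recovers the derivative from values on the diagonal alone, so that
  identities between cubic maps can be differentiated by algebra.\<close>

lemma jac_polar: "2 * jac n \<tau> x v i = tri n \<tau> (\<lambda>j. x j + v j) (\<lambda>j. x j + v j) (\<lambda>j. x j + v j) i
    - tri n \<tau> (\<lambda>j. x j - v j) (\<lambda>j. x j - v j) (\<lambda>j. x j - v j) i - 2 * tri n \<tau> v v v i"
  using tri_line[of n \<tau> x 1 v i] tri_line[of n \<tau> x "-1" v i] by simp

lemma jac_cong: "(\<And>j. j < n \<Longrightarrow> v j = v' j) \<Longrightarrow> jac n \<tau> x v i = jac n \<tau> x v' i"
  unfolding jac_def by (simp cong: tri_cong)

lemma jac_add: "jac n \<tau> x (\<lambda>j. u j + v j) i = jac n \<tau> x u i + jac n \<tau> x v i"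
  by (simp add: jac_def tri_add)

lemma jac_cmult: "jac n \<tau> x (\<lambda>j. a * v j) i = a * jac n \<tau> x v i"
  by (simp add: jac_def tri_cmult algebra_simps)

lemma jac_sum: "finite A \<Longrightarrow> jac n \<tau> x (\<lambda>j. \<Sum>a\<in>A. f a j) i = (\<Sum>a\<in>A. jac n \<tau> x (f a) i)"
proof (induction A rule: finite_induct)
  case empty
  then show ?case using jac_cmult[of n \<tau> x 0 "\<lambda>_. 0" i] by simp
qed (simp add: jac_add)

lemma jac_scale: "jac n \<tau> (\<lambda>j. s * x j) v i = s\<^sup>2 * jac n \<tau> x v i"
  by (simp add: jac_def tri_cmult algebra_simps power2_eq_square)

definition jac_mat :: "nat \<Rightarrow> tensor \<Rightarrow> (nat \<Rightarrow> complex) \<Rightarrow> complex mat" where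
  "jac_mat n \<tau> x = mat n n (\<lambda>(i, j). jac n \<tau> x (\<lambda>l. if l = j then 1 else 0) i)"

lemma jac_mat_carrier[simp]: "jac_mat n \<tau> x \<in> carrier_mat n n"
  by (simp add: jac_mat_def)

lemma jac_mat_dim[simp]: "dim_row (jac_mat n \<tau> x) = n" "dim_col (jac_mat n \<tau> x) = n"
  by (simp_all add: jac_mat_def)

lemma jac_mat_mult:
  assumes "w \<in> carrier_vec n" "i < n"
  shows "(jac_mat n \<tau> x *\<^sub>v w) $ i = jac n \<tau> x (\<lambda>j. w $ j) i"
proof -
  have "(jac_mat n \<tau> x *\<^sub>v w) $ i = (\<Sum>j<n. jac n \<tau> x (\<lambda>l. if l = j then 1 else 0) i * w $ j)"
    using assms by (simp add: jac_mat_def scalar_prod_def atLeast0LessThan)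
  also have "\<dots> = jac n \<tau> x (\<lambda>l. \<Sum>j<n. w $ j * (if l = j then 1 else 0)) i"
    by (simp add: jac_sum jac_cmult mult.commute)
  also have "\<dots> = jac n \<tau> x (\<lambda>j. w $ j) i"
    by (rule jac_cong) (simp add: if_distrib cong: if_cong)
  finally show ?thesis .
qed

lemma jac_mat_pow_mult:
  assumes "i < n"
  shows "(jac_mat n \<tau> x ^\<^sub>m p *\<^sub>v Matrix.vec n v) $ i = (jac n \<tau> x ^^ p) v i"
proof -
  have "\<forall>i<n. (jac_mat n \<tau> x ^\<^sub>m p *\<^sub>v Matrix.vec n v) $ i = (jac n \<tau> x ^^ p) v i"
  proof (induction p arbitrary: v)
    case (Suc p)
    have e: "jac_mat n \<tau> x *\<^sub>v Matrix.vec n v = Matrix.vec n (jac n \<tau> x v)"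
      by (intro eq_vecI) (auto simp: jac_mat_mult simp del: index_mult_mat_vec intro: jac_cong)
    have "jac_mat n \<tau> x ^\<^sub>m Suc p *\<^sub>v Matrix.vec n v
        = jac_mat n \<tau> x ^\<^sub>m p *\<^sub>v (jac_mat n \<tau> x *\<^sub>v Matrix.vec n v)"
      by (simp add: assoc_mult_mat_vec[of _ n n _ n])
    then show ?case unfolding e using Suc.IH[of "jac n \<tau> x v"] by (simp add: funpow_swap1)
  qed simp
  then show ?thesis using assms by blast
qed

text \<open>An eigenvector for a nonzero eigenvalue \<open>k\<close> would lie in the kernel of
  \<open>1 + s J\<close> for \<open>s = - 1 / k\<close>.\<close>

lemma nilpotent_if_unipotent:
  assumes "\<And>x s v. (\<And>i. i < n \<Longrightarrow> v i + s * jac n \<tau> x v i = 0) \<Longrightarrow> (\<And>i. i < n \<Longrightarrow> v i = 0)"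
  shows "nilpotent n \<tau>"
  unfolding nilpotent_def
proof (intro exI[of _ n] allI impI)
  fix x v i assume i: "i < n"
  have "jac_mat n \<tau> x ^\<^sub>m n = 0\<^sub>m n n"
  proof (rule mat_pow_eq_0_if_eigenvalues_0[OF jac_mat_carrier])
    fix k assume "eigenvalue (jac_mat n \<tau> x) k"
    then obtain w where w: "w \<in> carrier_vec n" "w \<noteq> 0\<^sub>v n" "jac_mat n \<tau> x *\<^sub>v w = k \<cdot>\<^sub>v w"
      unfolding eigenvalue_def eigenvector_def by (auto simp: jac_mat_def)
    show "k = 0"
    proof (rule ccontr)
      assume k: "k \<noteq> 0"
      have "w $ i + (- 1 / k) * jac n \<tau> x (\<lambda>j. w $ j) i = 0" if "i < n" for i
        using jac_mat_mult[OF w(1) that, of \<tau> x] w(1,3) that k by (simp add: field_simps)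
      from assms[OF this] have "w = 0\<^sub>v n" using w(1) by (intro eq_vecI) auto
      then show False using w by simp
    qed
  qed
  then show "(jac n \<tau> x ^^ n) v i = 0" using jac_mat_pow_mult[OF i, of \<tau> x n v] i by simp
qed

text \<open>On an eigenvector of the negated matrix the iterate of order \<open>p\<close> acts as
  \<open>(- k) ^ p\<close>; as it vanishes there, so does \<open>k\<close>.\<close>

lemma det_one_plus_jac_mat:
  assumes "nilpotent n \<tau>"
  shows "det (1\<^sub>m n + jac_mat n \<tau> x) = 1"
proof (rule det_one_plus_if_eigenvalues_0[OF jac_mat_carrier])
  fix k assume "eigenvalue (- jac_mat n \<tau> x) k"
  then obtain w where w: "w \<in> carrier_vec n" "w \<noteq> 0\<^sub>v n" "(- jac_mat n \<tau> x) *\<^sub>v w = k \<cdot>\<^sub>v w"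
    unfolding eigenvalue_def eigenvector_def by (auto simp: jac_mat_def)
  obtain p where p: "\<And>v i. i < n \<Longrightarrow> (jac n \<tau> x ^^ p) v i = 0"
    using assms unfolding nilpotent_def by blast
  have w': "jac n \<tau> x (\<lambda>j. w $ j) i = - k * w $ i" if "i < n" for i
  proof -
    have "((- jac_mat n \<tau> x) *\<^sub>v w) $ i = - ((jac_mat n \<tau> x *\<^sub>v w) $ i)"
      using that w(1) by (simp add: jac_mat_def scalar_prod_def sum_negf)
    then show ?thesis using jac_mat_mult[OF w(1) that, of \<tau> x] w that by simp
  qed
  have pow: "\<forall>i<n. (jac n \<tau> x ^^ m) (\<lambda>j. w $ j) i = (- k) ^ m * w $ i" for m
  proof (induction m)
    case (Suc m)
    have "jac n \<tau> x ((jac n \<tau> x ^^ m) (\<lambda>j. w $ j)) i = jac n \<tau> x (\<lambda>j. (- k) ^ m * w $ j) i" for i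
      by (rule jac_cong) (use Suc in auto)
    then show ?case by (simp add: jac_cmult w')
  qed simp
  obtain i where "i < n" "w $ i \<noteq> 0" using w(1,2) by (metis eq_vecI carrier_vecD index_zero_vec)
  then have "(- k) ^ p * w $ i = 0" using pow[of p] p[of i "\<lambda>j. w $ j"] by metis
  with \<open>w $ i \<noteq> 0\<close> show "k = 0" by simp
qed

lemma poly_fun_jac_pow_point:
  assumes "i < n"
  shows "\<exists>d. poly_fun n d (\<lambda>x. (jac n \<tau> x ^^ p) v i)"
proof -
  have "\<exists>d. \<forall>i<n. poly_fun n d (\<lambda>x. (jac n \<tau> x ^^ p) v i)"
  proof (induction p)
    case 0
    show ?case by (auto intro: poly_fun.const)
  next
    case (Suc p)
    then obtain d where d: "\<And>i. i < n \<Longrightarrow> poly_fun n d (\<lambda>x. (jac n \<tau> x ^^ p) v i)" by blast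
    have "poly_fun n (d + 2) (\<lambda>x. (jac n \<tau> x ^^ Suc p) v i)" if "i < n" for i
      unfolding funpow.simps o_apply jac_def[of n \<tau> _ "(jac n \<tau> _ ^^ p) v"]
      by (intro poly_fun.add poly_fun_tri[of _ _ d _ 1 _ 1] poly_fun_tri[of _ _ 1 _ d _ 1]
          poly_fun_tri[of _ _ 1 _ 1 _ d] d poly_fun.var) auto
    then show ?case by blast
  qed
  then show ?thesis using assms by blast
qed

lemma poly_fun_jac_pow_direction:
  assumes "i < n"
  shows "poly_fun n 1 (\<lambda>v. (jac n \<tau> x ^^ p) v i)"
proof -
  have "\<forall>i<n. poly_fun n 1 (\<lambda>v. (jac n \<tau> x ^^ p) v i)"
  proof (induction p)
    case 0
    show ?case by (auto intro: poly_fun.var)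
  next
    case (Suc p)
    have "poly_fun n 1 (\<lambda>v. (jac n \<tau> x ^^ Suc p) v i)" if "i < n" for i
      unfolding funpow.simps o_apply jac_def[of n \<tau> x "(jac n \<tau> x ^^ p) _"]
      by (intro poly_fun.add poly_fun_tri[of _ _ 1 _ 0 _ 0] poly_fun_tri[of _ _ 0 _ 1 _ 0]
          poly_fun_tri[of _ _ 0 _ 0 _ 1] poly_fun.const) (use Suc in auto)
    then show ?case by blast
  qed
  then show ?thesis using assms by blast
qed

text \<open>The iterate is polynomial in \<open>x\<close> for fixed \<open>v\<close> and polynomial
  in \<open>v\<close> for fixed \<open>x\<close>, so the two arguments are released from the
  naturals one after the other. Natural points are those that ring homomorphisms fix and that stay
  rational in a restriction of scalars.\<close>

lemma nilpotent_if_nat_points: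
  assumes "\<And>x v i. (\<forall>j. x j \<in> \<nat>) \<Longrightarrow> (\<forall>j. v j \<in> \<nat>) \<Longrightarrow> i < n \<Longrightarrow> (jac n \<tau> x ^^ p) v i = 0"
  shows "nilpotent n \<tau>"
  unfolding nilpotent_def
proof (intro exI[of _ p] allI impI)
  fix x v i assume i: "i < n"
  have *: "(jac n \<tau> x ^^ p) v i = 0" if "\<forall>j. v j \<in> \<nat>" for x v
    using poly_fun_jac_pow_point[OF i, where \<tau> = \<tau> and p = p and v = v]
      poly_fun_eq_0_if_nat_zeros assms that i by blast
  show "(jac n \<tau> x ^^ p) v i = 0"
    by (rule poly_fun_eq_0_if_nat_zeros[OF poly_fun_jac_pow_direction[OF i]]) (use * in auto)
qed

section \<open>Linear maps that carry one cubic map to another\<close>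

definition lin :: "nat \<Rightarrow> (nat \<Rightarrow> nat \<Rightarrow> complex) \<Rightarrow> (nat \<Rightarrow> complex) \<Rightarrow> nat \<Rightarrow> complex" where
  "lin n M u i = (\<Sum>j<n. M i j * u j)"

lemma lin_add: "lin n M (\<lambda>j. u j + v j) = (\<lambda>i. lin n M u i + lin n M v i)"
  by (simp add: lin_def[abs_def] distrib_left sum.distrib)

lemma lin_diff: "lin n M (\<lambda>j. u j - v j) = (\<lambda>i. lin n M u i - lin n M v i)"
  by (simp add: lin_def[abs_def] right_diff_distrib sum_subtractf)

lemma lin_cmult: "lin n M (\<lambda>j. a * u j) = (\<lambda>i. a * lin n M u i)"
  by (simp add: lin_def[abs_def] sum_distrib_left mult_ac)

lemma lin_0: "lin n M (\<lambda>_. 0) = (\<lambda>_. 0)"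
  by (simp add: lin_def[abs_def])

lemma lin_cong: "(\<And>j. j < n \<Longrightarrow> u j = v j) \<Longrightarrow> lin n M u = lin n M v"
  unfolding lin_def by auto

lemma poly_fun_lin: "poly_fun n 1 (\<lambda>u. lin n M u i)"
  unfolding lin_def by (intro poly_fun_sum poly_fun_cmult poly_fun.var) auto

text \<open>Linearity makes \<open>M\<close> carry the whole map of \<open>\<sigma>\<close> to that
  of \<open>\<tau>\<close> once it does so for the cubic parts; agreement on the diagonal also gives
  the derivatives, by polarization. The Druzkowski pairing and the restriction of scalars are the
  two instances.\<close>

locale cubic_intertwining =
  fixes n :: nat and \<sigma> :: tensor and m :: nat and \<tau> :: tensor and M :: "nat \<Rightarrow> nat \<Rightarrow> complex"
  assumes intertwine: "\<And>x i. i < m \<Longrightarrow>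
    lin n M (tri n \<sigma> x x x) i = tri m \<tau> (lin n M x) (lin n M x) (lin n M x) i"
begin

lemma jac_lin: "i < m \<Longrightarrow> lin n M (jac n \<sigma> x v) i = jac m \<tau> (lin n M x) (lin n M v) i"
proof -
  assume i: "i < m"
  have "2 * lin n M (jac n \<sigma> x v) i = lin n M (\<lambda>j. 2 * jac n \<sigma> x v j) i" by (simp add: lin_cmult)
  also have "\<dots> = 2 * jac m \<tau> (lin n M x) (lin n M v) i"
    unfolding jac_polar lin_diff lin_cmult intertwine[OF i] by (simp add: lin_add lin_diff)
  finally show ?thesis by simp
qed

lemma jac_pow_lin: "\<forall>i<m. lin n M ((jac n \<sigma> x ^^ p) v) i = (jac m \<tau> (lin n M x) ^^ p) (lin n M v) i"
proof (induction p)
  case (Suc p)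
  show ?case using Suc by (auto simp: jac_lin intro: jac_cong)
qed simp

text \<open>If \<open>G\<close> inverts the map above, then \<open>M \<circ> G \<circ> N\<close> inverts the map below.\<close>

lemma formal_inverse_descends:
  assumes N: "\<And>y i. i < m \<Longrightarrow> lin n M (lin m N y) i = y i"
    and "formal_inverse_terminates n \<sigma>"
  shows "formal_inverse_terminates m \<tau>"
proof -
  obtain b where 0: "\<And>y k i. b \<le> k \<Longrightarrow> i < n \<Longrightarrow> formal_inverse n \<sigma> y k i = 0"
    using assms(2) unfolding formal_inverse_terminates_def by blast
  let ?G = "truncated_inverse n \<sigma> b"
  define H where "H y = lin n M (?G (lin m N y))" for y
  have "\<exists>d. poly_fun m d (\<lambda>y. H y i)" for i
    unfolding H_def lin_def[of n M]
  proof -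
    have "\<exists>d. poly_fun m d (\<lambda>y. ?G (lin m N y) j)" if "j < n" for j
      using poly_fun_compose[OF poly_fun_truncated_inverse[OF that]] poly_fun_lin by blast
    then show "\<exists>d. poly_fun m d (\<lambda>y. \<Sum>j<n. M i j * ?G (lin m N y) j)"
      using poly_fun_compose[OF poly_fun_lin[of n M i], of m "\<lambda>y. ?G (lin m N y)"]
      by (simp add: lin_def[of n M])
  qed
  then obtain d where d: "\<And>i. poly_fun m (d i) (\<lambda>y. H y i)" by metis
  have D: "poly_fun m (\<Sum>i<m. d i) (\<lambda>y. H y i)" if "i < m" for i
    by (rule poly_fun_mono[OF d]) (use that in \<open>auto intro: member_le_sum\<close>)
  have FH: "cubic_map m \<tau> (H y) i = y i" if i: "i < m" for y i
  proof -
    have "lin n M (cubic_map n \<sigma> (?G (lin m N y))) i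
        = lin n M (\<lambda>j. ?G (lin m N y) j + tri n \<sigma> (?G (lin m N y)) (?G (lin m N y)) (?G (lin m N y)) j) i"
      by (simp add: lin_def cubic_map_def)
    also have "\<dots> = cubic_map m \<tau> (H y) i"
      using i by (simp add: lin_add intertwine cubic_map_def H_def)
    finally show ?thesis using cubic_map_truncated_inverse[OF 0] N[OF i] by simp
  qed
  have H0: "H (\<lambda>_. 0) i = 0" for i
    by (simp add: H_def lin_0) (simp add: lin_def truncated_inverse_def formal_inverse_0)
  show ?thesis by (rule formal_inverse_terminates_if_inverse[OF D FH H0])
qed

end

section \<open>Druzkowski maps\<close>

definition cube_tensor :: "(nat \<Rightarrow> nat \<Rightarrow> complex) \<Rightarrow> tensor" where
  "cube_tensor A i j k l = A i j * (A i k * A i l)"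

lemma tri_cube_tensor: "tri n (cube_tensor A) u v w i = lin n A u i * (lin n A v i * lin n A w i)"
proof -
  have "lin n A u i * (lin n A v i * lin n A w i)
      = (\<Sum>j<n. \<Sum>k<n. \<Sum>l<n. (A i j * u j) * ((A i k * v k) * (A i l * w l)))"
    unfolding lin_def sum_product by (simp add: sum_distrib_left)
  also have "\<dots> = tri n (cube_tensor A) u v w i"
    unfolding tri_def cube_tensor_def by (intro sum.cong refl) (simp add: mult_ac)
  finally show ?thesis by simp
qed

text \<open>For \<open>e < 4\<close> the index belongs to one of four sign patterns of a monomial:
  \<open>e = 1\<close>, \<open>2\<close>, \<open>3\<close> negates the variable \<open>l\<close>,
  \<open>k\<close>, \<open>j\<close>. The denominator 24 is the origin of the integrality condition
  on \<open>\<tau> i j k l / 24\<close>.\<close>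

definition cube_column :: "tensor \<Rightarrow> nat \<Rightarrow> nat \<times> nat \<times> nat \<times> nat \<Rightarrow> complex" where
  "cube_column \<tau> i = (\<lambda>(j, k, l, e). if e = 4 then (if k = 0 \<and> l = 0 \<and> i = j then 1 else 0)
     else (if e = 0 then 1 else - 1) * (\<tau> i j k l / 24))"

definition cube_row :: "nat \<times> nat \<times> nat \<times> nat \<Rightarrow> nat \<Rightarrow> complex" where
  "cube_row = (\<lambda>(j, k, l, e) m. if e = 4 then 0 else
     (if e = 3 then - 1 else 1) * (if m = j then 1 else 0)
     + (if e = 2 then - 1 else 1) * (if m = k then 1 else 0)
     + (if e = 1 then - 1 else 1) * (if m = l then 1 else 0))"

text \<open>Every cubic form is a combination of cubes of linear forms, because
  \<open>24xyz = (x + y + z)\<^sup>3 - (x + y - z)\<^sup>3 - (x - y + z)\<^sup>3 - (- x + y + z)\<^sup>3\<close>.  The terms with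
  \<open>e = 4\<close> vanish; they only make the matrix of columns surjective.\<close>

lemma sum_cubes_eq_tri:
  "(\<Sum>s\<in>{..<n} \<times> {..<n} \<times> {..<n} \<times> {..<5}. cube_column \<tau> i s * (\<Sum>m<n. cube_row s m * x m) ^ 3)
    = tri n \<tau> x x x i"
proof -
  have lin3: "(\<Sum>m<n. (a * (if m = j then 1 else 0) + b * (if m = k then 1 else 0)
      + c * (if m = l then 1 else 0)) * x m) = a * x j + b * x k + c * x l"
    if "j < n" "k < n" "l < n" for a b c :: complex and j k l
  proof -
    have "(\<Sum>m<n. (a * (if m = j then 1 else 0) + b * (if m = k then 1 else 0)
      + c * (if m = l then 1 else 0)) * x m)
      = (\<Sum>m<n. (if m = j then a * x m else 0) + (if m = k then b * x m else 0)
      + (if m = l then c * x m else 0))" by (intro sum.cong) (auto simp: algebra_simps)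
    then show ?thesis using that by (simp add: sum.distrib)
  qed
  have "(\<Sum>e<5. cube_column \<tau> i (j, k, l, e) * (\<Sum>m<n. cube_row (j, k, l, e) m * x m) ^ 3)
      = \<tau> i j k l * (x j * (x k * x l))" if *: "j < n" "k < n" "l < n" for j k l
  proof -
    have five: "(\<Sum>e<5. f e) = f 0 + f 1 + f 2 + f 3 + f 4" for f :: "nat \<Rightarrow> complex"
      by (simp add: eval_nat_numeral)
    have "(\<Sum>m<n. cube_row (j, k, l, 4) m * x m) = 0"
      by (simp add: cube_row_def)
    moreover have "(\<Sum>m<n. cube_row (j, k, l, 0) m * x m) = x j + x k + x l"
      "(\<Sum>m<n. cube_row (j, k, l, 1) m * x m) = x j + x k - x l"
      "(\<Sum>m<n. cube_row (j, k, l, 2) m * x m) = x j - x k + x l"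
      "(\<Sum>m<n. cube_row (j, k, l, 3) m * x m) = - x j + x k + x l"
      using lin3[OF *, of 1 1 1] lin3[OF *, of 1 1 "-1"] lin3[OF *, of 1 "-1" 1] lin3[OF *, of "-1" 1 1]
      by (simp_all add: cube_row_def)
    ultimately have "(\<Sum>e<5. cube_column \<tau> i (j, k, l, e) * (\<Sum>m<n. cube_row (j, k, l, e) m * x m) ^ 3)
        = \<tau> i j k l / 24 * ((x j + x k + x l) ^ 3 - (x j + x k - x l) ^ 3
          - (x j - x k + x l) ^ 3 - (- x j + x k + x l) ^ 3)"
      by (simp only: five) (simp add: cube_column_def algebra_simps)
    also have "\<dots> = \<tau> i j k l * (x j * (x k * x l))"
      by (simp add: power3_eq_cube field_simps)
    finally show ?thesis .
  qed
  then show ?thesis unfolding tri_def sum.cartesian_product' by simp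
qed

text \<open>The pairing of Gorni and Zampieri: a cubic map \<open>x + C (B x)\<^sup>3\<close> is a quotient, by \<open>C\<close>, of the
  Druzkowski map of \<open>A = B C\<close>.\<close>

lemma druzkowski_reduction:
  assumes n: "0 < n" and nil: "nilpotent n \<tau>"
  obtains m A where "0 < m" "nilpotent m (cube_tensor A)"
    "formal_inverse_terminates m (cube_tensor A) \<Longrightarrow> formal_inverse_terminates n \<tau>"
    "(\<forall>i j k l. \<tau> i j k l / 24 \<in> \<int>) \<longrightarrow> (\<forall>r s. A r s \<in> \<int>)"
proof -
  define S where "S = {..<n} \<times> {..<n} \<times> {..<n} \<times> {..<5::nat}"
  define m where "m = card S"
  have "finite S" by (simp add: S_def)
  then obtain h where h: "bij_betw h {..<m} S"
    unfolding m_def using ex_bij_betw_nat_finite[of S] by (auto simp: atLeast0LessThan)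
  define C where "C i r = cube_column \<tau> i (h r)" for i r
  define B where "B r j = cube_row (h r) j" for r j
  define A where "A r s = (\<Sum>j<n. B r j * C j s)" for r s
  \<comment> \<open>\<open>N\<close> selects the columns with index \<open>(i, 0, 0, 4)\<close>.
    They are the unit vectors, so \<open>N\<close> is a right inverse of \<open>C\<close>.\<close>
  define N where "N r i = (if h r = (i, 0, 0, 4) then 1 else 0 :: complex)" for r i
  have S: "(\<Sum>r<m. f (h r)) = (\<Sum>s\<in>S. f s)" for f :: "_ \<Rightarrow> complex"
    using sum.reindex_bij_betw[OF h] .
  have AX: "lin m A X r = lin n B (lin m C X) r" for X r
  proof -
    have "lin m A X r = (\<Sum>s<m. \<Sum>j<n. B r j * (C j s * X s))"
      by (simp add: lin_def A_def sum_distrib_right mult.assoc)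
    also have "\<dots> = (\<Sum>j<n. \<Sum>s<m. B r j * (C j s * X s))" by (rule sum.swap)
    finally show ?thesis by (simp add: lin_def sum_distrib_left)
  qed
  interpret cubic_intertwining m "cube_tensor A" n \<tau> C
  proof
    fix X i
    have "lin m C (tri m (cube_tensor A) X X X) i = (\<Sum>r<m. C i r * lin n B (lin m C X) r ^ 3)"
      by (simp add: lin_def[of m C "tri _ _ _ _ _"] tri_cube_tensor AX power3_eq_cube mult.assoc)
    also have "\<dots> = tri n \<tau> (lin m C X) (lin m C X) (lin m C X) i"
    proof -
      have "(\<Sum>r<m. C i r * (\<Sum>j<n. B r j * z j) ^ 3) = tri n \<tau> z z z i" for z
        unfolding C_def B_def
        using S[of "\<lambda>s. cube_column \<tau> i s * (\<Sum>j<n. cube_row s j * z j) ^ 3"]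
        unfolding S_def sum_cubes_eq_tri .
      then show ?thesis by (simp add: lin_def[of n])
    qed
    finally show "lin m C (tri m (cube_tensor A) X X X) i = tri n \<tau> (lin m C X) (lin m C X) (lin m C X) i" .
  qed
  have CN: "lin m C (lin n N y) i = y i" if i: "i < n" for y i
  proof -
    have "lin m C (lin n N y) i = (\<Sum>s\<in>S. cube_column \<tau> i s * (\<Sum>j<n. (if s = (j, 0, 0, 4) then 1 else 0) * y j))"
      unfolding lin_def C_def N_def by (rule S)
    also have "\<dots> = (\<Sum>j<n. \<Sum>s\<in>S. if s = (j, 0, 0, 4) then cube_column \<tau> i s * y j else 0)"
      unfolding sum_distrib_left by (subst sum.swap) (intro sum.cong; simp)
    also have "\<dots> = (\<Sum>j<n. cube_column \<tau> i (j, 0, 0, 4) * y j)"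
      using n \<open>finite S\<close> by (intro sum.cong refl) (simp add: S_def)
    also have "\<dots> = (\<Sum>j<n. if j = i then y j else 0)"
      by (intro sum.cong) (auto simp: cube_column_def)
    finally show ?thesis using i by simp
  qed
  show thesis
  proof
    show "0 < m" using n by (auto simp: m_def S_def card_cartesian_product)
    obtain p where p: "\<And>x v i. i < n \<Longrightarrow> (jac n \<tau> x ^^ p) v i = 0"
      using nil unfolding nilpotent_def by blast
    \<comment> \<open>Since \<open>A = B C\<close>, the derivative sees \<open>W\<close> only
      through \<open>C W\<close>. The image under \<open>C\<close> of the iterate of order
      \<open>p\<close> is zero, so one further iteration kills it upstairs.\<close>
    have ker: "jac m (cube_tensor A) X W r = 0" if "\<And>i. i < n \<Longrightarrow> lin m C W i = 0" for X W r
    proof -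
      have "lin m A W r = 0" unfolding AX lin_def[of n] using that by simp
      then show ?thesis by (simp add: jac_def tri_cube_tensor)
    qed
    have "(jac m (cube_tensor A) X ^^ Suc p) V r = 0" for X V r
      using ker jac_pow_lin[where x = X and p = p and v = V] p by simp
    then show "nilpotent m (cube_tensor A)" unfolding nilpotent_def by blast
    show "formal_inverse_terminates n \<tau>" if "formal_inverse_terminates m (cube_tensor A)"
      by (rule formal_inverse_descends[OF CN that])
    show "(\<forall>i j k l. \<tau> i j k l / 24 \<in> \<int>) \<longrightarrow> (\<forall>r s. A r s \<in> \<int>)"
    proof (intro impI allI)
      fix r s assume \<tau>: "\<forall>i j k l. \<tau> i j k l / 24 \<in> \<int>"
      have "cube_column \<tau> i t \<in> \<int>" for i t
        using \<tau> by (cases t) (auto simp: cube_column_def minus_in_Ints_iff)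
      moreover have "cube_row t j \<in> \<int>" for t j
        by (cases t) (auto simp: cube_row_def)
      ultimately show "A r s \<in> \<int>" unfolding A_def B_def C_def by (intro Ints_sum Ints_mult)
    qed
  qed
qed

lemma druzkowski_map_index:
  assumes "A \<in> carrier_mat n n" "x \<in> carrier_vec n" "i < n"
  shows "druzkowski_map A x $ i = cubic_map n (cube_tensor (\<lambda>r s. A $$ (r, s))) (\<lambda>j. x $ j) i"
proof -
  have "(A *\<^sub>v x) $ i = lin n (\<lambda>r s. A $$ (r, s)) (\<lambda>j. x $ j) i"
    using assms by (simp add: lin_def scalar_prod_def atLeast0LessThan)
  then show ?thesis
    using assms by (simp add: druzkowski_map_def cube_vec_def cubic_map_def tri_cube_tensor power3_eq_cube mult.assoc
        del: index_mult_mat_vec)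
qed

lemma druzkowski_map_carrier:
  "A \<in> carrier_mat n n \<Longrightarrow> x \<in> carrier_vec n \<Longrightarrow> druzkowski_map A x \<in> carrier_vec n"
  by (simp add: druzkowski_map_def cube_vec_def)

lemma jacobian_druzkowski_map:
  assumes A: "A \<in> carrier_mat n n" and x: "x \<in> carrier_vec n"
  shows "jacobian_mat n (druzkowski_map A) x
    = 1\<^sub>m n + jac_mat n (cube_tensor (\<lambda>r s. A $$ (r, s))) (\<lambda>j. x $ j)"
proof (rule eq_matI)
  let ?\<tau> = "cube_tensor (\<lambda>r s. A $$ (r, s))"
  fix i j assume "i < dim_row (1\<^sub>m n + jac_mat n ?\<tau> (\<lambda>j. x $ j))"
    "j < dim_col (1\<^sub>m n + jac_mat n ?\<tau> (\<lambda>j. x $ j))"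
  then have ij: "i < n" "j < n" by simp_all
  let ?e = "\<lambda>l. if l = j then 1 else 0 :: complex"
  let ?x = "\<lambda>l. x $ l"
  have F: "druzkowski_map A (x + t \<cdot>\<^sub>v unit_vec n j) $ i = x $ i + t * ?e i + (tri n ?\<tau> ?x ?x ?x i
      + t * jac n ?\<tau> ?x ?e i + t\<^sup>2 * jac n ?\<tau> ?e ?x i + t ^ 3 * tri n ?\<tau> ?e ?e ?e i)" for t
  proof -
    have 1: "(x + t \<cdot>\<^sub>v unit_vec n j) $ l = x $ l + t * ?e l" if "l < n" for l
      using x ij that by (simp add: unit_vec_def)
    have "druzkowski_map A (x + t \<cdot>\<^sub>v unit_vec n j) $ i
        = x $ i + t * ?e i + tri n ?\<tau> (\<lambda>l. x $ l + t * ?e l) (\<lambda>l. x $ l + t * ?e l) (\<lambda>l. x $ l + t * ?e l) i"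
      using druzkowski_map_index[OF A _ ij(1), of "x + t \<cdot>\<^sub>v unit_vec n j"] x ij
      by (simp add: cubic_map_def 1 cong: tri_cong)
    then show ?thesis unfolding tri_line .
  qed
  have "((\<lambda>t. druzkowski_map A (x + t \<cdot>\<^sub>v unit_vec n j) $ i) has_field_derivative (?e i + jac n ?\<tau> ?x ?e i)) (at 0)"
    unfolding F by (auto intro!: derivative_eq_intros)
  then show "jacobian_mat n (druzkowski_map A) x $$ (i, j) = (1\<^sub>m n + jac_mat n ?\<tau> ?x) $$ (i, j)"
    using ij by (simp add: jacobian_mat_def DERIV_imp_deriv jac_mat_def)
qed (simp_all add: jacobian_mat_def)

lemma druzkowski_mat_if_nilpotent:
  assumes "nilpotent n (cube_tensor A)"
  shows "druzkowski_mat n (mat n n (\<lambda>(r, s). A r s))"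
proof -
  let ?A = "mat n n (\<lambda>(r, s). A r s)"
  have e: "jac n (cube_tensor (\<lambda>r s. ?A $$ (r, s))) x v i = jac n (cube_tensor A) x v i" if "i < n" for x v i
    using that unfolding jac_def tri_cube_tensor lin_def by simp
  have "jac_mat n (cube_tensor (\<lambda>r s. ?A $$ (r, s))) x = jac_mat n (cube_tensor A) x" for x
    unfolding jac_mat_def using e by (intro cong_mat) auto
  then show ?thesis using det_one_plus_jac_mat[OF assms]
    by (simp add: druzkowski_mat_def jacobian_druzkowski_map)
qed

lemma polynomial_map_index:
  assumes "polynomial_map n G"
  shows "\<exists>d. \<forall>i<n. poly_fun n d (\<lambda>y. G (Matrix.vec n y) $ i)"
proof -
  obtain d c where G: "\<And>x. x \<in> carrier_vec n \<Longrightarrow> G x = eval_coeffs n d c x"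
    using assms unfolding polynomial_map_def has_coeffs_def by blast
  have "G (Matrix.vec n y) $ i = (\<Sum>m\<in>multi_indices n d. c (i, m) * monomial_fun n m y)" if "i < n" for y i
    using that by (simp add: G eval_coeffs_def monomial_fun_def)
  then show ?thesis by (intro exI[of _ d]) (simp add: poly_fun_sum_monomials)
qed

lemma formal_inverse_druzkowski:
  assumes A: "A \<in> carrier_mat n n" and inv: "has_polynomial_inverse n (druzkowski_map A)"
  shows "formal_inverse_terminates n (cube_tensor (\<lambda>r s. A $$ (r, s)))"
proof -
  let ?\<tau> = "cube_tensor (\<lambda>r s. A $$ (r, s))" and ?F = "druzkowski_map A"
  obtain G where G: "polynomial_map n G" and GF: "\<And>x. x \<in> carrier_vec n \<Longrightarrow> G (?F x) = x"
    and FG: "\<And>x. x \<in> carrier_vec n \<Longrightarrow> ?F (G x) = x"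
    using inv unfolding has_polynomial_inverse_def by blast
  have Gc: "G x \<in> carrier_vec n" if "x \<in> carrier_vec n" for x
    using G that unfolding polynomial_map_def has_coeffs_def by (auto simp: eval_coeffs_def)
  define H where "H y i = G (Matrix.vec n y) $ i" for y i
  obtain d where "\<And>i. i < n \<Longrightarrow> poly_fun n d (\<lambda>y. H y i)"
    using polynomial_map_index[OF G] by (auto simp: H_def)
  moreover have "cubic_map n ?\<tau> (H y) i = y i" if "i < n" for y i
    using druzkowski_map_index[OF A Gc that, of "Matrix.vec n y"] FG[of "Matrix.vec n y"] that
    by (simp add: H_def[abs_def])
  \<comment> \<open>The comparison with the formal inverse asks for an inverse that fixes the
    origin; this holds because \<open>F\<close> fixes it.\<close>
  moreover have "H (\<lambda>_. 0) i = 0" if "i < n" for i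
  proof -
    have "?F (0\<^sub>v n) = 0\<^sub>v n"
      using A druzkowski_map_carrier[OF A, of "0\<^sub>v n"]
      by (intro eq_vecI) (auto simp: druzkowski_map_def cube_vec_def)
    then have "G (0\<^sub>v n) = 0\<^sub>v n" using GF[of "0\<^sub>v n"] by simp
    moreover have "Matrix.vec n (\<lambda>_. 0) = (0\<^sub>v n :: complex Matrix.vec)" by auto
    ultimately show ?thesis using that by (simp add: H_def)
  qed
  ultimately show ?thesis by (rule formal_inverse_terminates_if_inverse)
qed

section \<open>Reduction to cubic homogeneous maps\<close>

text \<open>The number of variables is hidden because the reductions below keep adding new
  ones.\<close>

definition pol :: "((nat \<Rightarrow> complex) \<Rightarrow> complex) \<Rightarrow> bool" where
  "pol f \<longleftrightarrow> (\<exists>n d. poly_fun n d f)"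

lemma pol_const: "pol (\<lambda>x. a)"
  unfolding pol_def by (blast intro: poly_fun.const)

lemma pol_var: "pol (\<lambda>x. x i)"
  unfolding pol_def by (rule exI[of _ "Suc i"], rule exI[of _ 1]) (simp add: poly_fun.var)

lemma pol_add: "pol f \<Longrightarrow> pol g \<Longrightarrow> pol (\<lambda>x. f x + g x)"
proof -
  assume "pol f" "pol g"
  then obtain n d m e where "poly_fun n d f" "poly_fun m e g" unfolding pol_def by blast
  then have "poly_fun (max n m) (max d e) f" "poly_fun (max n m) (max d e) g"
    by (auto elim: poly_fun_mono)
  then show ?thesis unfolding pol_def by (blast intro: poly_fun.add)
qed

lemma pol_mult: "pol f \<Longrightarrow> pol g \<Longrightarrow> pol (\<lambda>x. f x * g x)"
proof -
  assume "pol f" "pol g"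
  then obtain n d m e where "poly_fun n d f" "poly_fun m e g" unfolding pol_def by blast
  then have "poly_fun (max n m) d f" "poly_fun (max n m) e g"
    by (auto elim: poly_fun_mono)
  from poly_fun.mult[OF this order.refl] show ?thesis unfolding pol_def by blast
qed

lemma pol_prod_list: "pol (\<lambda>x. \<Prod>j\<leftarrow>js. x j)"
  by (induction js) (simp_all add: pol_const pol_mult pol_var)

lemma poly_fun_pol_compose:
  assumes "poly_fun n d f" "\<And>i. pol (\<lambda>x. E x i)"
  shows "pol (\<lambda>x. f (E x))"
  using assms by induction (simp_all add: pol_const pol_add pol_mult)

lemma pol_compose: "pol f \<Longrightarrow> (\<And>i. pol (\<lambda>x. E x i)) \<Longrightarrow> pol (\<lambda>x. f (E x))"
  unfolding pol_def[of f] using poly_fun_pol_compose by blast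

lemma pol_chain_rule:
  assumes "pol f"
  shows "\<exists>n D. \<forall>\<gamma>'. (\<forall>j. ((\<lambda>t. \<gamma> t j) has_field_derivative \<gamma>' j) (at 0)) \<longrightarrow>
    ((\<lambda>t::complex. f (\<gamma> t)) has_field_derivative (\<Sum>j<n. D j * \<gamma>' j)) (at 0)"
proof -
  obtain n d where "poly_fun n d f" using assms unfolding pol_def by blast
  from poly_fun_chain_rule[OF this, of "\<gamma> 0"] show ?thesis by blast
qed

text \<open>Invertibility of the Jacobian matrix is expressed through curves.  In this form it is visibly
  preserved by composition with polynomial automorphisms.\<close>

definition keller :: "((nat \<Rightarrow> complex) \<Rightarrow> nat \<Rightarrow> complex) \<Rightarrow> bool" where
  "keller F \<longleftrightarrow> (\<forall>\<gamma>. (\<forall>i. (\<lambda>t. \<gamma> t i) field_differentiable (at 0)) \<longrightarrow>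
    (\<forall>i. ((\<lambda>t. F (\<gamma> t) i) has_field_derivative 0) (at 0)) \<longrightarrow>
    (\<forall>i. ((\<lambda>t. \<gamma> t i) has_field_derivative 0) (at 0)))"

definition pol_map :: "((nat \<Rightarrow> complex) \<Rightarrow> nat \<Rightarrow> complex) \<Rightarrow> bool" where
  "pol_map F \<longleftrightarrow> (\<forall>i. pol (\<lambda>x. F x i))"

definition pol_inverse :: "((nat \<Rightarrow> complex) \<Rightarrow> nat \<Rightarrow> complex) \<Rightarrow> ((nat \<Rightarrow> complex) \<Rightarrow> nat \<Rightarrow> complex) \<Rightarrow> bool" where
  "pol_inverse F G \<longleftrightarrow> pol_map G \<and> (\<forall>x. G (F x) = x \<and> F (G x) = x)"

lemma pol_map_compose: "pol_map F \<Longrightarrow> pol_map E \<Longrightarrow> pol_map (F \<circ> E)"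
  unfolding pol_map_def o_def
proof
  fix i
  assume "\<forall>i. pol (\<lambda>x. F x i)" "\<forall>i. pol (\<lambda>x. E x i)"
  then show "pol (\<lambda>x. F (E x) i)" by (intro pol_compose[of "\<lambda>x. F x i" E]) auto
qed

lemma pol_map_differentiable:
  assumes "pol_map F" "\<And>i. (\<lambda>t. \<gamma> t i) field_differentiable (at 0)"
  shows "(\<lambda>t. F (\<gamma> t) i) field_differentiable (at 0)"
proof -
  obtain \<gamma>' where \<gamma>': "\<And>i. ((\<lambda>t. \<gamma> t i) has_field_derivative \<gamma>' i) (at 0)"
    using assms(2) unfolding field_differentiable_def by metis
  have "pol (\<lambda>x. F x i)" using assms(1) by (simp add: pol_map_def)
  from pol_chain_rule[OF this, of \<gamma>] \<gamma>' show ?thesis unfolding field_differentiable_def by blast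
qed

lemma pol_map_derivative_0:
  assumes "pol_map F" "\<And>i. ((\<lambda>t. \<gamma> t i) has_field_derivative 0) (at 0)"
  shows "((\<lambda>t. F (\<gamma> t) i) has_field_derivative 0) (at 0)"
proof -
  have "pol (\<lambda>x. F x i)" using assms(1) by (simp add: pol_map_def)
  from pol_chain_rule[OF this, of \<gamma>] obtain n D where "\<And>\<gamma>'. (\<forall>j. ((\<lambda>t. \<gamma> t j) has_field_derivative \<gamma>' j) (at 0)) \<Longrightarrow>
    ((\<lambda>t. F (\<gamma> t) i) has_field_derivative (\<Sum>j<n. D j * \<gamma>' j)) (at 0)" by blast
  from this[of "\<lambda>_. 0"] assms(2) show ?thesis by simp
qed

lemma keller_compose: "keller F \<Longrightarrow> keller E \<Longrightarrow> pol_map E \<Longrightarrow> keller (F \<circ> E)"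
  unfolding keller_def o_def
proof (intro allI impI)
  fix \<gamma> i
  assume F: "\<forall>\<gamma>. (\<forall>i. (\<lambda>t. \<gamma> t i) field_differentiable at 0) \<longrightarrow>
      (\<forall>i. ((\<lambda>t. F (\<gamma> t) i) has_field_derivative 0) (at 0)) \<longrightarrow> (\<forall>i. ((\<lambda>t. \<gamma> t i) has_field_derivative 0) (at 0))"
    and E: "\<forall>\<gamma>. (\<forall>i. (\<lambda>t. \<gamma> t i) field_differentiable at 0) \<longrightarrow>
      (\<forall>i. ((\<lambda>t. E (\<gamma> t) i) has_field_derivative 0) (at 0)) \<longrightarrow> (\<forall>i. ((\<lambda>t. \<gamma> t i) has_field_derivative 0) (at 0))"
    and "pol_map E" and \<gamma>: "\<forall>i. (\<lambda>t. \<gamma> t i) field_differentiable at 0"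
    and "\<forall>i. ((\<lambda>t. F (E (\<gamma> t)) i) has_field_derivative 0) (at 0)"
  moreover from \<open>pol_map E\<close> \<gamma> have "\<forall>i. (\<lambda>t. E (\<gamma> t) i) field_differentiable at 0"
    by (blast intro: pol_map_differentiable)
  ultimately have "\<forall>i. ((\<lambda>t. E (\<gamma> t) i) has_field_derivative 0) (at 0)"
    using F[rule_format, of "\<lambda>t. E (\<gamma> t)"] by blast
  with E[rule_format, of \<gamma>] \<gamma> show "((\<lambda>t. \<gamma> t i) has_field_derivative 0) (at 0)" by blast
qed

text \<open>The curve is \<open>G (F (\<gamma> t))\<close>, and \<open>G\<close> carries stationary
  curves to stationary curves.\<close>

lemma keller_if_pol_inverse: "pol_inverse F G \<Longrightarrow> keller F"
  unfolding keller_def pol_inverse_def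
proof (intro allI impI)
  fix \<gamma> :: "complex \<Rightarrow> nat \<Rightarrow> complex" and i
  assume G: "pol_map G \<and> (\<forall>x. G (F x) = x \<and> F (G x) = x)"
    and "\<forall>i. ((\<lambda>t. F (\<gamma> t) i) has_field_derivative 0) (at 0)"
  then show "((\<lambda>t. \<gamma> t i) has_field_derivative 0) (at 0)"
    using pol_map_derivative_0[of G "\<lambda>t. F (\<gamma> t)" i] by simp
qed

lemma pol_inverse_compose:
  "pol_inverse F G \<Longrightarrow> pol_inverse E H \<Longrightarrow> pol_inverse (F \<circ> E) (H \<circ> G)"
  unfolding pol_inverse_def by (auto intro: pol_map_compose)

text \<open>The term \<open>(i, a, js)\<close> contributes \<open>a\<close> times the product of the variables \<open>js\<close> to the
  \<open>i\<close>-th component.\<close>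

type_synonym terms = "(nat \<times> complex \<times> nat list) list"

definition term_sum :: "terms \<Rightarrow> (nat \<Rightarrow> complex) \<Rightarrow> nat \<Rightarrow> complex" where
  "term_sum ts x i = (\<Sum>(i', a, js)\<leftarrow>ts. if i' = i then a * (\<Prod>j\<leftarrow>js. x j) else 0)"

definition term_map :: "terms \<Rightarrow> (nat \<Rightarrow> complex) \<Rightarrow> nat \<Rightarrow> complex" where
  "term_map ts x i = x i + term_sum ts x i"

definition terms_below :: "nat \<Rightarrow> terms \<Rightarrow> bool" where
  "terms_below n ts \<longleftrightarrow> (\<forall>(i, a, js)\<in>set ts. i < n \<and> set js \<subseteq> {..<n})"

lemma terms_below_Cons: "terms_below n ((i, a, js) # ts) \<longleftrightarrow> i < n \<and> set js \<subseteq> {..<n} \<and> terms_below n ts"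
  by (auto simp: terms_below_def)

lemma terms_below_mono: "n \<le> m \<Longrightarrow> terms_below n ts \<Longrightarrow> terms_below m ts"
  unfolding terms_below_def by fastforce

lemma term_sum_Nil[simp]: "term_sum [] x i = 0"
  by (simp add: term_sum_def)

lemma term_sum_Cons[simp]: "term_sum ((i', a, js) # ts) x i =
    (if i' = i then a * (\<Prod>j\<leftarrow>js. x j) else 0) + term_sum ts x i"
  by (simp add: term_sum_def)

lemma term_sum_append[simp]: "term_sum (ts @ us) x i = term_sum ts x i + term_sum us x i"
  by (simp add: term_sum_def)

lemma pol_term_sum: "pol (\<lambda>x. term_sum ts x i)"
proof (induction ts)
  case (Cons t ts)
  obtain i' a js where "t = (i', a, js)" by (cases t)
  then show ?case
    using Cons by (cases "i' = i") (auto intro!: pol_add pol_mult pol_const pol_prod_list)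
qed (simp add: pol_const)

lemma pol_map_term_map: "pol_map (term_map ts)"
  unfolding pol_map_def term_map_def by (intro allI pol_add pol_var pol_term_sum)

lemma term_sum_cong:
  assumes "\<And>a js j. (i, a, js) \<in> set ts \<Longrightarrow> j \<in> set js \<Longrightarrow> x j = y j"
  shows "term_sum ts x i = term_sum ts y i"
  using assms
proof (induction ts)
  case (Cons t ts)
  obtain i' a js where t: "t = (i', a, js)" by (cases t)
  have "term_sum ts x i = term_sum ts y i" using Cons by (meson list.set_intros(2))
  moreover have "i' = i \<Longrightarrow> map x js = map y js" using Cons.prems[of a js] by (auto simp: t)
  ultimately show ?case by (auto simp: t simp del: map_eq_conv)
qed simp

lemma term_sum_below_cong:
  assumes "terms_below n ts" "\<And>j. j < n \<Longrightarrow> x j = y j"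
  shows "term_sum ts x i = term_sum ts y i"
  by (rule term_sum_cong) (use assms in \<open>force simp: terms_below_def\<close>)

lemma term_sum_eq_0: "(\<And>a js. (i, a, js) \<notin> set ts) \<Longrightarrow> term_sum ts x i = 0"
proof (induction ts)
  case (Cons t ts)
  obtain i' a js where t: "t = (i', a, js)" by (cases t)
  then have "i' \<noteq> i" using Cons.prems[of a js] by auto
  moreover have "term_sum ts x i = 0" using Cons by (meson list.set_intros(2))
  ultimately show ?case by (simp add: t)
qed simp

lemma term_sum_above: "terms_below n ts \<Longrightarrow> n \<le> i \<Longrightarrow> term_sum ts x i = 0"
  by (rule term_sum_eq_0) (force simp: terms_below_def)

lemma term_sum_homogeneous:
  assumes "\<And>i a js. (i, a, js) \<in> set ts \<Longrightarrow> length js = d"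
  shows "term_sum ts (\<lambda>j. s * x j) i = s ^ d * term_sum ts x i"
  using assms
proof (induction ts)
  case (Cons t ts)
  obtain i' a js where t: "t = (i', a, js)" by (cases t)
  have "(\<Prod>j\<leftarrow>js. s * x j) = s ^ length js * (\<Prod>j\<leftarrow>js. x j)" by (induction js) auto
  moreover have "length js = d" using Cons.prems[of i' a js] by (simp add: t)
  moreover have "term_sum ts (\<lambda>j. s * x j) i = s ^ d * term_sum ts x i"
    using Cons by (meson list.set_intros(2))
  ultimately show ?case by (simp add: t algebra_simps)
qed simp

section \<open>Elementary automorphisms and degree reduction\<close>

definition negate_terms :: "terms \<Rightarrow> terms" where
  "negate_terms ts = map (\<lambda>(i, a, js). (i, - a, js)) ts"

lemma term_sum_negate: "term_sum (negate_terms ts) x i = - term_sum ts x i"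
  by (induction ts) (auto simp: negate_terms_def)

text \<open>No component that is changed occurs in an added term. The added terms therefore have the
  same values before and after the change, and negating them gives the inverse.\<close>

definition elementary :: "terms \<Rightarrow> bool" where
  "elementary ts \<longleftrightarrow> (\<forall>(i, a, js)\<in>set ts. \<forall>(i', a', js')\<in>set ts. i' \<notin> set js)"

lemma term_map_negate:
  assumes "elementary ts"
  shows "term_map (negate_terms ts) (term_map ts x) = x"
    and "term_map ts (term_map (negate_terms ts) x) = x"
proof -
  have *: "term_sum ts (\<lambda>j. x j + c * term_sum ts x j) i = term_sum ts x i" for c i
    by (rule term_sum_cong) (use assms in \<open>fastforce simp: elementary_def intro: term_sum_eq_0\<close>)
  show "term_map (negate_terms ts) (term_map ts x) = x"
    using *[of 1] by (simp add: term_map_def[abs_def] term_sum_negate)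
  show "term_map ts (term_map (negate_terms ts) x) = x"
    using *[of "-1"] by (simp add: term_map_def[abs_def] term_sum_negate)
qed

lemma pol_inverse_elementary:
  assumes "elementary ts"
  shows "pol_inverse (term_map ts) (term_map (negate_terms ts))"
    and "pol_inverse (term_map (negate_terms ts)) (term_map ts)"
  using assms by (simp_all add: pol_inverse_def pol_map_term_map term_map_negate)

lemma keller_elementary: "elementary ts \<Longrightarrow> keller (term_map ts)"
  using keller_if_pol_inverse pol_inverse_elementary by blast

text \<open>The two directions that a reduction step requires: the hypothesis passes to the reduced
  map \<open>F'\<close>, and an inverse passes back to \<open>F\<close>.\<close>

lemma elementary_equivalence:
  assumes el: "elementary us" "elementary vs"
    and F': "\<And>x. term_map us (F (term_map vs x)) = F' x" and F: "pol_map F"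
  shows "keller F \<Longrightarrow> keller F'" and "\<exists>G. pol_inverse F' G \<Longrightarrow> \<exists>G. pol_inverse F G"
proof -
  have e: "F' = term_map us \<circ> (F \<circ> term_map vs)" using F' by auto
  show "keller F'" if "keller F"
    unfolding e using that F by (intro keller_compose keller_elementary el pol_map_compose pol_map_term_map)
  show "\<exists>G. pol_inverse F G" if "\<exists>G. pol_inverse F' G"
  proof -
    obtain G where "pol_inverse F' G" using \<open>\<exists>G. pol_inverse F' G\<close> by blast
    from pol_inverse_compose[OF pol_inverse_elementary(2)[OF el(1)]
        pol_inverse_compose[OF this pol_inverse_elementary(2)[OF el(2)]]]
    have "\<exists>G. pol_inverse (term_map (negate_terms us) \<circ> (F' \<circ> term_map (negate_terms vs))) G" by blast
    moreover have "term_map (negate_terms us) \<circ> (F' \<circ> term_map (negate_terms vs)) = F"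
      by (auto simp: e term_map_negate el)
    ultimately show ?thesis by simp
  qed
qed

text \<open>One step of the degree reduction of Bass, Connell and Wright: with two new variables
  \<open>y\<close>, \<open>z\<close> the term \<open>P Q\<close> is traded for \<open>y z\<close>, \<open>y Q\<close>, \<open>z P\<close> and the new components \<open>y + P\<close>, \<open>z + Q\<close>.\<close>

lemma split_term:
  assumes b: "terms_below n ((i, a, p @ q) # ts)"
  shows "term_map [(i, - a, [n, Suc n])]
      (term_map ((i, a, p @ q) # ts) (term_map [(n, 1, p), (Suc n, 1, q)] x))
    = term_map ((i, - a, [n, Suc n]) # (i, - a, n # q) # (i, - a, Suc n # p) # (n, 1, p) # (Suc n, 1, q) # ts) x"
    (is "term_map ?us (term_map ?ts (term_map ?vs x)) = term_map ?ts' x")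
proof
  fix j
  have i: "i < n" and pq: "\<And>j. j \<in> set p \<union> set q \<Longrightarrow> j < n" and ts: "terms_below n ts"
    using b by (auto simp: terms_below_def)
  define z where "z = term_map ?vs x"
  have z: "z j = x j" if "j < n" for j using that by (simp add: z_def term_map_def)
  have zn: "z n = x n + (\<Prod>j\<leftarrow>p. x j)" "z (Suc n) = x (Suc n) + (\<Prod>j\<leftarrow>q. x j)"
    by (simp_all add: z_def term_map_def)
  have zo: "z j = x j" if "j \<noteq> n" "j \<noteq> Suc n" for j using that by (simp add: z_def term_map_def)
  have tz: "term_sum ?ts z k = term_sum ?ts x k" for k by (rule term_sum_below_cong[OF b z])
  have t0: "term_sum ts x k = 0" if "n \<le> k" for k by (rule term_sum_above[OF ts that])
  define w where "w = term_map ?ts z"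
  have w: "w k = z k + term_sum ?ts x k" for k by (simp only: w_def term_map_def tz)
  show "term_map ?us (term_map ?ts (term_map ?vs x)) j = term_map ?ts' x j"
    unfolding z_def[symmetric] w_def[symmetric]
    using i by (cases "j < n"; cases "j = n"; cases "j = Suc n")
      (auto simp: term_map_def w z zn zo t0 algebra_simps)
qed

lemma term_map_perm: "term_map (us @ t # vs) = term_map (t # us @ vs)"
  by (cases t) (auto simp: term_map_def fun_eq_iff)

text \<open>A term of length \<open>l\<close> weighs \<open>6 ^ l\<close>. The left side is the
  weight of the five terms that replace one of length \<open>2 + q\<close>; their number grows but
  the longest has length only \<open>Suc q\<close>, so the total weight drops.\<close>

lemma six_power_bound:
  fixes q :: nat
  assumes "2 \<le> q"
  shows "6 ^ 2 + 6 ^ Suc q + 6 ^ Suc 2 + 6 ^ 2 + 6 ^ q < (6::nat) ^ (2 + q)"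
proof -
  have "(6::nat) ^ 2 \<le> 6 ^ q" by (rule power_increasing) (use assms in auto)
  then show ?thesis by (simp add: power_add)
qed

lemma degree_reduction:
  assumes "terms_below n ts" "\<forall>(i, a, js)\<in>set ts. 2 \<le> length js" "keller (term_map ts)"
  shows "\<exists>n us. terms_below n us \<and> (\<forall>(i, a, js)\<in>set us. length js = 2 \<or> length js = 3) \<and>
    keller (term_map us) \<and> ((\<exists>G. pol_inverse (term_map us) G) \<longrightarrow> (\<exists>G. pol_inverse (term_map ts) G))"
  using assms
proof (induction "\<Sum>(i, a, js)\<leftarrow>ts. 6 ^ length js :: nat" arbitrary: n ts rule: less_induct)
  case less
  show ?case
  proof (cases "\<forall>(i, a, js)\<in>set ts. length js = 2 \<or> length js = 3")
    case True
    then show ?thesis using less.prems by blast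
  next
    case False
    then obtain i a js where t: "(i, a, js) \<in> set ts" "length js \<noteq> 2" "length js \<noteq> 3" by auto
    with less.prems(2) have len: "4 \<le> length js" by fastforce
    obtain us vs where ts: "ts = us @ (i, a, js) # vs" using t(1) by (meson split_list)
    \<comment> \<open>Two factors are split off and at least two remain, so the new components
      \<open>y + P\<close> and \<open>z + Q\<close> again have only terms of degree at least
      two.\<close>
    define p q where "p = take 2 js" and "q = drop 2 js"
    have pq: "js = p @ q" "length p = 2" "2 \<le> length q" "length js = 2 + length q"
      using len by (auto simp: p_def q_def)
    let ?ts = "(i, a, p @ q) # us @ vs"
    let ?ts' = "(i, - a, [n, Suc n]) # (i, - a, n # q) # (i, - a, Suc n # p) # (n, 1, p) # (Suc n, 1, q) # us @ vs"
    have e: "term_map ts = term_map ?ts" unfolding ts pq(1) by (rule term_map_perm)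
    have b: "terms_below n ?ts" using less.prems(1) by (auto simp: ts pq(1) terms_below_def)
    have i: "i < n" and s: "set p \<subseteq> {..<n}" "set q \<subseteq> {..<n}" using b by (auto simp: terms_below_def)
    have el: "elementary [(i, - a, [n, Suc n])]" "elementary [(n, 1, p), (Suc n, 1, q)]"
      using i s by (auto simp: elementary_def)
    note eq = elementary_equivalence[OF el split_term[OF b] pol_map_term_map]
    have "(\<Sum>(i, a, js)\<leftarrow>?ts'. 6 ^ length js :: nat) < (\<Sum>(i, a, js)\<leftarrow>ts. 6 ^ length js)"
      using six_power_bound[OF pq(3)] by (simp add: ts pq)
    moreover have "terms_below (Suc (Suc n)) ?ts'"
    proof -
      have "terms_below (Suc (Suc n)) (us @ vs)"
        by (rule terms_below_mono[of n]) (use b in \<open>auto simp: terms_below_def\<close>)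
      then show ?thesis using i s by (auto simp: terms_below_Cons less_Suc_eq)
    qed
    moreover have "\<forall>(i, a, js)\<in>set ?ts'. 2 \<le> length js"
      using less.prems(2) pq by (auto simp: ts)
    moreover have "keller (term_map ?ts')" using eq(1) less.prems(3) by (simp add: e)
    ultimately have "\<exists>n us. terms_below n us \<and> (\<forall>(i, a, js)\<in>set us. length js = 2 \<or> length js = 3) \<and>
      keller (term_map us) \<and> ((\<exists>G. pol_inverse (term_map us) G) \<longrightarrow> (\<exists>G. pol_inverse (term_map ?ts') G))"
      by (rule less.hyps)
    then show ?thesis using eq(2) unfolding e by blast
  qed
qed

section \<open>Homogenization and the passage to nilpotent cubic maps\<close>

lemma term_sum_filter: "term_sum ts x i = term_sum (filter P ts) x i + term_sum (filter (\<lambda>t. \<not> P t) ts) x i"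
  by (induction ts) auto

lemma term_sum_map_source:
  "term_sum (map (\<lambda>(i, a, js). (i, a, ks @ js)) ts) x i = (\<Prod>k\<leftarrow>ks. x k) * term_sum ts x i"
  by (induction ts) (auto simp: algebra_simps)

lemma term_sum_map_target:
  "term_sum (map (\<lambda>(i, a, js). (m + i, a, js)) ts) x i = (if m \<le> i then term_sum ts x (i - m) else 0)"
  by (induction ts) auto

lemma term_sum_upt:
  "term_sum (map (\<lambda>i. (i, a, js i)) [0..<n]) x i = (if i < n then a * (\<Prod>j\<leftarrow>js i. x j) else 0)"
  by (induction n) auto

text \<open>Homogenization: \<open>s\<close> is the variable with index \<open>n\<close>, and \<open>F (s x) / s\<close> is polynomial.\<close>

lemma
  fixes ts us :: terms and n :: nat
  defines "F \<equiv> term_map (ts @ us)"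
    and "H \<equiv> term_map (map (\<lambda>(i, a, js). (i, a, [n] @ js)) ts @ map (\<lambda>(i, a, js). (i, a, [n, n] @ js)) us)"
  assumes b: "terms_below n ts" "terms_below n us"
    and len: "\<forall>(i, a, js)\<in>set ts. length js = 2" "\<forall>(i, a, js)\<in>set us. length js = 3"
  shows keller_homogenize: "keller F \<Longrightarrow> keller H"
    and pol_inverse_dehomogenize: "\<exists>G. pol_inverse H G \<Longrightarrow> \<exists>G. pol_inverse F G"
proof -
  have H: "H x i = x i + (x n * term_sum ts x i + (x n)\<^sup>2 * term_sum us x i)" for x i
    unfolding H_def term_map_def term_sum_append term_sum_map_source by (simp add: power2_eq_square)
  have H_above: "H x i = x i" if "n \<le> i" for x i using that b by (simp add: H term_sum_above)
  have F: "F x i = x i + (term_sum ts x i + term_sum us x i)" for x i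
    by (simp add: F_def term_map_def)
  have F_above: "F x i = x i" if "n \<le> i" for x i using that b by (simp add: F term_sum_above)
  show "keller H" if "keller F"
    unfolding keller_def
  proof (intro allI impI)
    fix \<gamma> :: "complex \<Rightarrow> nat \<Rightarrow> complex" and i
    assume \<gamma>: "\<forall>i. (\<lambda>t. \<gamma> t i) field_differentiable (at 0)"
      and H0: "\<forall>i. ((\<lambda>t. H (\<gamma> t) i) has_field_derivative 0) (at 0)"
    have above: "((\<lambda>t. \<gamma> t i) has_field_derivative 0) (at 0)" if "n \<le> i" for i
      using H0[rule_format, of i] that by (simp add: H_above)
    obtain \<gamma>' where \<gamma>': "\<And>i. ((\<lambda>t. \<gamma> t i) has_field_derivative \<gamma>' i) (at 0)"
      using \<gamma> unfolding field_differentiable_def by metis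
    \<comment> \<open>The homogenizing coordinate is stationary along the curve, so it
      differentiates like a constant factor.\<close>
    have D0: "((\<lambda>t. \<gamma> t n * f t) has_field_derivative \<gamma> 0 n * f') (at 0)"
      if "(f has_field_derivative f') (at 0)" for f f'
      using DERIV_mult[OF above[of n] that] by (simp add: mult.commute)
    \<comment> \<open>If the homogenizing coordinate \<open>s\<close> is zero at time 0, then
      \<open>H\<close> is the identity to first order along the curve. Otherwise
      \<open>F (s x) = s H(x)\<close> turns the curve into one whose image under \<open>F\<close> is
      stationary, and the nonzero factor is divided out.\<close>
    have "\<gamma>' i = 0" if i: "i < n" for i
    proof (cases "\<gamma> 0 n = 0")
      case True
      have "(\<lambda>t. term_sum vs (\<gamma> t) i) field_differentiable (at 0)" for vs
        using pol_map_differentiable[of "term_sum vs" \<gamma> i] \<gamma> by (simp add: pol_map_def pol_term_sum)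
      then obtain d e where "((\<lambda>t. term_sum ts (\<gamma> t) i) has_field_derivative d) (at 0)"
        "((\<lambda>t. term_sum us (\<gamma> t) i) has_field_derivative e) (at 0)"
        unfolding field_differentiable_def by metis
      from DERIV_add[OF \<gamma>'[of i] D0[OF DERIV_add[OF this(1) D0[OF this(2)]]]]
      have "((\<lambda>t. H (\<gamma> t) i) has_field_derivative \<gamma>' i) (at 0)"
        by (simp add: H True algebra_simps power2_eq_square)
      then show ?thesis using H0 DERIV_unique by blast
    next
      case False
      define \<delta> where "\<delta> t j = (if j < n then \<gamma> t n * \<gamma> t j else 0)" for t j
      have "F (\<delta> t) j = (if j < n then \<gamma> t n * H (\<gamma> t) j else 0)" for t j
      proof (cases "j < n")
        case True
        have "term_sum vs (\<delta> t) j = term_sum vs (\<lambda>j. \<gamma> t n * \<gamma> t j) j" if "terms_below n vs" for vs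
          by (rule term_sum_below_cong[OF that]) (simp add: \<delta>_def)
        moreover have "term_sum ts (\<lambda>j. \<gamma> t n * \<gamma> t j) j = \<gamma> t n ^ 2 * term_sum ts (\<gamma> t) j"
          "term_sum us (\<lambda>j. \<gamma> t n * \<gamma> t j) j = \<gamma> t n ^ 3 * term_sum us (\<gamma> t) j"
          by (rule term_sum_homogeneous; use len in auto)+
        ultimately show ?thesis using True b
          by (simp add: F H \<delta>_def[of t j] algebra_simps power2_eq_square power3_eq_cube)
      qed (simp add: F_above \<delta>_def)
      then have "((\<lambda>t. F (\<delta> t) j) has_field_derivative 0) (at 0)" for j
        using D0[OF H0[rule_format, of j]] by (cases "j < n") auto
      moreover have \<delta>': "((\<lambda>t. \<delta> t j) has_field_derivative (if j < n then \<gamma> 0 n * \<gamma>' j else 0)) (at 0)" for j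
        using D0[OF \<gamma>'[of j]] by (cases "j < n") (auto simp: \<delta>_def)
      moreover have "(\<lambda>t. \<delta> t j) field_differentiable (at 0)" for j
        using \<delta>' unfolding field_differentiable_def by blast
      ultimately have "((\<lambda>t. \<delta> t i) has_field_derivative 0) (at 0)"
        using \<open>keller F\<close> unfolding keller_def by blast
      with \<delta>'[of i] i have "\<gamma> 0 n * \<gamma>' i = 0" using DERIV_unique by fastforce
      with False show ?thesis by simp
    qed
    then show "((\<lambda>t. \<gamma> t i) has_field_derivative 0) (at 0)"
      using \<gamma>'[of i] above[of i] by (cases "i < n") auto
  qed
  show "\<exists>G. pol_inverse F G" if "\<exists>G. pol_inverse H G"
  proof -
    obtain G where G: "pol_map G" "\<And>x. G (H x) = x" "\<And>x. H (G x) = x"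
      using \<open>\<exists>G. pol_inverse H G\<close> unfolding pol_inverse_def by blast
    \<comment> \<open>\<open>\<iota>\<close> sets the homogenizing variable to 1, where
      \<open>H\<close> becomes \<open>F\<close>.\<close>
    define \<iota> where "\<iota> w j = (if j < n then w j else if j = n then 1 else 0 :: complex)" for w :: "nat \<Rightarrow> complex" and j
    define K where "K w i = (if i < n then G (\<iota> w) i else w i)" for w i
    have "pol (\<lambda>w. \<iota> w j)" for j
      by (cases "j < n"; cases "j = n") (simp_all add: \<iota>_def pol_const pol_var)
    then have "pol (\<lambda>w. G (\<iota> w) i)" for i
      using pol_compose[of "\<lambda>x. G x i" \<iota>] G(1) by (simp add: pol_map_def)
    then have "pol (\<lambda>w. K w i)" for i
      unfolding K_def by (cases "i < n") (simp_all add: pol_var)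
    then have K: "pol_map K" by (simp add: pol_map_def)
    have cong: "term_sum vs x i = term_sum vs y i"
      if "vs = ts \<or> vs = us" "\<And>j. j < n \<Longrightarrow> x j = y j" for vs x y i
      using that b by (auto intro: term_sum_below_cong)
    have H\<iota>: "H (\<iota> x) = \<iota> (F x)" for x
    proof
      fix i
      show "H (\<iota> x) i = \<iota> (F x) i"
      proof (cases "i < n")
        case True
        then show ?thesis using cong[of ts "\<iota> x" x i] cong[of us "\<iota> x" x i] by (simp add: H F \<iota>_def)
      qed (simp add: H_above \<iota>_def)
    qed
    have "K (F x) = x" for x
    proof
      fix i
      have "G (\<iota> (F x)) = \<iota> x" by (simp only: H\<iota>[symmetric] G(2))
      then show "K (F x) i = x i" by (simp add: K_def F_above \<iota>_def)
    qed
    moreover have "F (K w) = w" for w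
    proof
      fix i
      define u where "u = G (\<iota> w)"
      have Hu: "H u = \<iota> w" by (simp add: u_def G(3))
      from fun_cong[OF this, of n] have un: "u n = 1" by (simp add: H_above \<iota>_def)
      show "F (K w) i = w i"
      proof (cases "i < n")
        case True
        have "F (K w) i = u i + (term_sum ts u i + term_sum us u i)"
          using True cong[of ts "K w" u i] cong[of us "K w" u i] by (simp add: F K_def u_def)
        also have "\<dots> = H u i" by (simp add: H un)
        finally show ?thesis using True by (simp add: Hu \<iota>_def)
      qed (simp add: F_above K_def)
    qed
    ultimately show ?thesis using K unfolding pol_inverse_def by blast
  qed
qed

lemma cubic_map_of_terms:
  assumes "terms_below n ts" "\<And>i a js. (i, a, js) \<in> set ts \<Longrightarrow> length js = 3"
  shows "cubic_map n (\<lambda>i j k l. \<Sum>(i', a, js)\<leftarrow>ts. if i' = i \<and> js = [j, k, l] then a else 0) = term_map ts"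
proof (intro ext)
  fix x i
  have "tri n (\<lambda>i j k l. \<Sum>(i', a, js)\<leftarrow>ts. if i' = i \<and> js = [j, k, l] then a else 0) x x x i = term_sum ts x i"
    using assms
  proof (induction ts)
    case Nil
    show ?case by (simp add: tri_def)
  next
    case (Cons t ts)
    obtain i' a js where t: "t = (i', a, js)" by (cases t)
    have "length js = 3" using Cons.prems(2)[of i' a js] by (simp add: t)
    then obtain j k l where js: "js = [j, k, l]" by (auto simp: eval_nat_numeral length_Suc_conv)
    have jkl: "j < n" "k < n" "l < n" using Cons.prems(1) by (auto simp: t js terms_below_def)
    have "(\<Sum>j'<n. \<Sum>k'<n. \<Sum>l'<n. (if i' = i \<and> js = [j', k', l'] then a else 0) * (x j' * (x k' * x l')))
      = (\<Sum>j'<n. \<Sum>k'<n. \<Sum>l'<n. if l' = l then (if k' = k then (if j' = j then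
          (if i' = i then a * (x j' * (x k' * x l')) else 0) else 0) else 0) else 0)"
      by (intro sum.cong) (auto simp: js)
    also have "\<dots> = (if i' = i then a * (\<Prod>j\<leftarrow>js. x j) else 0)"
      using jkl by (simp add: js)
    moreover have "tri n (\<lambda>i j k l. \<Sum>(i', a, js)\<leftarrow>ts. if i' = i \<and> js = [j, k, l] then a else 0) x x x i = term_sum ts x i"
    proof (rule Cons.IH)
      show "terms_below n ts" using Cons.prems(1) by (simp add: t terms_below_Cons)
      show "length js = 3" if "(i, a, js) \<in> set ts" for i a js
        using that by (intro Cons.prems(2)[of i a js]) simp
    qed
    ultimately show ?case by (simp add: t tri_def distrib_right sum.distrib)
  qed
  then show "cubic_map n (\<lambda>i j k l. \<Sum>(i', a, js)\<leftarrow>ts. if i' = i \<and> js = [j, k, l] then a else 0) x i = term_map ts x i"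
    using term_sum_above[OF assms(1), of i x] by (simp add: cubic_map_def term_map_def)
qed

text \<open>The derivative of the cubic part at \<open>r x\<close> with \<open>r^2 = s\<close> is
  \<open>s\<close> times the one at \<open>x\<close>. A kernel vector of \<open>1 + s J\<close> is
  thus the velocity of a curve through \<open>r x\<close> whose image is stationary.\<close>

lemma nilpotent_if_keller:
  assumes "keller (cubic_map n \<tau>)"
  shows "nilpotent n \<tau>"
proof (rule nilpotent_if_unipotent)
  fix x s v i
  assume v: "\<And>i. i < n \<Longrightarrow> v i + s * jac n \<tau> x v i = 0" and i: "i < n"
  define r where "r = csqrt s"
  have r: "r\<^sup>2 = s" by (simp add: r_def)
  define \<gamma> where "\<gamma> t j = r * x j + t * (if j < n then v j else 0)" for t j
  have \<gamma>': "((\<lambda>t. \<gamma> t j) has_field_derivative (if j < n then v j else 0)) (at 0)" for j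
    unfolding \<gamma>_def by (auto intro!: derivative_eq_intros)
  have "((\<lambda>t. cubic_map n \<tau> (\<gamma> t) j) has_field_derivative 0) (at 0)" for j
  proof (cases "j < n")
    case True
    have "tri n \<tau> (\<gamma> t) (\<gamma> t) (\<gamma> t) j
        = tri n \<tau> (\<lambda>j. r * x j + t * v j) (\<lambda>j. r * x j + t * v j) (\<lambda>j. r * x j + t * v j) j" for t
      by (rule tri_cong) (auto simp: \<gamma>_def)
    then have "cubic_map n \<tau> (\<gamma> t) j = r * x j + t * v j + (tri n \<tau> (\<lambda>j. r * x j) (\<lambda>j. r * x j) (\<lambda>j. r * x j) j
      + t * (s * jac n \<tau> x v j) + t\<^sup>2 * jac n \<tau> v (\<lambda>j. r * x j) j + t ^ 3 * tri n \<tau> v v v j)" for t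
      unfolding cubic_map_def tri_line jac_scale r using True by (simp add: \<gamma>_def)
    moreover have "((\<lambda>t. r * x j + t * v j + (tri n \<tau> (\<lambda>j. r * x j) (\<lambda>j. r * x j) (\<lambda>j. r * x j) j
      + t * (s * jac n \<tau> x v j) + t\<^sup>2 * jac n \<tau> v (\<lambda>j. r * x j) j + t ^ 3 * tri n \<tau> v v v j))
      has_field_derivative (v j + s * jac n \<tau> x v j)) (at 0)"
      by (auto intro!: derivative_eq_intros)
    ultimately show ?thesis using v[OF True] by simp
  next
    case False
    then show ?thesis using \<gamma>'[of j] by (simp add: cubic_map_def)
  qed
  moreover have "(\<lambda>t. \<gamma> t j) field_differentiable (at 0)" for j
    using \<gamma>' unfolding field_differentiable_def by blast
  ultimately have "((\<lambda>t. \<gamma> t i) has_field_derivative 0) (at 0)"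
    using assms unfolding keller_def by blast
  then show "v i = 0" using \<gamma>'[of i] i DERIV_unique by fastforce
qed

lemma pol_inverse_cubic_map:
  assumes "formal_inverse_terminates n \<tau>"
  shows "\<exists>G. pol_inverse (cubic_map n \<tau>) G"
proof -
  obtain b where b: "\<And>y k i. b \<le> k \<Longrightarrow> i < n \<Longrightarrow> formal_inverse n \<tau> y k i = 0"
    using assms unfolding formal_inverse_terminates_def by blast
  have "pol (\<lambda>y. truncated_inverse n \<tau> b y i)" for i
  proof (cases "i < n")
    case True
    then show ?thesis unfolding pol_def using poly_fun_truncated_inverse by blast
  qed (simp add: truncated_inverse_def pol_var)
  then have "pol_inverse (cubic_map n \<tau>) (truncated_inverse n \<tau> b)"
    by (simp add: pol_inverse_def pol_map_def cubic_map_truncated_inverse[OF b]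
        truncated_inverse_cubic_map[OF b])
  then show ?thesis by blast
qed

text \<open>The common target of conditions (i) and (ii), from which the Jacobian conjecture is then
  derived.\<close>

definition nilpotent_invertible :: bool where
  "nilpotent_invertible \<longleftrightarrow> (\<forall>n \<tau>. nilpotent n \<tau> \<longrightarrow> formal_inverse_terminates n \<tau>)"

lemma pol_inverse_if_keller:
  assumes nil: nilpotent_invertible
    and "terms_below n ts" "\<forall>(i, a, js)\<in>set ts. 2 \<le> length js" "keller (term_map ts)"
  shows "\<exists>G. pol_inverse (term_map ts) G"
proof -
  obtain n us where us: "terms_below n us" "\<forall>(i, a, js)\<in>set us. length js = 2 \<or> length js = 3"
    "keller (term_map us)" and lift: "\<exists>G. pol_inverse (term_map us) G \<Longrightarrow> \<exists>G. pol_inverse (term_map ts) G"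
    using degree_reduction[OF assms(2-4)] by blast
  define A where "A = filter (\<lambda>(i, a, js). length js = 2) us"
  define B where "B = filter (\<lambda>t. \<not> (case t of (i, a, js) \<Rightarrow> length js = 2)) us"
  have AB: "term_map us = term_map (A @ B)"
    unfolding A_def B_def using term_sum_filter by (auto simp: term_map_def fun_eq_iff)
  have b: "terms_below n A" "terms_below n B" using us(1) by (auto simp: A_def B_def terms_below_def)
  have len: "\<forall>(i, a, js)\<in>set A. length js = 2" "\<forall>(i, a, js)\<in>set B. length js = 3"
    using us(2) by (auto simp: A_def B_def)
  define H where "H = map (\<lambda>(i, a, js). (i, a, [n] @ js)) A @ map (\<lambda>(i, a, js). (i, a, [n, n] @ js)) B"
  \<comment> \<open>\<open>H\<close> is \<open>x + s A + s^2 B\<close> with \<open>B\<close> cubic,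
    so its last part has degree five. With \<open>n\<close> new variables \<open>u\<close>, first
    \<open>Q\<close> adds \<open>B\<close> to \<open>u\<close>, then after \<open>H\<close> the map
    \<open>P\<close> subtracts \<open>s^2 u\<close> from \<open>x\<close>. This cancels
    \<open>s^2 B\<close> and leaves the cubic terms \<open>s A - s^2 u\<close> in \<open>x\<close>
    and \<open>B\<close> in \<open>u\<close>.\<close>
  define P where "P = map (\<lambda>i. (i, - 1 :: complex, [n, n, Suc n + i])) [0..<n]"
  define Q where "Q = map (\<lambda>(i, a, js). (Suc n + i, a, js)) B"
  define cs where "cs = map (\<lambda>(i, a, js). (i, a, [n] @ js)) A @ Q @ P"
  have el: "elementary P" "elementary Q"
    using b(2) by (auto simp: elementary_def P_def Q_def terms_below_def) fastforce
  have comp: "term_map P (term_map H (term_map Q x)) = term_map cs x" for x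
  proof
    fix i
    have Pt: "term_sum P x i = (if i < n then - (x n * (x n * x (Suc n + i))) else 0)" for x i
      unfolding P_def term_sum_upt by simp
    have Qt: "term_sum Q x i = (if Suc n \<le> i then term_sum B x (i - Suc n) else 0)" for x i
      unfolding Q_def term_sum_map_target ..
    have Ht: "term_sum H x i = x n * term_sum A x i + x n * (x n * term_sum B x i)" for x i
      unfolding H_def term_sum_append term_sum_map_source by simp
    define z where "z = term_map Q x"
    have z: "z j = x j" if "j \<le> n" for j using that by (simp add: z_def term_map_def Qt)
    have zA: "term_sum A z j = term_sum A x j" "term_sum B z j = term_sum B x j" for j
      using b z by (auto intro: term_sum_below_cong)
    have za: "z (Suc n + j) = x (Suc n + j) + term_sum B x j" for j by (simp add: z_def term_map_def Qt)
    have above: "term_sum A x j = 0" "term_sum B x j = 0" if "n \<le> j" for j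
      using that b by (auto intro: term_sum_above)
    define w where "w = term_map H z"
    have w: "w j = z j + (x n * term_sum A x j + x n * (x n * term_sum B x j))" for j
      by (simp add: w_def term_map_def Ht z zA)
    have wn: "w n = x n" by (simp add: w above z)
    show "term_map P (term_map H (term_map Q x)) i = term_map cs x i"
    proof (cases "i < n")
      case True
      then show ?thesis
        unfolding z_def[symmetric] w_def[symmetric] using za[of i]
        by (simp add: term_map_def Pt wn w above z cs_def term_sum_map_source[of "[n]"] Qt algebra_simps
            del: append_Cons append_Nil)
    next
      case False
      then show ?thesis
        unfolding z_def[symmetric] w_def[symmetric]
        by (simp add: term_map_def Pt w above cs_def term_sum_map_source[of "[n]"]
            del: append_Cons append_Nil) (simp add: z_def term_map_def)
    qed
  qed
  note eq = elementary_equivalence[OF el comp pol_map_term_map]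
  have "keller (term_map H)"
    unfolding H_def using keller_homogenize[OF b len] us(3) by (simp add: AB)
  then have cs: "keller (term_map cs)" by (rule eq(1))
  \<comment> \<open>The variables \<open>x\<close>, the homogenizing one, and
    \<open>u\<close>.\<close>
  define N where "N = Suc (2 * n)"
  have "terms_below N cs"
    using b by (fastforce simp: cs_def terms_below_def P_def Q_def N_def)
  moreover have "length js = 3" if "(i, a, js) \<in> set cs" for i a js
    using that len by (auto simp: cs_def P_def Q_def)
  ultimately obtain \<tau> where \<tau>: "cubic_map N \<tau> = term_map cs" using cubic_map_of_terms by blast
  have "nilpotent N \<tau>" using nilpotent_if_keller cs by (simp add: \<tau>)
  then have "formal_inverse_terminates N \<tau>" using nil unfolding nilpotent_invertible_def by blast
  from pol_inverse_cubic_map[OF this] have "\<exists>G. pol_inverse (term_map cs) G" unfolding \<tau> .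
  then have "\<exists>G. pol_inverse (term_map H) G" by (rule eq(2))
  then have "\<exists>G. pol_inverse (term_map us) G"
    unfolding AB H_def using pol_inverse_dehomogenize[OF b len] by blast
  then show ?thesis by (rule lift)
qed

section \<open>Polynomial maps on vectors\<close>

definition pad_vec :: "nat \<Rightarrow> complex Matrix.vec \<Rightarrow> nat \<Rightarrow> complex" where
  "pad_vec n v j = (if j < n then v $ j else 0)"

lemma vec_pad_vec: "v \<in> carrier_vec n \<Longrightarrow> Matrix.vec n (pad_vec n v) = v"
  by (intro eq_vecI) (auto simp: pad_vec_def)

lemma polynomial_mapI:
  assumes G: "\<And>x. x \<in> carrier_vec n \<Longrightarrow> G x \<in> carrier_vec n"
    and p: "\<And>i. i < n \<Longrightarrow> \<exists>d. poly_fun n d (\<lambda>y. G (Matrix.vec n y) $ i)"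
  shows "polynomial_map n G"
proof -
  from p obtain d where d: "\<And>i. i < n \<Longrightarrow> poly_fun n (d i) (\<lambda>y. G (Matrix.vec n y) $ i)" by metis
  define D where "D = (\<Sum>i<n. d i)"
  have "\<exists>c. \<forall>y. G (Matrix.vec n y) $ i = (\<Sum>m\<in>multi_indices n D. c m * monomial_fun n m y)" if "i < n" for i
    by (rule poly_fun_imp_sum_monomials, rule poly_fun_mono[OF d[OF that]])
       (use that in \<open>auto simp: D_def intro: member_le_sum\<close>)
  then obtain c where c: "\<And>i y. i < n \<Longrightarrow>
      G (Matrix.vec n y) $ i = (\<Sum>m\<in>multi_indices n D. c i m * monomial_fun n m y)" by metis
  have "has_coeffs n D G (\<lambda>(i, m). c i m)"
    unfolding has_coeffs_def
  proof
    fix x :: "complex Matrix.vec" assume x: "x \<in> carrier_vec n"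
    show "G x = eval_coeffs n D (\<lambda>(i, m). c i m) x"
    proof (rule eq_vecI)
      fix i assume "i < dim_vec (eval_coeffs n D (\<lambda>(i, m). c i m) x)"
      then have i: "i < n" by (simp add: eval_coeffs_def)
      have "monomial_fun n m (pad_vec n x) = (\<Prod>j<n. x $ j ^ (m $ j))" for m
        by (simp add: monomial_fun_def pad_vec_def)
      then show "G x $ i = eval_coeffs n D (\<lambda>(i, m). c i m) x $ i"
        using c[OF i, of "pad_vec n x"] i by (simp add: eval_coeffs_def vec_pad_vec[OF x])
    qed (use G[OF x] in \<open>simp add: eval_coeffs_def\<close>)
  qed
  then show ?thesis unfolding polynomial_map_def by blast
qed

text \<open>Coordinate lines identify the coefficients of the abstract chain rule with the entries
  of \<open>jacobian_mat\<close>; this links the curve condition to invertible Jacobian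
  matrices.\<close>

lemma jacobian_chain_rule:
  assumes f: "poly_fun n d (\<lambda>y. F (Matrix.vec n y) $ k)" and k: "k < n"
    and \<gamma>: "\<And>j. j < n \<Longrightarrow> ((\<lambda>t. \<gamma> t j) has_field_derivative \<gamma>' j) (at 0)"
  shows "((\<lambda>t. F (Matrix.vec n (\<gamma> t)) $ k) has_field_derivative
    (\<Sum>j<n. jacobian_mat n F (Matrix.vec n (\<gamma> 0)) $$ (k, j) * \<gamma>' j)) (at 0)"
proof -
  define x where "x = \<gamma> 0"
  obtain D where D: "\<And>\<gamma> \<gamma>'. \<forall>j<n. \<gamma> 0 j = x j \<and> ((\<lambda>t. \<gamma> t j) has_field_derivative \<gamma>' j) (at 0) \<Longrightarrow>
    ((\<lambda>t::complex. F (Matrix.vec n (\<gamma> t)) $ k) has_field_derivative (\<Sum>j<n. D j * \<gamma>' j)) (at 0)"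
    using poly_fun_chain_rule[OF f, of x] by blast
  have "D j = jacobian_mat n F (Matrix.vec n x) $$ (k, j)" if j: "j < n" for j
  proof -
    define \<delta> where "\<delta> t l = x l + t * (if l = j then 1 else 0)" for t :: complex and l
    have "\<forall>l<n. \<delta> 0 l = x l \<and> ((\<lambda>t. \<delta> t l) has_field_derivative (if l = j then 1 else 0)) (at 0)"
      unfolding \<delta>_def by (auto intro!: derivative_eq_intros)
    from D[OF this] have "((\<lambda>t. F (Matrix.vec n (\<delta> t)) $ k) has_field_derivative D j) (at 0)"
      using j by (simp add: if_distrib cong: if_cong)
    moreover have "Matrix.vec n (\<delta> t) = Matrix.vec n x + t \<cdot>\<^sub>v unit_vec n j" for t
      using j by (intro eq_vecI) (auto simp: \<delta>_def unit_vec_def)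
    ultimately show ?thesis using k j by (simp add: jacobian_mat_def DERIV_imp_deriv)
  qed
  then show ?thesis using D[of \<gamma> \<gamma>'] \<gamma> by (simp add: x_def)
qed

definition exponent_list :: "nat \<Rightarrow> nat Matrix.vec \<Rightarrow> nat list" where
  "exponent_list n m = concat (map (\<lambda>j. replicate (m $ j) j) [0..<n])"

lemma exponent_list:
  "set (exponent_list n m) \<subseteq> {..<n}" "length (exponent_list n m) = (\<Sum>j<n. m $ j)"
  "(\<Prod>j\<leftarrow>exponent_list n m. x j) = monomial_fun n m x"
proof -
  show "set (exponent_list n m) \<subseteq> {..<n}" by (auto simp: exponent_list_def)
  show "length (exponent_list n m) = (\<Sum>j<n. m $ j)"
    by (induction n) (auto simp: exponent_list_def)
  show "(\<Prod>j\<leftarrow>exponent_list n m. x j) = monomial_fun n m x"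
    by (induction n) (auto simp: exponent_list_def monomial_fun_def prod_list_replicate)
qed

text \<open>As a polynomial in \<open>s\<close>, \<open>g i (s x)\<close> has the coefficients
  \<open>0\<close> and \<open>x i\<close> in degrees 0 and 1. The monomials of degree at least two
  become the terms.\<close>

lemma normalized_term_map:
  assumes g: "\<And>i. i < n \<Longrightarrow> poly_fun n d (g i)"
    and g0: "\<And>i. i < n \<Longrightarrow> g i (\<lambda>_. 0) = 0"
    and g1: "\<And>i x. i < n \<Longrightarrow> ((\<lambda>s. g i (\<lambda>j. s * x j)) has_field_derivative x i) (at 0)"
  obtains ts where "terms_below n ts" "\<forall>(i, a, js)\<in>set ts. 2 \<le> length js"
    "\<And>x i. term_map ts x i = (if i < n then g i x else x i)"
proof -
  obtain c where c: "\<And>i x. i < n \<Longrightarrow> g i x = (\<Sum>m\<in>multi_indices n d. c i m * monomial_fun n m x)"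
    using poly_fun_imp_sum_monomials[OF g] by metis
  define w where "w m = (\<Sum>j<n. m $ j)" for m :: "nat Matrix.vec"
  define I where "I = {m \<in> multi_indices n d. 2 \<le> w m}"
  have fI: "finite I" by (simp add: I_def finite_multi_indices)
  have gI: "g i x = x i + (\<Sum>m\<in>I. c i m * monomial_fun n m x)" if i: "i < n" for i x
  proof -
    let ?h = "\<lambda>m. c i m * monomial_fun n m x"
    define p where "p = (\<Sum>m\<in>multi_indices n d. monom (?h m) (w m))"
    have p: "poly p s = g i (\<lambda>j. s * x j)" for s
      by (simp add: p_def c[OF i] poly_sum poly_monom monomial_fun_def w_def power_mult_distrib
          prod.distrib power_sum mult_ac)
    have cf: "coeff p r = (\<Sum>m\<in>{m\<in>multi_indices n d. w m = r}. ?h m)" for r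
      by (simp add: p_def coeff_sum sum.inter_filter[OF finite_multi_indices])
    have "coeff p 0 = 0" using p[of 0] g0[OF i] by (simp add: poly_0_coeff_0)
    moreover have "coeff p 1 = x i"
    proof -
      have "((\<lambda>s. poly p s) has_field_derivative poly (pderiv p) 0) (at 0)" by (rule poly_DERIV)
      then have "poly (pderiv p) 0 = x i" unfolding p using g1[OF i] DERIV_unique by blast
      then show ?thesis by (simp add: poly_0_coeff_0 coeff_pderiv)
    qed
    moreover have "g i x = (\<Sum>m\<in>{m\<in>multi_indices n d. w m = 0}. ?h m)
        + (\<Sum>m\<in>{m\<in>multi_indices n d. w m = 1}. ?h m) + (\<Sum>m\<in>I. ?h m)"
    proof -
      have "multi_indices n d = {m\<in>multi_indices n d. w m = 0} \<union> {m\<in>multi_indices n d. w m = 1} \<union> I"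
        by (auto simp: I_def)
      then have "g i x = sum ?h ({m\<in>multi_indices n d. w m = 0} \<union> {m\<in>multi_indices n d. w m = 1} \<union> I)"
        using c[OF i] by simp
      also have "\<dots> = sum ?h ({m\<in>multi_indices n d. w m = 0} \<union> {m\<in>multi_indices n d. w m = 1}) + sum ?h I"
        by (rule sum.union_disjoint) (auto simp: I_def finite_multi_indices)
      also have "sum ?h ({m\<in>multi_indices n d. w m = 0} \<union> {m\<in>multi_indices n d. w m = 1})
          = sum ?h {m\<in>multi_indices n d. w m = 0} + sum ?h {m\<in>multi_indices n d. w m = 1}"
        by (rule sum.union_disjoint) (auto simp: finite_multi_indices)
      finally show ?thesis .
    qed
    ultimately show ?thesis using cf[of 0] cf[of 1] by simp
  qed
  obtain ps where ps: "distinct ps" "set ps = {..<n} \<times> I"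
    using finite_distinct_list[of "{..<n} \<times> I"] fI by auto
  define ts where "ts = map (\<lambda>(i, m). (i, c i m, exponent_list n m)) ps"
  show thesis
  proof
    show "terms_below n ts"
      using ps(2) exponent_list(1) by (fastforce simp: ts_def terms_below_def)
    show "\<forall>(i, a, js)\<in>set ts. 2 \<le> length js"
      using ps(2) by (auto simp: ts_def exponent_list(2) I_def w_def)
    fix x i
    have "term_sum ts x i = (\<Sum>(i', m)\<in>{..<n} \<times> I. if i' = i then c i' m * monomial_fun n m x else 0)"
      unfolding ts_def term_sum_def ps(2)[symmetric]
      by (simp add: o_def case_prod_unfold sum_list_distinct_conv_sum_set[OF ps(1)])
         (intro sum.cong refl; simp add: exponent_list(3))
    also have "\<dots> = (\<Sum>i'<n. if i' = i then \<Sum>m\<in>I. c i' m * monomial_fun n m x else 0)"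
      unfolding sum.cartesian_product[symmetric] by (intro sum.cong refl) simp
    finally have "term_sum ts x i = (if i < n then \<Sum>m\<in>I. c i m * monomial_fun n m x else 0)" by simp
    then show "term_map ts x i = (if i < n then g i x else x i)"
      by (simp add: term_map_def gI)
  qed
qed

lemma JC_if_nilpotent_invertible:
  assumes nil: nilpotent_invertible
  shows "JC n"
  unfolding JC_def
proof (intro allI impI)
  fix F
  assume "polynomial_map n F \<and> (\<forall>x\<in>carrier_vec n. invertible_mat (jacobian_mat n F x))"
  then have F: "polynomial_map n F"
    and inv: "\<And>x. x \<in> carrier_vec n \<Longrightarrow> invertible_mat (jacobian_mat n F x)" by auto
  have Fc: "F x \<in> carrier_vec n" if "x \<in> carrier_vec n" for x
    using F that unfolding polynomial_map_def has_coeffs_def by (auto simp: eval_coeffs_def)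
  obtain d where f: "\<And>k. k < n \<Longrightarrow> poly_fun n d (\<lambda>y. F (Matrix.vec n y) $ k)"
    using polynomial_map_index[OF F] by blast
  have Fd: "dim_vec (F x) = n" if "x \<in> carrier_vec n" for x
    using Fc[OF that] by simp
  have inv': "\<exists>B \<in> carrier_mat n n. B * jacobian_mat n F x = 1\<^sub>m n \<and> jacobian_mat n F x * B = 1\<^sub>m n"
    if "x \<in> carrier_vec n" for x
  proof -
    have c: "jacobian_mat n F x \<in> carrier_mat n n" by (simp add: jacobian_mat_def)
    from inv[OF that] obtain B where B: "jacobian_mat n F x * B = 1\<^sub>m (dim_row (jacobian_mat n F x))"
      "B * jacobian_mat n F x = 1\<^sub>m (dim_row B)"
      unfolding invertible_mat_def inverts_mat_def by blast
    have "dim_col (B * jacobian_mat n F x) = n" "dim_col (jacobian_mat n F x * B) = n"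
      unfolding B using c B by (auto simp: jacobian_mat_def dest: arg_cong[of _ _ dim_col])
    then have "B \<in> carrier_mat n n" using B c
      by (metis carrier_matD(1) carrier_matI index_mult_mat(3) index_one_mat(2,3))
    then show ?thesis using B c by auto
  qed
  let ?z = "0\<^sub>v n :: complex Matrix.vec"
  define J where "J = jacobian_mat n F ?z"
  have J: "J \<in> carrier_mat n n" by (simp add: J_def jacobian_mat_def)
  obtain B where B: "B \<in> carrier_mat n n" "B * J = 1\<^sub>m n" "J * B = 1\<^sub>m n"
    using inv'[of ?z] by (auto simp: J_def)
  have vz: "Matrix.vec n (\<lambda>_. 0) = ?z" by auto
  \<comment> \<open>Subtracting \<open>F 0\<close> and applying the inverse \<open>B\<close> of the
    Jacobian matrix at the origin makes the origin fixed and the derivative there the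
    identity.\<close>
  define g where "g i x = (\<Sum>k<n. B $$ (i, k) * (F (Matrix.vec n x) $ k - F ?z $ k))" for i and x :: "nat \<Rightarrow> complex"
  have g_vec: "(B *\<^sub>v (F (Matrix.vec n x) - F ?z)) $ i = g i x" if "i < n" for i x
    using that B(1) by (simp add: g_def scalar_prod_def atLeast0LessThan Fd)
  have g': "((\<lambda>t. g i (\<gamma> t)) has_field_derivative
      (B *\<^sub>v (jacobian_mat n F (Matrix.vec n (\<gamma> 0)) *\<^sub>v Matrix.vec n \<gamma>')) $ i) (at 0)"
    if i: "i < n" and \<gamma>: "\<And>j. j < n \<Longrightarrow> ((\<lambda>t. \<gamma> t j) has_field_derivative \<gamma>' j) (at 0)" for \<gamma> \<gamma>' i
  proof -
    let ?J = "jacobian_mat n F (Matrix.vec n (\<gamma> 0))"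
    have "((\<lambda>t. g i (\<gamma> t)) has_field_derivative (\<Sum>k<n. B $$ (i, k) * (\<Sum>j<n. ?J $$ (k, j) * \<gamma>' j))) (at 0)"
      unfolding g_def
    proof (rule DERIV_sum)
      fix k assume "k \<in> {..<n}"
      then have k: "k < n" by simp
      from DERIV_cmult[OF DERIV_diff[OF jacobian_chain_rule[OF f[OF k] k \<gamma>] DERIV_const]]
      show "((\<lambda>t. B $$ (i, k) * (F (Matrix.vec n (\<gamma> t)) $ k - F ?z $ k)) has_field_derivative
        B $$ (i, k) * (\<Sum>j<n. ?J $$ (k, j) * \<gamma>' j)) (at 0)" by simp
    qed
    also have "(\<Sum>k<n. B $$ (i, k) * (\<Sum>j<n. ?J $$ (k, j) * \<gamma>' j)) = (B *\<^sub>v (?J *\<^sub>v Matrix.vec n \<gamma>')) $ i"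
      using i B(1) by (simp add: scalar_prod_def atLeast0LessThan jacobian_mat_def)
    finally show ?thesis .
  qed
  have "poly_fun n d (g i)" for i
    unfolding g_def[abs_def] by (intro poly_fun_sum poly_fun_cmult poly_fun_diff f poly_fun.const) auto
  moreover have "g i (\<lambda>_. 0) = 0" for i by (simp add: g_def vz)
  moreover have "((\<lambda>s. g i (\<lambda>j. s * x j)) has_field_derivative x i) (at 0)" if i: "i < n" for i x
  proof -
    have "((\<lambda>s. s * x j) has_field_derivative x j) (at 0)" for j
      by (auto intro!: derivative_eq_intros)
    from g'[OF i this] have "((\<lambda>s. g i (\<lambda>j. s * x j)) has_field_derivative
        (B *\<^sub>v (J *\<^sub>v Matrix.vec n x)) $ i) (at 0)" by (simp add: vz J_def)
    moreover have "B *\<^sub>v (J *\<^sub>v Matrix.vec n x) = Matrix.vec n x"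
      using B J by (simp add: assoc_mult_mat_vec[symmetric, of _ n n _ n])
    ultimately show ?thesis using i by simp
  qed
  ultimately obtain ts where ts: "terms_below n ts" "\<forall>(i, a, js)\<in>set ts. 2 \<le> length js"
    "\<And>x i. term_map ts x i = (if i < n then g i x else x i)"
    using normalized_term_map[of n d g] by metis
  have "keller (term_map ts)"
    unfolding keller_def
  proof (intro allI impI)
    fix \<gamma> :: "complex \<Rightarrow> nat \<Rightarrow> complex" and i
    assume "\<forall>i. (\<lambda>t. \<gamma> t i) field_differentiable at 0"
      and 0: "\<forall>i. ((\<lambda>t. term_map ts (\<gamma> t) i) has_field_derivative 0) (at 0)"
    then obtain \<gamma>' where \<gamma>': "\<And>i. ((\<lambda>t. \<gamma> t i) has_field_derivative \<gamma>' i) (at 0)"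
      unfolding field_differentiable_def by metis
    let ?J = "jacobian_mat n F (Matrix.vec n (\<gamma> 0))" and ?w = "Matrix.vec n \<gamma>'"
    have Jc: "?J \<in> carrier_mat n n" by (simp add: jacobian_mat_def)
    obtain K where K: "K \<in> carrier_mat n n" "K * ?J = 1\<^sub>m n"
      using inv'[of "Matrix.vec n (\<gamma> 0)"] by auto
    \<comment> \<open>A stationary image means that \<open>B\<close> and then the Jacobian matrix at
      the starting point can be cancelled, which leaves a zero velocity.\<close>
    have "B *\<^sub>v (?J *\<^sub>v ?w) = ?z"
    proof (rule eq_vecI)
      fix i assume "i < dim_vec ?z"
      then have i: "i < n" by simp
      have "((\<lambda>t. g i (\<gamma> t)) has_field_derivative 0) (at 0)" using 0[rule_format, of i] i by (simp add: ts(3))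
      then have "(B *\<^sub>v (?J *\<^sub>v ?w)) $ i = 0" by (rule DERIV_unique[OF g'[OF i \<gamma>']])
      then show "(B *\<^sub>v (?J *\<^sub>v ?w)) $ i = ?z $ i" using i by simp
    qed (use B in simp)
    then have "J *\<^sub>v (B *\<^sub>v (?J *\<^sub>v ?w)) = ?z" using J by auto
    then have "?J *\<^sub>v ?w = ?z"
      using B J Jc by (simp add: assoc_mult_mat_vec[symmetric, of J n n B n])
    then have "K *\<^sub>v (?J *\<^sub>v ?w) = ?z" using K by auto
    then have w: "?w = ?z"
      using K Jc by (simp add: assoc_mult_mat_vec[symmetric, of K n n ?J n])
    show "((\<lambda>t. \<gamma> t i) has_field_derivative 0) (at 0)"
    proof (cases "i < n")
      case True
      then have "\<gamma>' i = 0" using arg_cong[OF w, of "\<lambda>v. v $ i"] by simp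
      then show ?thesis using \<gamma>'[of i] by simp
    next
      case False
      then show ?thesis using 0[rule_format, of i] by (simp add: ts(3))
    qed
  qed
  from pol_inverse_if_keller[OF nil ts(1,2) this] obtain G where
    G: "pol_map G" "\<And>x. G (term_map ts x) = x" "\<And>x. term_map ts (G x) = x"
    unfolding pol_inverse_def by blast
  \<comment> \<open>\<open>W\<close> is an injective affine map with \<open>W \<circ> F\<close> the
    normalized map, so \<open>G \<circ> W\<close> is the inverse of \<open>F\<close>.\<close>
  define W where "W v = B *\<^sub>v (v - F ?z)" for v
  have Wc: "W v \<in> carrier_vec n" for v using B(1) by (intro carrier_vecI) (simp add: W_def)
  have W_inj: "v = v'" if "W v = W v'" "v \<in> carrier_vec n" "v' \<in> carrier_vec n" for v v'
  proof -
    have "J *\<^sub>v W u = u - F ?z" if "u \<in> carrier_vec n" for u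
      using that B J Fc[of ?z] by (simp add: W_def assoc_mult_mat_vec[symmetric, of J n n B n])
    with that have e: "v - F ?z = v' - F ?z" by metis
    show ?thesis
    proof (rule eq_vecI)
      fix i assume "i < dim_vec v'"
      then show "v $ i = v' $ i"
        using arg_cong[OF e, of "\<lambda>u. u $ i"] that by (simp add: Fd carrier_vecD[of _ n])
    qed (use that in \<open>simp add: carrier_vecD[of _ n]\<close>)
  qed
  have tm: "term_map ts (pad_vec n x) = pad_vec n (W (F x))" if "x \<in> carrier_vec n" for x
  proof
    fix i
    have "g i (pad_vec n x) = W (F x) $ i" if "i < n"
      using g_vec[OF that, of "pad_vec n x"] vec_pad_vec[OF \<open>x \<in> carrier_vec n\<close>] by (simp only: W_def)
    then show "term_map ts (pad_vec n x) i = pad_vec n (W (F x)) i"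
      unfolding ts(3) pad_vec_def[of n "W (F x)"] by (simp add: pad_vec_def)
  qed
  define H where "H v = Matrix.vec n (G (pad_vec n (W v)))" for v
  have "polynomial_map n H"
  proof (rule polynomial_mapI)
    fix i assume i: "i < n"
    have "\<exists>m e. poly_fun m e (\<lambda>x. G x i)" using G(1) by (simp add: pol_map_def pol_def)
    then obtain m e where Gi: "poly_fun m e (\<lambda>x. G x i)" by blast
    have "\<exists>e. poly_fun n e (\<lambda>y. pad_vec n (W (Matrix.vec n y)) j)" for j
    proof (cases "j < n")
      case True
      have "pad_vec n (W (Matrix.vec n y)) j = (\<Sum>k<n. B $$ (j, k) * (y k - F ?z $ k))" for y
        using True B(1) by (simp add: pad_vec_def W_def scalar_prod_def atLeast0LessThan Fd)
      moreover have "poly_fun n 1 (\<lambda>y. \<Sum>k<n. B $$ (j, k) * (y k - F ?z $ k))"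
        by (intro poly_fun_sum poly_fun_cmult poly_fun_diff poly_fun.var poly_fun.const) auto
      ultimately show ?thesis by auto
    next
      case False
      then show ?thesis by (auto simp: pad_vec_def intro: poly_fun.const)
    qed
    from poly_fun_compose[OF Gi this] show "\<exists>d. poly_fun n d (\<lambda>y. H (Matrix.vec n y) $ i)"
      using i by (simp add: H_def)
  qed (simp add: H_def)
  moreover have "H (F x) = x" if "x \<in> carrier_vec n" for x
    by (simp only: H_def tm[OF that, symmetric] G(2) vec_pad_vec[OF that])
  moreover have "F (H v) = v" if v: "v \<in> carrier_vec n" for v
  proof -
    define u where "u = G (pad_vec n (W v))"
    have u: "term_map ts u = pad_vec n (W v)" by (simp add: u_def G(3))
    have "u j = 0" if "\<not> j < n" for j
      using fun_cong[OF u, of j] that by (simp add: ts(3) pad_vec_def)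
    then have pu: "pad_vec n (Matrix.vec n u) = u" by (auto simp: pad_vec_def)
    have "pad_vec n (W (F (Matrix.vec n u))) = pad_vec n (W v)"
      using tm[of "Matrix.vec n u"] u by (simp add: pu)
    then have "W (F (Matrix.vec n u)) = W v" by (metis Wc vec_pad_vec)
    then have "F (Matrix.vec n u) = v" by (rule W_inj) (use v Fc in auto)
    then show ?thesis by (simp add: H_def u_def)
  qed
  ultimately show "has_polynomial_inverse n F" unfolding has_polynomial_inverse_def by blast
qed

section \<open>Closedness\<close>

lemma tri_tensor_cong:
  assumes "i < n" "\<And>i j k l. i < n \<Longrightarrow> j < n \<Longrightarrow> k < n \<Longrightarrow> l < n \<Longrightarrow> \<sigma> i j k l = \<tau> i j k l"
  shows "tri n \<sigma> u v w i = tri n \<tau> u v w i"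
  unfolding tri_def using assms by (intro sum.cong refl) auto

lemma formal_inverse_tensor_cong:
  assumes "\<And>i j k l. i < n \<Longrightarrow> j < n \<Longrightarrow> k < n \<Longrightarrow> l < n \<Longrightarrow> \<sigma> i j k l = \<tau> i j k l"
  shows "i < n \<Longrightarrow> formal_inverse n \<sigma> y k i = formal_inverse n \<tau> y k i"
proof (induction k arbitrary: i rule: less_induct)
  case (less k)
  consider "k = 0" | "k = 1" | k' where "k = Suc (Suc k')"
    by (metis One_nat_def old.nat.exhaust)
  then show ?case
  proof cases
    case 3
    have "tri n \<sigma> (formal_inverse n \<sigma> y p) (formal_inverse n \<sigma> y r) (formal_inverse n \<sigma> y (k' - p - r)) i
      = tri n \<tau> (formal_inverse n \<tau> y p) (formal_inverse n \<tau> y r) (formal_inverse n \<tau> y (k' - p - r)) i"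
      if "p \<le> k'" "r \<le> k' - p" for p r
    proof -
      have "tri n \<sigma> u v w i = tri n \<tau> u v w i" for u v w
        by (rule tri_tensor_cong[OF \<open>i < n\<close>]) (rule assms)
      then show ?thesis using that 3 less.IH by (auto intro!: tri_cong)
    qed
    then show ?thesis unfolding 3 formal_inverse.simps by (intro arg_cong[of _ _ uminus] sum.cong refl) auto
  qed auto
qed

lemma formal_inverse_terminates_cong:
  assumes "\<And>i j k l. i < n \<Longrightarrow> j < n \<Longrightarrow> k < n \<Longrightarrow> l < n \<Longrightarrow> \<sigma> i j k l = \<tau> i j k l"
  shows "formal_inverse_terminates n \<sigma> \<longleftrightarrow> formal_inverse_terminates n \<tau>"
  using formal_inverse_tensor_cong[OF assms] by (simp add: formal_inverse_terminates_def)

lemma continuous_map_complex_mult: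
  fixes f g :: "'a \<Rightarrow> complex"
  shows "continuous_map X euclidean f \<Longrightarrow> continuous_map X euclidean g \<Longrightarrow>
    continuous_map X euclidean (\<lambda>x. f x * g x)"
  by (simp add: continuous_map_atin tendsto_mult)

lemma continuous_map_tri:
  assumes "\<And>j k l. j < n \<Longrightarrow> k < n \<Longrightarrow> l < n \<Longrightarrow> continuous_map X euclidean (\<lambda>c. \<tau> c i j k l)"
    and "\<And>j. j < n \<Longrightarrow> continuous_map X euclidean (\<lambda>c. u c j)"
    and "\<And>j. j < n \<Longrightarrow> continuous_map X euclidean (\<lambda>c. v c j)"
    and "\<And>j. j < n \<Longrightarrow> continuous_map X euclidean (\<lambda>c. w c j)"
  shows "continuous_map X euclidean (\<lambda>c. tri n (\<tau> c) (u c) (v c) (w c) i)"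
  unfolding tri_def
  by (intro continuous_map_sum continuous_map_complex_mult) (use assms in auto)

lemma continuous_map_formal_inverse:
  assumes "\<And>i j k l. i < n \<Longrightarrow> j < n \<Longrightarrow> k < n \<Longrightarrow> l < n \<Longrightarrow> continuous_map X euclidean (\<lambda>c. \<tau> c i j k l)"
  shows "i < n \<Longrightarrow> continuous_map X euclidean (\<lambda>c. formal_inverse n (\<tau> c) y k i)"
proof (induction k arbitrary: i rule: less_induct)
  case (less k)
  consider "k = 0" | "k = 1" | k' where "k = Suc (Suc k')"
    by (metis One_nat_def old.nat.exhaust)
  then show ?case
  proof cases
    case 3
    show ?thesis unfolding 3 formal_inverse.simps
      by (intro continuous_map_minus continuous_map_sum continuous_map_tri less.IH assms)
         (use 3 less.prems in auto)
  qed auto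
qed

definition coeff_fun :: "nat \<Rightarrow> (nat \<times> nat Matrix.vec \<Rightarrow> complex) \<Rightarrow> nat \<Rightarrow> (nat \<Rightarrow> complex) \<Rightarrow> complex" where
  "coeff_fun n c i x = (\<Sum>m\<in>multi_indices n 3. c (i, m) * monomial_fun n m x)"

text \<open>Polarization recovers the tensor of a Druzkowski map from its coefficients, continuously.\<close>

definition coeff_tensor :: "nat \<Rightarrow> (nat \<times> nat Matrix.vec \<Rightarrow> complex) \<Rightarrow> tensor" where
  "coeff_tensor n c i j k l = (let e = \<lambda>j m. if m = j then 1 else 0; f = coeff_fun n c i in
     (f (\<lambda>m. e j m + e k m + e l m) - f (\<lambda>m. e j m + e k m - e l m)
      - f (\<lambda>m. e j m - e k m + e l m) - f (\<lambda>m. - e j m + e k m + e l m)) / 24)"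

lemma continuous_map_coeff_tensor:
  assumes "i < n"
  shows "continuous_map (coeff_space n) euclidean (\<lambda>c. coeff_tensor n c i j k l)"
proof -
  have "continuous_map (coeff_space n) euclidean (\<lambda>c. c (i, m))" if "m \<in> multi_indices n 3" for m
    unfolding coeff_space_def
    using continuous_map_product_projection[of "(i, m)" "{..<n} \<times> multi_indices n 3" "\<lambda>_. euclidean"] assms that
    by simp
  then have "continuous_map (coeff_space n) euclidean (\<lambda>c. coeff_fun n c i x)" for x
    unfolding coeff_fun_def
    by (intro continuous_map_sum continuous_map_complex_mult) (auto simp: finite_multi_indices)
  then show ?thesis
    unfolding coeff_tensor_def Let_def divide_inverse
    by (intro continuous_map_complex_mult continuous_map_diff) auto
qed

text \<open>In the signed sum of the four evaluation points every unit vector cancels, so the linear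
  part of the map drops out; the cubes leave 24 times the product of the three entries.\<close>

lemma coeff_tensor_druzkowski:
  assumes A: "A \<in> carrier_mat n n" and c: "has_coeffs n 3 (druzkowski_map A) c"
    and *: "i < n" "j < n" "k < n" "l < n"
  shows "coeff_tensor n c i j k l = cube_tensor (\<lambda>r s. A $$ (r, s)) i j k l"
proof -
  let ?A = "\<lambda>r s. A $$ (r, s)"
  have f: "coeff_fun n c i x = x i + (lin n ?A x i) ^ 3" for x
  proof -
    have "coeff_fun n c i x = eval_coeffs n 3 c (Matrix.vec n x) $ i"
      using \<open>i < n\<close> by (simp add: coeff_fun_def eval_coeffs_def monomial_fun_def)
    also have "\<dots> = druzkowski_map A (Matrix.vec n x) $ i" using c by (simp add: has_coeffs_def)
    also have "\<dots> = cubic_map n (cube_tensor ?A) (\<lambda>j. Matrix.vec n x $ j) i"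
      using \<open>i < n\<close> by (intro druzkowski_map_index[OF A]) auto
    also have "\<dots> = x i + (lin n ?A x i) ^ 3"
      using \<open>i < n\<close> by (simp add: cubic_map_def tri_cube_tensor power3_eq_cube mult.assoc cong: lin_cong)
    finally show ?thesis .
  qed
  have e: "lin n ?A (\<lambda>m. if m = j then 1 else 0) i = ?A i j" if "j < n" for j
    using that by (simp add: lin_def if_distrib cong: if_cong)
  have neg: "lin n ?A (\<lambda>m. - u m) = (\<lambda>i. - lin n ?A u i)" for u
    using lin_cmult[of n ?A "-1" u] by simp
  show ?thesis
    unfolding coeff_tensor_def Let_def f lin_add lin_diff neg e[OF *(2)] e[OF *(3)] e[OF *(4)]
    by (simp add: cube_tensor_def power3_eq_cube field_simps)
qed

lemma druzkowski_map_has_coeffs: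
  assumes A: "A \<in> carrier_mat n n"
  shows "\<exists>c\<in>topspace (coeff_space n). has_coeffs n 3 (druzkowski_map A) c"
proof -
  let ?A = "\<lambda>r s. A $$ (r, s)"
  have "\<exists>c. \<forall>x. cubic_map n (cube_tensor ?A) x i = (\<Sum>m\<in>multi_indices n 3. c m * monomial_fun n m x)" if "i < n" for i
    by (rule poly_fun_imp_sum_monomials[OF poly_fun_cubic_map[OF that]])
  then obtain c where c: "\<And>i x. i < n \<Longrightarrow>
    cubic_map n (cube_tensor ?A) x i = (\<Sum>m\<in>multi_indices n 3. c i m * monomial_fun n m x)" by metis
  define b where "b = restrict (\<lambda>(i, m). c i m) ({..<n} \<times> multi_indices n 3)"
  have "has_coeffs n 3 (druzkowski_map A) b"
    unfolding has_coeffs_def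
  proof
    fix x :: "complex Matrix.vec" assume x: "x \<in> carrier_vec n"
    show "druzkowski_map A x = eval_coeffs n 3 b x"
    proof (rule eq_vecI)
      fix i assume "i < dim_vec (eval_coeffs n 3 b x)"
      then have "i < n" by (simp add: eval_coeffs_def)
      then show "druzkowski_map A x $ i = eval_coeffs n 3 b x $ i"
        using druzkowski_map_index[OF A x] c[of i "\<lambda>j. x $ j"]
        by (simp add: eval_coeffs_def b_def monomial_fun_def)
    qed (use druzkowski_map_carrier[OF A x] in \<open>simp add: eval_coeffs_def\<close>)
  qed
  moreover have "b \<in> topspace (coeff_space n)"
    by (simp add: coeff_space_def b_def)
  ultimately show ?thesis by blast
qed

lemma nilpotent_invertible_if_dense:
  assumes dense: "\<And>n. 1 \<le> n \<Longrightarrow>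
    dense_in_maps n {F \<in> druzkowski_maps n. has_polynomial_inverse n F} (druzkowski_maps n)"
  shows nilpotent_invertible
  unfolding nilpotent_invertible_def
proof (intro allI impI)
  fix n \<tau> assume nil: "nilpotent n \<tau>"
  show "formal_inverse_terminates n \<tau>"
  proof (cases "n = 0")
    case False
    then have "0 < n" by simp
    then obtain m A where m: "0 < m" "nilpotent m (cube_tensor A)"
      and lift: "formal_inverse_terminates m (cube_tensor A) \<Longrightarrow> formal_inverse_terminates n \<tau>"
      using druzkowski_reduction[OF _ nil] by metis
    let ?S = "{F \<in> druzkowski_maps m. has_polynomial_inverse m F}"
    let ?A = "mat m m (\<lambda>(r, s). A r s)"
    have "druzkowski_mat m ?A" by (rule druzkowski_mat_if_nilpotent[OF m(2)])
    then have D: "druzkowski_map ?A \<in> druzkowski_maps m" by (auto simp: druzkowski_maps_def)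
    obtain c where c: "c \<in> topspace (coeff_space m)" "has_coeffs m 3 (druzkowski_map ?A) c"
      using druzkowski_map_has_coeffs[of ?A m] by auto
    have "c \<in> coeff_points m (druzkowski_maps m)" using c D by (auto simp: coeff_points_def)
    with dense[of m] m(1) have cl: "c \<in> coeff_space m closure_of coeff_points m ?S"
      by (auto simp: dense_in_maps_def)
    show ?thesis
    proof (rule lift, unfold formal_inverse_terminates_def, intro exI[of _ "inverse_bound m"] allI impI)
      fix y k i assume k: "inverse_bound m \<le> k" and i: "i < m"
      \<comment> \<open>For fixed \<open>k\<close>, \<open>y\<close>, \<open>i\<close> this is the
        zero set of a continuous function of the coefficients. As the bound on \<open>k\<close> is
        uniform, it contains all invertible Druzkowski maps, hence by density every one.\<close>
      let ?Z = "{c \<in> topspace (coeff_space m). formal_inverse m (coeff_tensor m c) y k i \<in> {0}}"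
      have "closedin (coeff_space m) ?Z"
        by (rule closedin_continuous_map_preimage[OF continuous_map_formal_inverse])
           (auto intro: continuous_map_coeff_tensor i)
      moreover have "coeff_points m ?S \<subseteq> ?Z"
      proof
        fix b assume "b \<in> coeff_points m ?S"
        then obtain B where b: "b \<in> topspace (coeff_space m)" "has_coeffs m 3 (druzkowski_map B) b"
          and B: "B \<in> carrier_mat m m" "has_polynomial_inverse m (druzkowski_map B)"
          by (auto simp: coeff_points_def druzkowski_maps_def druzkowski_mat_def)
        let ?\<sigma> = "cube_tensor (\<lambda>r s. B $$ (r, s))"
        from formal_inverse_bound[OF formal_inverse_druzkowski[OF B] k i]
        have "formal_inverse m ?\<sigma> y k i = 0" .
        moreover have "formal_inverse m (coeff_tensor m b) y k i = formal_inverse m ?\<sigma> y k i"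
          by (rule formal_inverse_tensor_cong[OF coeff_tensor_druzkowski[OF B(1) b(2)] i])
        ultimately show "b \<in> ?Z" using b by simp
      qed
      ultimately have "c \<in> ?Z" using cl closure_of_minimal by blast
      moreover have "formal_inverse m (coeff_tensor m c) y k i = formal_inverse m (cube_tensor A) y k i"
      proof (rule formal_inverse_tensor_cong[OF _ i])
        fix i j k l assume "i < m" "j < m" "k < m" "l < m"
        then show "coeff_tensor m c i j k l = cube_tensor A i j k l"
          using coeff_tensor_druzkowski[OF _ c(2)] by (simp add: cube_tensor_def)
      qed
      ultimately show "formal_inverse m (cube_tensor A) y k i = 0" by simp
    qed
  qed (simp add: formal_inverse_terminates_def)
qed

section \<open>Specialization to number fields\<close>

definition is_subring :: "complex set \<Rightarrow> bool" where
  "is_subring R \<longleftrightarrow> 1 \<in> R \<and> (\<forall>x\<in>R. \<forall>y\<in>R. x - y \<in> R \<and> x * y \<in> R)"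

definition ring_hom_on :: "complex set \<Rightarrow> (complex \<Rightarrow> complex) \<Rightarrow> bool" where
  "ring_hom_on R \<phi> \<longleftrightarrow> \<phi> 1 = 1 \<and>
    (\<forall>x\<in>R. \<forall>y\<in>R. \<phi> (x + y) = \<phi> x + \<phi> y \<and> \<phi> (x * y) = \<phi> x * \<phi> y)"

definition polys_over :: "complex set \<Rightarrow> complex poly set" where
  "polys_over R = {p. \<forall>i. coeff p i \<in> R}"

definition adjoin :: "complex set \<Rightarrow> complex \<Rightarrow> complex set" where
  "adjoin R s = (\<lambda>p. poly p s) ` polys_over R"

locale complex_subring =
  fixes R :: "complex set"
  assumes R: "is_subring R"
begin

lemma one_in: "1 \<in> R" and diff_in: "x \<in> R \<Longrightarrow> y \<in> R \<Longrightarrow> x - y \<in> R"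
  and mult_in: "x \<in> R \<Longrightarrow> y \<in> R \<Longrightarrow> x * y \<in> R"
  using R by (auto simp: is_subring_def)

lemma zero_in: "0 \<in> R"
  using diff_in[OF one_in one_in] by simp

lemma minus_in: "x \<in> R \<Longrightarrow> - x \<in> R"
  using diff_in[OF zero_in] by simp

lemma add_in: "x \<in> R \<Longrightarrow> y \<in> R \<Longrightarrow> x + y \<in> R"
  using diff_in[OF _ minus_in] by simp

lemma sum_in: "(\<And>i. i \<in> S \<Longrightarrow> f i \<in> R) \<Longrightarrow> (\<Sum>i\<in>S. f i) \<in> R"
  by (induction S rule: infinite_finite_induct) (auto intro: zero_in add_in)

lemma power_in: "x \<in> R \<Longrightarrow> x ^ k \<in> R"
  by (induction k) (auto intro: one_in mult_in)

lemma of_nat_in: "of_nat k \<in> R"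
  by (induction k) (auto intro: zero_in one_in add_in)

lemma polys_over_add: "p \<in> polys_over R \<Longrightarrow> q \<in> polys_over R \<Longrightarrow> p + q \<in> polys_over R"
  by (simp add: polys_over_def add_in)

lemma polys_over_diff: "p \<in> polys_over R \<Longrightarrow> q \<in> polys_over R \<Longrightarrow> p - q \<in> polys_over R"
  by (simp add: polys_over_def diff_in)

lemma polys_over_mult: "p \<in> polys_over R \<Longrightarrow> q \<in> polys_over R \<Longrightarrow> p * q \<in> polys_over R"
  by (simp add: polys_over_def coeff_mult sum_in mult_in)

lemma polys_over_smult: "a \<in> R \<Longrightarrow> p \<in> polys_over R \<Longrightarrow> smult a p \<in> polys_over R"
  by (simp add: polys_over_def mult_in)

lemma polys_over_monom: "a \<in> R \<Longrightarrow> monom a k \<in> polys_over R"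
  by (simp add: polys_over_def zero_in)

lemma polys_over_0: "0 \<in> polys_over R"
  by (simp add: polys_over_def zero_in)

lemma polys_over_1: "1 \<in> polys_over R"
  by (simp add: polys_over_def one_in zero_in)

lemma is_subring_adjoin: "is_subring (adjoin R s)"
proof -
  have "1 \<in> adjoin R s" unfolding adjoin_def
    by (rule image_eqI[of _ _ 1]) (auto intro: polys_over_1)
  then show ?thesis
    unfolding is_subring_def adjoin_def
    by (auto simp flip: poly_diff poly_mult intro: polys_over_diff polys_over_mult)
qed

lemma subset_adjoin: "R \<subseteq> adjoin R s"
proof
  fix x assume "x \<in> R"
  then show "x \<in> adjoin R s" unfolding adjoin_def
    by (intro image_eqI[of _ _ "monom x 0"]) (auto simp: poly_monom intro: polys_over_monom)
qed

lemma in_adjoin: "s \<in> adjoin R s"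
  unfolding adjoin_def
  by (rule image_eqI[of _ _ "monom 1 1"]) (auto simp: poly_monom intro: polys_over_monom one_in)

text \<open>Leading coefficients need not be invertible in \<open>R\<close>, so each division step
  is paid for by a factor \<open>lead_coeff f\<close>.\<close>

lemma pseudo_division:
  assumes f: "f \<in> polys_over R" "f \<noteq> 0"
  shows "g \<in> polys_over R \<Longrightarrow> \<exists>k q r. q \<in> polys_over R \<and> r \<in> polys_over R \<and>
    smult (lead_coeff f ^ k) g = f * q + r \<and> (r = 0 \<or> degree r < degree f)"
proof (induction "degree g" arbitrary: g rule: less_induct)
  case less
  let ?a = "lead_coeff f"
  have a: "?a \<in> R" using f by (simp add: polys_over_def)
  show ?case
  proof (cases "degree g < degree f")
    case True
    then show ?thesis using less.prems
      by (intro exI[of _ 0] exI[of _ 0] exI[of _ g]) (simp add: polys_over_0)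
  next
    case False
    define h where "h = monom (lead_coeff g) (degree g - degree f)"
    have h: "h \<in> polys_over R"
      using less.prems by (auto simp: h_def polys_over_def zero_in)
    define g' where "g' = smult ?a g - f * h"
    have g': "g' \<in> polys_over R"
      unfolding g'_def using a f h less.prems by (intro polys_over_diff polys_over_smult polys_over_mult)
    have "degree g' \<le> degree g" unfolding g'_def
    proof (rule degree_diff_le)
      show "degree (smult ?a g) \<le> degree g" by (rule degree_smult_le)
      have "degree (f * h) \<le> degree f + (degree g - degree f)"
        by (rule order.trans[OF degree_mult_le]) (simp add: h_def degree_monom_le)
      then show "degree (f * h) \<le> degree g" using False by simp
    qed
    moreover have "coeff g' (degree g) = 0"
      using False by (simp add: g'_def h_def mult.commute[of f] coeff_monom_mult)
    ultimately consider "g' = 0" | "degree g' < degree g" using eq_zero_or_degree_less by blast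
    then obtain k q r where IH: "q \<in> polys_over R" "r \<in> polys_over R"
      "smult (?a ^ k) g' = f * q + r" "r = 0 \<or> degree r < degree f"
    proof cases
      case 1
      then show ?thesis using that[of 0 0 0] by (simp add: polys_over_0)
    next
      case 2
      show ?thesis using less.hyps[OF 2 g'] that by blast
    qed
    have "smult (?a ^ Suc k) g = f * (q + smult (?a ^ k) h) + r"
    proof -
      have "smult (?a ^ Suc k) g = smult (?a ^ k) g' + smult (?a ^ k) (f * h)"
        by (simp add: g'_def smult_diff_right mult.commute)
      then show ?thesis using IH(3) by (simp add: algebra_simps)
    qed
    moreover have "q + smult (?a ^ k) h \<in> polys_over R"
      using IH(1) a h by (intro polys_over_add polys_over_smult power_in)
    ultimately show ?thesis using IH by blast
  qed
qed

end

locale complex_subring_hom = complex_subring +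
  fixes \<phi> :: "complex \<Rightarrow> complex"
  assumes hom: "ring_hom_on R \<phi>"
begin

lemma hom_one: "\<phi> 1 = 1" and hom_add: "x \<in> R \<Longrightarrow> y \<in> R \<Longrightarrow> \<phi> (x + y) = \<phi> x + \<phi> y"
  and hom_mult: "x \<in> R \<Longrightarrow> y \<in> R \<Longrightarrow> \<phi> (x * y) = \<phi> x * \<phi> y"
  using hom by (auto simp: ring_hom_on_def)

lemma hom_zero: "\<phi> 0 = 0"
  using hom_add[OF zero_in zero_in] by simp

lemma hom_minus: "x \<in> R \<Longrightarrow> \<phi> (- x) = - \<phi> x"
  using hom_add[OF _ minus_in, of x x] by (simp add: hom_zero eq_neg_iff_add_eq_0 add.commute)

lemma hom_sum: "(\<And>i. i \<in> S \<Longrightarrow> f i \<in> R) \<Longrightarrow> \<phi> (\<Sum>i\<in>S. f i) = (\<Sum>i\<in>S. \<phi> (f i))"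
  by (induction S rule: infinite_finite_induct) (auto simp: hom_zero hom_add sum_in)

lemma hom_power: "x \<in> R \<Longrightarrow> \<phi> (x ^ k) = \<phi> x ^ k"
  by (induction k) (simp_all add: hom_one hom_mult power_in)

lemma hom_of_nat: "\<phi> (of_nat k) = of_nat k"
  by (induction k) (simp_all add: hom_zero hom_one hom_add one_in of_nat_in)

lemma coeff_hom: "coeff (map_poly \<phi> p) i = \<phi> (coeff p i)"
  by (simp add: coeff_map_poly hom_zero)

lemma map_poly_hom_add:
  "p \<in> polys_over R \<Longrightarrow> q \<in> polys_over R \<Longrightarrow> map_poly \<phi> (p + q) = map_poly \<phi> p + map_poly \<phi> q"
  by (rule poly_eqI) (simp add: coeff_hom polys_over_def hom_add)

lemma map_poly_hom_mult:
  "p \<in> polys_over R \<Longrightarrow> q \<in> polys_over R \<Longrightarrow> map_poly \<phi> (p * q) = map_poly \<phi> p * map_poly \<phi> q"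
  by (rule poly_eqI) (simp add: coeff_hom polys_over_def coeff_mult hom_sum hom_mult mult_in)

lemma map_poly_hom_smult:
  "a \<in> R \<Longrightarrow> p \<in> polys_over R \<Longrightarrow> map_poly \<phi> (smult a p) = smult (\<phi> a) (map_poly \<phi> p)"
  by (rule poly_eqI) (simp add: coeff_hom polys_over_def hom_mult)

text \<open>Two representations of an element as \<open>poly p s\<close> differ by a polynomial with
  root \<open>s\<close>, so the value at \<open>\<xi>\<close> does not depend on the choice.\<close>

lemma extend_hom:
  assumes root: "\<And>p. p \<in> polys_over R \<Longrightarrow> poly p s = 0 \<Longrightarrow> poly (map_poly \<phi> p) \<xi> = 0"
  shows "\<exists>\<psi>. ring_hom_on (adjoin R s) \<psi> \<and>
    (\<forall>p\<in>polys_over R. \<psi> (poly p s) = poly (map_poly \<phi> p) \<xi>)"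
proof -
  define \<psi> where "\<psi> x = poly (map_poly \<phi> (SOME p. p \<in> polys_over R \<and> poly p s = x)) \<xi>" for x
  have \<psi>: "\<psi> (poly p s) = poly (map_poly \<phi> p) \<xi>" if p: "p \<in> polys_over R" for p
  proof -
    define q where "q = (SOME q. q \<in> polys_over R \<and> poly q s = poly p s)"
    have q: "q \<in> polys_over R" "poly q s = poly p s"
      unfolding q_def using someI[of "\<lambda>q. q \<in> polys_over R \<and> poly q s = poly p s" p] p by auto
    have "poly (map_poly \<phi> (q - p)) \<xi> = 0" using q p by (intro root polys_over_diff) auto
    moreover have "map_poly \<phi> q = map_poly \<phi> (q - p) + map_poly \<phi> p"
      using map_poly_hom_add[OF polys_over_diff[OF q(1) p] p] by simp
    ultimately show ?thesis by (simp add: \<psi>_def q_def)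
  qed
  have "\<psi> 1 = 1"
    using \<psi>[OF polys_over_monom[OF one_in, of 0]]
    by (simp add: poly_monom map_poly_monom hom_zero hom_one)
  moreover have "\<psi> (poly p s + poly q s) = \<psi> (poly p s) + \<psi> (poly q s)"
    "\<psi> (poly p s * poly q s) = \<psi> (poly p s) * \<psi> (poly q s)"
    if "p \<in> polys_over R" "q \<in> polys_over R" for p q
    using that \<psi>[OF polys_over_add[OF that]] \<psi>[OF polys_over_mult[OF that]]
    by (simp_all add: \<psi> map_poly_hom_add map_poly_hom_mult)
  ultimately have "ring_hom_on (adjoin R s) \<psi>"
    unfolding ring_hom_on_def adjoin_def by auto
  with \<psi> show ?thesis by blast
qed

end

section \<open>Number fields as finite-dimensional algebras over the rationals\<close>

interpretation rat_complex: vector_space "\<lambda>(q::rat) (x::complex). of_rat q * x"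
  by standard (auto simp: algebra_simps of_rat_add of_rat_mult)

definition finite_rat_algebra :: "complex set \<Rightarrow> bool" where
  "finite_rat_algebra K \<longleftrightarrow> is_subring K \<and> (\<exists>B. finite B \<and> K = rat_complex.span B)"

lemma finite_rat_algebra_Rats: "finite_rat_algebra \<rat>"
proof -
  have "rat_complex.span {1} = \<rat>"
    unfolding rat_complex.span_singleton by (auto simp: Rats_def)
  moreover have "is_subring \<rat>" by (simp add: is_subring_def)
  ultimately show ?thesis unfolding finite_rat_algebra_def by (metis finite.emptyI finite_insert)
qed

lemma finite_rat_algebra_basis:
  assumes "finite_rat_algebra K"
  obtains B where "finite B" "rat_complex.independent B" "K = rat_complex.span B"
proof -
  obtain S where S: "finite S" "K = rat_complex.span S"
    using assms unfolding finite_rat_algebra_def by blast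
  obtain B where B: "B \<subseteq> S" "rat_complex.independent B" "S \<subseteq> rat_complex.span B"
    using rat_complex.maximal_independent_subset[of S] by blast
  have "rat_complex.span S = rat_complex.span B"
  proof
    show "rat_complex.span S \<subseteq> rat_complex.span B"
      by (rule rat_complex.span_minimal[OF B(3) rat_complex.subspace_span])
    show "rat_complex.span B \<subseteq> rat_complex.span S" by (rule rat_complex.span_mono[OF B(1)])
  qed
  then show thesis using that B S finite_subset by blast
qed

lemma rat_mult_span: "(\<And>b. b \<in> B \<Longrightarrow> a * b \<in> T) \<Longrightarrow> rat_complex.subspace T \<Longrightarrow>
  x \<in> rat_complex.span B \<Longrightarrow> a * x \<in> T"
proof -
  assume *: "\<And>b. b \<in> B \<Longrightarrow> a * b \<in> T" "rat_complex.subspace T" "x \<in> rat_complex.span B"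
  have "rat_complex.span B \<subseteq> {x. a * x \<in> T}"
  proof (rule rat_complex.span_minimal)
    show "rat_complex.subspace {x. a * x \<in> T}"
      using *(2) unfolding rat_complex.subspace_def
      by (auto simp: distrib_left) (metis mult.left_commute)
  qed (use * in auto)
  then show ?thesis using * by blast
qed

text \<open>Multiplication by \<open>a\<close> carries a basis to an independent subset of
  \<open>K\<close> of the same size. If \<open>1\<close> were outside its span, adding
  \<open>1\<close> would exceed the dimension.\<close>

lemma finite_rat_algebra_inverse:
  assumes K: "finite_rat_algebra K" and a: "a \<in> K" "a \<noteq> 0"
  shows "inverse a \<in> K"
proof -
  obtain B where B: "finite B" "rat_complex.independent B" "K = rat_complex.span B"
    using finite_rat_algebra_basis[OF K] .
  interpret complex_subring K by unfold_locales (use K in \<open>simp add: finite_rat_algebra_def\<close>)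
  have BK: "B \<subseteq> K" using B(3) rat_complex.span_superset by blast
  let ?aB = "(\<lambda>b. a * b) ` B"
  have inj: "inj_on (\<lambda>b. a * b) B" using a(2) by (auto simp: inj_on_def)
  have sp: "rat_complex.span ?aB = (\<lambda>x. a * x) ` rat_complex.span B"
  proof
    have "rat_complex.subspace ((\<lambda>x. a * x) ` rat_complex.span B)"
      using rat_complex.subspace_span[of B] unfolding rat_complex.subspace_def
      by (auto simp flip: distrib_left simp: mult.left_commute[of "of_rat _" a])
    then show "rat_complex.span ?aB \<subseteq> (\<lambda>x. a * x) ` rat_complex.span B"
      by (rule rat_complex.span_minimal[rotated]) (auto intro: rat_complex.span_base)
    show "(\<lambda>x. a * x) ` rat_complex.span B \<subseteq> rat_complex.span ?aB"
    proof
      fix y assume "y \<in> (\<lambda>x. a * x) ` rat_complex.span B"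
      then obtain x where "x \<in> rat_complex.span B" "y = a * x" by blast
      then show "y \<in> rat_complex.span ?aB"
        by (auto intro: rat_mult_span[of B a "rat_complex.span ?aB" x] rat_complex.span_base)
    qed
  qed
  have ind: "rat_complex.independent ?aB"
  proof -
    have "b \<notin> rat_complex.span (B - {b})" if "b \<in> B" for b
      using B(2) that unfolding rat_complex.dependent_def by blast
    moreover have "rat_complex.span (?aB - {a * b}) \<subseteq> (\<lambda>x. a * x) ` rat_complex.span (B - {b})" if "b \<in> B" for b
    proof (rule rat_complex.span_minimal)
      show "rat_complex.subspace ((\<lambda>x. a * x) ` rat_complex.span (B - {b}))"
        using rat_complex.subspace_span[of "B - {b}"] unfolding rat_complex.subspace_def
        by (auto simp flip: distrib_left simp: mult.left_commute[of "of_rat _" a])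
    qed (auto intro!: imageI rat_complex.span_base)
    ultimately show ?thesis unfolding rat_complex.dependent_def using a(2) by fastforce
  qed
  have "1 \<in> rat_complex.span ?aB"
  proof (rule ccontr)
    assume n: "1 \<notin> rat_complex.span ?aB"
    have "rat_complex.independent (insert 1 ?aB)" using n ind by (rule rat_complex.independent_insertI)
    moreover have "insert 1 ?aB \<subseteq> rat_complex.span B"
      using BK a(1) one_in mult_in by (auto simp flip: B(3))
    ultimately have "card (insert 1 ?aB) \<le> card B"
      using rat_complex.independent_span_bound[OF B(1)] by blast
    moreover have "1 \<notin> ?aB" using n rat_complex.span_base by blast
    ultimately show False using B(1) card_image[OF inj] by simp
  qed
  then obtain x where "x \<in> K" "1 = a * x" unfolding sp B(3) by blast
  then show ?thesis using inverse_unique[of a x] by simp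
qed

text \<open>Division by \<open>f\<close> leaves powers of \<open>\<xi>\<close> below its degree, and
  its leading coefficient is invertible in \<open>K\<close>. The image of a minimal polynomial can
  be reducible, so \<open>f\<close> is an arbitrary nonzero polynomial with root
  \<open>\<xi>\<close>.\<close>

lemma finite_rat_algebra_adjoin:
  assumes K: "finite_rat_algebra K" and f: "f \<in> polys_over K" "f \<noteq> 0" "poly f \<xi> = 0"
  shows "finite_rat_algebra (adjoin K \<xi>)"
proof -
  interpret complex_subring K by unfold_locales (use K in \<open>simp add: finite_rat_algebra_def\<close>)
  interpret A: complex_subring "adjoin K \<xi>" by unfold_locales (rule is_subring_adjoin)
  obtain B where B: "finite B" "K = rat_complex.span B" using K unfolding finite_rat_algebra_def by blast
  have BK: "B \<subseteq> K" using B(2) rat_complex.span_superset by blast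
  let ?B = "(\<lambda>(b, i). b * \<xi> ^ i) ` (B \<times> {..<degree f})"
  have rat_in: "of_rat q * x \<in> K" if "x \<in> K" for q x
    using that rat_complex.span_scale[of x B q] by (simp add: B(2))
  then have of_rat_in: "of_rat q \<in> K" for q using one_in by fastforce
  have "adjoin K \<xi> = rat_complex.span ?B"
  proof
    show "adjoin K \<xi> \<subseteq> rat_complex.span ?B"
    proof
      fix x assume "x \<in> adjoin K \<xi>"
      then obtain p where p: "p \<in> polys_over K" "x = poly p \<xi>" by (auto simp: adjoin_def)
      obtain k q r where r: "r \<in> polys_over K" "smult (lead_coeff f ^ k) p = f * q + r"
        "r = 0 \<or> degree r < degree f" using pseudo_division[OF f(1,2) p(1)] by blast
      define a where "a = inverse (lead_coeff f ^ k)"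
      have "lead_coeff f \<in> K" using f(1) by (simp add: polys_over_def)
      then have a: "a \<in> K" "a * lead_coeff f ^ k = 1"
        using f(2) by (auto simp: a_def intro!: finite_rat_algebra_inverse[OF K] power_in)
      have "lead_coeff f ^ k * x = poly r \<xi>" using arg_cong[OF r(2), of "\<lambda>p. poly p \<xi>"] p(2) f(3) by simp
      then have "x = a * poly r \<xi>" using a(2) by (metis mult.assoc mult_1)
      also have "\<dots> = (\<Sum>i<degree f. (a * coeff r i) * \<xi> ^ i)"
      proof (cases "r = 0")
        case False
        then have "degree r < degree f" using r(3) by simp
        then have "poly r \<xi> = (\<Sum>i<degree f. coeff r i * \<xi> ^ i)"
          unfolding poly_altdef by (intro sum.mono_neutral_left) (auto simp: coeff_eq_0)
        then show ?thesis by (simp add: sum_distrib_left mult.assoc)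
      qed simp
      also have "\<dots> \<in> rat_complex.span ?B"
      proof (rule rat_complex.span_sum)
        fix i assume i: "i \<in> {..<degree f}"
        have "a * coeff r i \<in> rat_complex.span B" using a(1) r(1) mult_in by (simp add: polys_over_def flip: B(2))
        then have "\<xi> ^ i * (a * coeff r i) \<in> rat_complex.span ?B"
          by (rule rat_mult_span[rotated 2])
             (use i in \<open>force intro!: rat_complex.span_base simp: mult.commute\<close>, rule rat_complex.subspace_span)
        then show "a * coeff r i * \<xi> ^ i \<in> rat_complex.span ?B" by (simp add: mult.commute)
      qed
      finally show "x \<in> rat_complex.span ?B" .
    qed
    show "rat_complex.span ?B \<subseteq> adjoin K \<xi>"
    proof (rule rat_complex.span_minimal)
      show "?B \<subseteq> adjoin K \<xi>"
        using BK subset_adjoin in_adjoin by (auto intro!: A.mult_in A.power_in)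
      show "rat_complex.subspace (adjoin K \<xi>)"
        unfolding rat_complex.subspace_def
        using subset_adjoin of_rat_in by (auto intro!: A.zero_in A.add_in A.mult_in)
    qed
  qed
  moreover have "finite ?B" using B(1) by auto
  ultimately show ?thesis unfolding finite_rat_algebra_def using is_subring_adjoin by blast
qed

text \<open>Only one prescribed element is kept nonzero: a ring with transcendental elements has no
  injective homomorphism to a number field.\<close>

definition specializable :: "complex set \<Rightarrow> bool" where
  "specializable R \<longleftrightarrow> (\<forall>b\<in>R. b \<noteq> 0 \<longrightarrow>
    (\<exists>K \<phi>. finite_rat_algebra K \<and> ring_hom_on R \<phi> \<and> \<phi> ` R \<subseteq> K \<and> \<phi> b \<noteq> 0))"

text \<open>If the leading coefficient of \<open>p\<close> is not killed, the image of
  \<open>p\<close> is not zero and some natural is not a root of it. As \<open>s\<close> satisfies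
  no relation, it may be sent to this natural.\<close>

lemma specializable_adjoin_transcendental:
  assumes R: "is_subring R" and spec: "specializable R"
    and s: "\<And>p. p \<in> polys_over R \<Longrightarrow> poly p s = 0 \<Longrightarrow> p = 0"
  shows "specializable (adjoin R s)"
  unfolding specializable_def
proof (intro ballI impI)
  fix b assume "b \<in> adjoin R s" "b \<noteq> 0"
  then obtain p where "p \<in> polys_over R" "b = poly p s" by (auto simp: adjoin_def)
  with \<open>b \<noteq> 0\<close> have p: "p \<in> polys_over R" "b = poly p s" "p \<noteq> 0" by auto
  then have "lead_coeff p \<in> R" "lead_coeff p \<noteq> 0" by (auto simp: polys_over_def)
  then obtain K \<phi> where K: "finite_rat_algebra K" "ring_hom_on R \<phi>" "\<phi> ` R \<subseteq> K" "\<phi> (lead_coeff p) \<noteq> 0"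
    using spec unfolding specializable_def by blast
  interpret complex_subring_hom R \<phi> by unfold_locales (use R K in auto)
  interpret K: complex_subring K by unfold_locales (use K in \<open>simp add: finite_rat_algebra_def\<close>)
  have "map_poly \<phi> p \<noteq> 0" using K(4) by (metis coeff_hom coeff_0)
  then obtain m :: nat where m: "poly (map_poly \<phi> p) (of_nat m) \<noteq> 0" using poly_eq_0_if_nat_roots by blast
  have "\<exists>\<psi>. ring_hom_on (adjoin R s) \<psi> \<and> (\<forall>p\<in>polys_over R. \<psi> (poly p s) = poly (map_poly \<phi> p) (of_nat m))"
    by (rule extend_hom) (use s in fastforce)
  then obtain \<psi> where \<psi>: "ring_hom_on (adjoin R s) \<psi>"
    "\<And>p. p \<in> polys_over R \<Longrightarrow> \<psi> (poly p s) = poly (map_poly \<phi> p) (of_nat m)" by blast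
  have "\<psi> ` adjoin R s \<subseteq> K"
  proof
    fix y assume "y \<in> \<psi> ` adjoin R s"
    then obtain q where q: "q \<in> polys_over R" "y = poly (map_poly \<phi> q) (of_nat m)"
      using \<psi>(2) by (auto simp: adjoin_def)
    have "\<phi> (coeff q i) \<in> K" for i using q(1) K(3) by (auto simp: polys_over_def)
    then show "y \<in> K" unfolding q(2) poly_altdef coeff_hom
      by (intro K.sum_in K.mult_in K.power_in K.of_nat_in)
  qed
  moreover have "\<psi> b \<noteq> 0" using \<psi>(2)[OF p(1)] p(2) m by simp
  ultimately show "\<exists>K \<phi>. finite_rat_algebra K \<and> ring_hom_on (adjoin R s) \<phi> \<and> \<phi> ` adjoin R s \<subseteq> K \<and> \<phi> b \<noteq> 0"
    using K(1) \<psi>(1) by blast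
qed

text \<open>Bezout over the fraction field, with denominators cleared: an element \<open>h\<close>
  of least degree in the ideal of \<open>f\<close> and \<open>g\<close> divides both up to
  constants. It is not zero at \<open>s\<close> because \<open>g\<close> is not, so the cofactor of
  \<open>h\<close> in \<open>f\<close> has the root \<open>s\<close>, and minimality of
  \<open>f\<close> makes \<open>h\<close> constant.\<close>

lemma (in complex_subring) constant_combination:
  assumes f: "f \<in> polys_over R" "f \<noteq> 0" "poly f s = 0"
    and min: "\<forall>p\<in>polys_over R. p \<noteq> 0 \<longrightarrow> poly p s = 0 \<longrightarrow> degree f \<le> degree p"
    and g: "g \<in> polys_over R" "poly g s \<noteq> 0"
  obtains c u v where "c \<in> R" "c \<noteq> 0" "u \<in> polys_over R" "v \<in> polys_over R" "[:c:] = u * g + v * f"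
proof -
  define I where "I = {h. h \<noteq> 0 \<and> (\<exists>u\<in>polys_over R. \<exists>v\<in>polys_over R. h = u * g + v * f)}"
  have I_poly: "h \<in> polys_over R" if "h \<in> I" for h
    using that f(1) g(1) by (auto simp: I_def intro!: polys_over_add polys_over_mult)
  note one = polys_over_1
  have "f \<in> I" unfolding I_def using f(2) one polys_over_0 by force
  then obtain h where h: "h \<in> I" and hmin: "\<And>h'. h' \<in> I \<Longrightarrow> degree h \<le> degree h'"
    using ex_has_least_nat[of "\<lambda>h. h \<in> I" f degree] by blast
  have h0: "h \<noteq> 0" using h by (simp add: I_def)
  let ?c = "lead_coeff h"
  have c: "?c \<in> R" "?c \<noteq> 0" using I_poly[OF h] h0 by (auto simp: polys_over_def)
  obtain u v where uv: "u \<in> polys_over R" "v \<in> polys_over R" "h = u * g + v * f" using h by (auto simp: I_def)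
  have dvd: "\<exists>k q. q \<in> polys_over R \<and> smult (?c ^ k) p = h * q"
    if p: "p \<in> polys_over R" "\<exists>u\<in>polys_over R. \<exists>v\<in>polys_over R. p = u * g + v * f" for p
  proof -
    obtain k q r where q: "q \<in> polys_over R" "r \<in> polys_over R" "smult (?c ^ k) p = h * q + r"
      "r = 0 \<or> degree r < degree h" using pseudo_division[OF I_poly[OF h] h0 p(1)] by blast
    have "r = 0"
    proof (rule ccontr)
      assume "r \<noteq> 0"
      obtain u' v' where u': "u' \<in> polys_over R" "v' \<in> polys_over R" "p = u' * g + v' * f" using p(2) by blast
      have "r = smult (?c ^ k) p - h * q" using q(3) by simp
      also have "\<dots> = (smult (?c ^ k) u' - u * q) * g + (smult (?c ^ k) v' - v * q) * f"
        unfolding u'(3) uv(3) by (simp add: algebra_simps smult_add_right)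
      finally have "r \<in> I"
        unfolding I_def using \<open>r \<noteq> 0\<close> u' uv q(1) c(1)
        by (auto intro!: bexI polys_over_diff polys_over_smult polys_over_mult power_in)
      then show False using hmin q(4) \<open>r \<noteq> 0\<close> by fastforce
    qed
    then show ?thesis using q by auto
  qed
  have "\<exists>u\<in>polys_over R. \<exists>v\<in>polys_over R. f = u * g + v * f" using one polys_over_0 by force
  from dvd[OF f(1) this] obtain k q where q: "q \<in> polys_over R" "smult (?c ^ k) f = h * q" by blast
  have "\<exists>u\<in>polys_over R. \<exists>v\<in>polys_over R. g = u * g + v * f" using one polys_over_0 by force
  from dvd[OF g(1) this] obtain l q' where q': "smult (?c ^ l) g = h * q'" by blast
  have "poly h s \<noteq> 0"
  proof
    assume "poly h s = 0"
    then have "?c ^ l * poly g s = 0" using arg_cong[OF q', of "\<lambda>p. poly p s"] by simp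
    then show False using c(2) g(2) by simp
  qed
  moreover have "poly h s * poly q s = 0" using arg_cong[OF q(2), of "\<lambda>p. poly p s"] f(3) by simp
  ultimately have "poly q s = 0" by simp
  moreover have q0: "q \<noteq> 0" using q(2) f(2) c(2) by auto
  ultimately have "degree f \<le> degree q" using min q(1) by blast
  moreover have "degree f = degree h + degree q"
    using arg_cong[OF q(2), of degree] c(2) degree_mult_eq[OF h0 q0] by simp
  ultimately have "degree h = 0" by simp
  then have "h = [:?c:]" by (metis degree_eq_zeroE lead_coeff_pCons(2) pCons_0_0 coeff_pCons_0 degree_pCons_0)
  then show thesis using that[of ?c u v] c uv by simp
qed

text \<open>The homomorphism on \<open>R\<close> is chosen so as not to kill the leading coefficient
  of \<open>f\<close> times the constant \<open>c\<close>. The first factor preserves the degree, so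
  the image of \<open>f\<close> has a root; the second, through
  \<open>[:c:] = u * g + v * f\<close>, keeps the image of \<open>g\<close> from vanishing at that
  root.\<close>

lemma specializable_adjoin_algebraic:
  assumes R: "is_subring R" and spec: "specializable R"
    and f: "f \<in> polys_over R" "f \<noteq> 0" "poly f s = 0"
    and min: "\<And>p. p \<in> polys_over R \<Longrightarrow> p \<noteq> 0 \<Longrightarrow> poly p s = 0 \<Longrightarrow> degree f \<le> degree p"
  shows "specializable (adjoin R s)"
  unfolding specializable_def
proof (intro ballI impI)
  fix b assume b: "b \<in> adjoin R s" "b \<noteq> 0"
  interpret R: complex_subring R by unfold_locales (rule R)
  obtain g where g: "g \<in> polys_over R" "b = poly g s" using b by (auto simp: adjoin_def)
  have "\<forall>p\<in>polys_over R. p \<noteq> 0 \<longrightarrow> poly p s = 0 \<longrightarrow> degree f \<le> degree p"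
    using min by blast
  moreover have "poly g s \<noteq> 0" using b(2) g(2) by simp
  ultimately obtain c u v where c: "c \<in> R" "c \<noteq> 0"
    and uv: "u \<in> polys_over R" "v \<in> polys_over R" "[:c:] = u * g + v * f"
    using R.constant_combination[OF f _ g(1)] by metis
  let ?a = "lead_coeff f"
  have a: "?a \<in> R" "?a \<noteq> 0" using f by (auto simp: polys_over_def)
  have "?a * c \<in> R" "?a * c \<noteq> 0" using a c R.mult_in by auto
  then obtain K \<phi> where K: "finite_rat_algebra K" "ring_hom_on R \<phi>" "\<phi> ` R \<subseteq> K" "\<phi> (?a * c) \<noteq> 0"
    using spec unfolding specializable_def by blast
  interpret complex_subring_hom R \<phi> by unfold_locales (rule K)
  interpret K: complex_subring K by unfold_locales (use K in \<open>simp add: finite_rat_algebra_def\<close>)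
  have \<phi>: "\<phi> ?a \<noteq> 0" "\<phi> c \<noteq> 0" using K(4) a c by (auto simp: hom_mult)
  have over: "map_poly \<phi> p \<in> polys_over K" if "p \<in> polys_over R" for p
    using that K(3) by (auto simp: polys_over_def coeff_hom)
  let ?f = "map_poly \<phi> f"
  have f0: "?f \<noteq> 0" using \<phi>(1) by (metis coeff_hom coeff_0)
  have "degree f \<noteq> 0"
  proof
    assume "degree f = 0"
    then obtain e where "f = [:e:]" by (rule degree_eq_zeroE)
    then show False using f by simp
  qed
  moreover have "degree f \<le> degree ?f" by (rule le_degree) (simp add: coeff_hom \<phi>)
  ultimately have "degree ?f \<noteq> 0" by simp
  then obtain \<xi> where \<xi>: "poly ?f \<xi> = 0"
    using fundamental_theorem_of_algebra[of ?f] by (auto simp: constant_degree)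
  have "\<exists>\<psi>. ring_hom_on (adjoin R s) \<psi> \<and> (\<forall>p\<in>polys_over R. \<psi> (poly p s) = poly (map_poly \<phi> p) \<xi>)"
  proof (rule extend_hom)
    fix p assume p: "p \<in> polys_over R" "poly p s = 0"
    obtain k q r where q: "q \<in> polys_over R" "r \<in> polys_over R" "smult (?a ^ k) p = f * q + r"
      "r = 0 \<or> degree r < degree f" using R.pseudo_division[OF f(1,2) p(1)] by blast
    have "poly r s = 0" using arg_cong[OF q(3), of "\<lambda>p. poly p s"] p(2) f(3) by simp
    then have "r = 0" using min[OF q(2)] q(4) by fastforce
    then have "smult (?a ^ k) p = f * q" using q(3) by simp
    then have "map_poly \<phi> (smult (?a ^ k) p) = map_poly \<phi> (f * q)" by simp
    then have "smult (\<phi> ?a ^ k) (map_poly \<phi> p) = ?f * map_poly \<phi> q"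
      using p(1) q(1) f(1) a(1) by (simp add: map_poly_hom_mult map_poly_hom_smult hom_power R.power_in)
    from arg_cong[OF this, of "\<lambda>p. poly p \<xi>"] \<xi> \<phi>(1)
    show "poly (map_poly \<phi> p) \<xi> = 0" by simp
  qed
  then obtain \<psi> where \<psi>: "ring_hom_on (adjoin R s) \<psi>"
    "\<And>p. p \<in> polys_over R \<Longrightarrow> \<psi> (poly p s) = poly (map_poly \<phi> p) \<xi>" by blast
  have "\<psi> ` adjoin R s \<subseteq> adjoin K \<xi>"
    using \<psi>(2) over by (auto simp: adjoin_def)
  moreover have "\<psi> b \<noteq> 0"
  proof
    assume "\<psi> b = 0"
    then have "poly (map_poly \<phi> g) \<xi> = 0" using \<psi>(2)[OF g(1)] g(2) by simp
    moreover have "map_poly \<phi> [:c:] = map_poly \<phi> u * map_poly \<phi> g + map_poly \<phi> v * ?f"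
      using uv g f by (simp add: map_poly_hom_add map_poly_hom_mult R.polys_over_mult)
    moreover have "map_poly \<phi> [:c:] = [:\<phi> c:]"
      by (rule poly_eqI) (simp add: coeff_hom coeff_pCons hom_zero split: nat.splits)
    ultimately have "[:\<phi> c:] = map_poly \<phi> u * map_poly \<phi> g + map_poly \<phi> v * ?f"
      and "poly (map_poly \<phi> g) \<xi> = 0" by simp_all
    from arg_cong[OF this(1), of "\<lambda>p. poly p \<xi>"] this(2) show False using \<phi>(2) \<xi> by simp
  qed
  ultimately show "\<exists>K \<phi>. finite_rat_algebra K \<and> ring_hom_on (adjoin R s) \<phi> \<and> \<phi> ` adjoin R s \<subseteq> K \<and> \<phi> b \<noteq> 0"
    using finite_rat_algebra_adjoin[OF K(1) over[OF f(1)] f0 \<xi>] \<psi>(1) by blast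
qed

lemma specializable_adjoin:
  assumes "is_subring R" "specializable R"
  shows "specializable (adjoin R s)"
proof (cases "\<exists>p\<in>polys_over R. p \<noteq> 0 \<and> poly p s = 0")
  case True
  then obtain p where "p \<in> polys_over R \<and> p \<noteq> 0 \<and> poly p s = 0" by blast
  from ex_has_least_nat[of "\<lambda>p. p \<in> polys_over R \<and> p \<noteq> 0 \<and> poly p s = 0", OF this, of degree]
  obtain f where "f \<in> polys_over R" "f \<noteq> 0" "poly f s = 0"
    "\<And>p. p \<in> polys_over R \<Longrightarrow> p \<noteq> 0 \<Longrightarrow> poly p s = 0 \<Longrightarrow> degree f \<le> degree p" by blast
  then show ?thesis by (rule specializable_adjoin_algebraic[OF assms])
next
  case False
  then show ?thesis using specializable_adjoin_transcendental[OF assms] by blast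
qed

lemma specializable_Ints: "specializable \<int>"
proof -
  have "ring_hom_on \<int> (\<lambda>x. x)" by (simp add: ring_hom_on_def)
  moreover have "(\<lambda>x. x) ` \<int> \<subseteq> (\<rat> :: complex set)" by (auto elim: Ints_cases)
  ultimately show ?thesis unfolding specializable_def using finite_rat_algebra_Rats by blast
qed

lemma specializable_subring_exists:
  "finite X \<Longrightarrow> \<exists>R. is_subring R \<and> X \<subseteq> R \<and> specializable R"
proof (induction X rule: finite_induct)
  case empty
  have "is_subring \<int>" by (simp add: is_subring_def)
  then show ?case using specializable_Ints by blast
next
  case (insert s X)
  then obtain R where X: "is_subring R" "X \<subseteq> R" "specializable R" by blast
  interpret complex_subring R by unfold_locales (rule X)
  show ?case
    using is_subring_adjoin[of s] specializable_adjoin[OF X(1,3), of s] subset_adjoin[of s] in_adjoin[of s] X(2)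
    by blast
qed

section \<open>Restriction of scalars\<close>

context complex_subring
begin

lemma tri_in:
  assumes "\<And>j k l. j < n \<Longrightarrow> k < n \<Longrightarrow> l < n \<Longrightarrow> \<tau> i j k l \<in> R" "\<And>j. j < n \<Longrightarrow> u j \<in> R"
    "\<And>j. j < n \<Longrightarrow> v j \<in> R" "\<And>j. j < n \<Longrightarrow> w j \<in> R"
  shows "tri n \<tau> u v w i \<in> R"
  unfolding tri_def by (intro sum_in mult_in) (use assms in auto)

lemma formal_inverse_in:
  assumes \<tau>: "\<And>i j k l. i < n \<Longrightarrow> j < n \<Longrightarrow> k < n \<Longrightarrow> l < n \<Longrightarrow> \<tau> i j k l \<in> R"
    and y: "\<And>j. j < n \<Longrightarrow> y j \<in> R"
  shows "i < n \<Longrightarrow> formal_inverse n \<tau> y k i \<in> R"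
proof (induction k arbitrary: i rule: less_induct)
  case (less k)
  consider "k = 0" | "k = 1" | k' where "k = Suc (Suc k')"
    by (metis One_nat_def old.nat.exhaust)
  then show ?case
  proof cases
    case 3
    show ?thesis unfolding 3 formal_inverse.simps
      by (intro minus_in sum_in tri_in less.IH \<tau>) (use 3 less.prems in auto)
  qed (use less.prems y zero_in in auto)
qed

lemma jac_pow_in:
  assumes \<tau>: "\<And>i j k l. i < n \<Longrightarrow> j < n \<Longrightarrow> k < n \<Longrightarrow> l < n \<Longrightarrow> \<tau> i j k l \<in> R"
    and x: "\<And>j. j < n \<Longrightarrow> x j \<in> R" and v: "\<And>j. j < n \<Longrightarrow> v j \<in> R"
  shows "i < n \<Longrightarrow> (jac n \<tau> x ^^ p) v i \<in> R"
proof (induction p arbitrary: i)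
  case (Suc p)
  show ?case unfolding funpow.simps o_apply jac_def[of n \<tau> x "(jac n \<tau> x ^^ p) v"]
    by (intro add_in tri_in \<tau> x Suc) (use Suc.prems in auto)
qed (use v in auto)

end

context complex_subring_hom
begin

lemma hom_tri:
  assumes "\<And>j k l. j < n \<Longrightarrow> k < n \<Longrightarrow> l < n \<Longrightarrow> \<tau> i j k l \<in> R" "\<And>j. j < n \<Longrightarrow> u j \<in> R"
    "\<And>j. j < n \<Longrightarrow> v j \<in> R" "\<And>j. j < n \<Longrightarrow> w j \<in> R"
  shows "\<phi> (tri n \<tau> u v w i) =
    tri n (\<lambda>i j k l. \<phi> (\<tau> i j k l)) (\<lambda>j. \<phi> (u j)) (\<lambda>j. \<phi> (v j)) (\<lambda>j. \<phi> (w j)) i"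
proof -
  have "\<phi> (\<Sum>j<n. \<Sum>k<n. \<Sum>l<n. g j k l) = (\<Sum>j<n. \<Sum>k<n. \<Sum>l<n. \<phi> (g j k l))"
    if g: "\<And>j k l. j < n \<Longrightarrow> k < n \<Longrightarrow> l < n \<Longrightarrow> g j k l \<in> R" for g
  proof -
    have "\<phi> (\<Sum>j<n. \<Sum>k<n. \<Sum>l<n. g j k l) = (\<Sum>j<n. \<phi> (\<Sum>k<n. \<Sum>l<n. g j k l))"
      by (rule hom_sum) (use g in \<open>auto intro!: sum_in\<close>)
    also have "\<dots> = (\<Sum>j<n. \<Sum>k<n. \<phi> (\<Sum>l<n. g j k l))"
      by (intro sum.cong refl hom_sum) (use g in \<open>auto intro!: sum_in\<close>)
    also have "\<dots> = (\<Sum>j<n. \<Sum>k<n. \<Sum>l<n. \<phi> (g j k l))"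
      by (intro sum.cong refl hom_sum) (use g in auto)
    finally show ?thesis .
  qed
  from this[of "\<lambda>j k l. \<tau> i j k l * (u j * (v k * w l))"] show ?thesis
    unfolding tri_def using assms by (simp add: hom_mult mult_in)
qed

lemma hom_formal_inverse:
  assumes \<tau>: "\<And>i j k l. i < n \<Longrightarrow> j < n \<Longrightarrow> k < n \<Longrightarrow> l < n \<Longrightarrow> \<tau> i j k l \<in> R"
    and y: "\<And>j. j < n \<Longrightarrow> y j \<in> R"
  shows "i < n \<Longrightarrow> \<phi> (formal_inverse n \<tau> y k i) =
    formal_inverse n (\<lambda>i j k l. \<phi> (\<tau> i j k l)) (\<lambda>j. \<phi> (y j)) k i"
proof (induction k arbitrary: i rule: less_induct)
  case (less k)
  consider "k = 0" | "k = 1" | k' where "k = Suc (Suc k')"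
    by (metis One_nat_def old.nat.exhaust)
  then show ?case
  proof cases
    case 3
    let ?g = "formal_inverse n \<tau> y" and ?h = "formal_inverse n (\<lambda>i j k l. \<phi> (\<tau> i j k l)) (\<lambda>j. \<phi> (y j))"
    have in_R: "?g p j \<in> R" if "j < n" for p j by (rule formal_inverse_in[OF \<tau> y that])
    have t: "\<phi> (tri n \<tau> (?g p) (?g r) (?g (k' - p - r)) i)
      = tri n (\<lambda>i j k l. \<phi> (\<tau> i j k l)) (?h p) (?h r) (?h (k' - p - r)) i" if "p \<le> k'" "r \<le> k' - p" for p r
    proof -
      have "\<phi> (tri n \<tau> (?g p) (?g r) (?g (k' - p - r)) i) = tri n (\<lambda>i j k l. \<phi> (\<tau> i j k l))
          (\<lambda>j. \<phi> (?g p j)) (\<lambda>j. \<phi> (?g r j)) (\<lambda>j. \<phi> (?g (k' - p - r) j)) i"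
        by (rule hom_tri) (use \<tau> in_R less.prems in auto)
      then show ?thesis using that 3 less.IH by (auto intro: tri_cong)
    qed
    have tR: "tri n \<tau> (?g p) (?g r) (?g (k' - p - r)) i \<in> R" for p r
      by (rule tri_in) (use \<tau> in_R less.prems in auto)
    have "\<phi> (formal_inverse n \<tau> y k i)
        = - (\<Sum>p\<le>k'. \<Sum>r\<le>k' - p. \<phi> (tri n \<tau> (?g p) (?g r) (?g (k' - p - r)) i))"
    proof -
      have "\<phi> (formal_inverse n \<tau> y k i)
          = - \<phi> (\<Sum>p\<le>k'. \<Sum>r\<le>k' - p. tri n \<tau> (?g p) (?g r) (?g (k' - p - r)) i)"
        unfolding 3 formal_inverse.simps by (intro hom_minus sum_in tR)
      also have "\<phi> (\<Sum>p\<le>k'. \<Sum>r\<le>k' - p. tri n \<tau> (?g p) (?g r) (?g (k' - p - r)) i)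
          = (\<Sum>p\<le>k'. \<phi> (\<Sum>r\<le>k' - p. tri n \<tau> (?g p) (?g r) (?g (k' - p - r)) i))"
        by (intro hom_sum sum_in tR)
      also have "\<dots> = (\<Sum>p\<le>k'. \<Sum>r\<le>k' - p. \<phi> (tri n \<tau> (?g p) (?g r) (?g (k' - p - r)) i))"
        by (intro sum.cong refl hom_sum tR)
      finally show ?thesis .
    qed
    also have "\<dots> = ?h k i"
      unfolding 3 formal_inverse.simps by (intro arg_cong[of _ _ uminus] sum.cong refl t) auto
    finally show ?thesis .
  qed (use less.prems hom_zero in auto)
qed

lemma hom_jac_pow:
  assumes \<tau>: "\<And>i j k l. i < n \<Longrightarrow> j < n \<Longrightarrow> k < n \<Longrightarrow> l < n \<Longrightarrow> \<tau> i j k l \<in> R"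
    and x: "\<And>j. j < n \<Longrightarrow> x j \<in> R" and v: "\<And>j. j < n \<Longrightarrow> v j \<in> R"
  shows "i < n \<Longrightarrow> \<phi> ((jac n \<tau> x ^^ p) v i) =
    (jac n (\<lambda>i j k l. \<phi> (\<tau> i j k l)) (\<lambda>j. \<phi> (x j)) ^^ p) (\<lambda>j. \<phi> (v j)) i"
proof (induction p arbitrary: i)
  case (Suc p)
  let ?w = "(jac n \<tau> x ^^ p) v"
  have w: "?w j \<in> R" if "j < n" for j by (rule jac_pow_in[OF \<tau> x v that])
  have "\<phi> (jac n \<tau> x ?w i) = jac n (\<lambda>i j k l. \<phi> (\<tau> i j k l)) (\<lambda>j. \<phi> (x j)) (\<lambda>j. \<phi> (?w j)) i"
    unfolding jac_def[of n _ _ ?w] jac_def[of n _ _ "\<lambda>j. \<phi> (?w j)"]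
    using Suc.prems \<tau> x w by (simp add: hom_add hom_tri tri_in add_in)
  also have "\<dots> = jac n (\<lambda>i j k l. \<phi> (\<tau> i j k l)) (\<lambda>j. \<phi> (x j))
      ((jac n (\<lambda>i j k l. \<phi> (\<tau> i j k l)) (\<lambda>j. \<phi> (x j)) ^^ p) (\<lambda>j. \<phi> (v j))) i"
    by (rule jac_cong) (use Suc.IH in auto)
  finally show ?case by simp
qed simp

text \<open>At natural points, which the homomorphism fixes, the iterates for the image tensor are
  the images of the iterates for \<open>\<tau>\<close>.\<close>

lemma nilpotent_hom:
  assumes \<tau>: "\<And>i j k l. i < n \<Longrightarrow> j < n \<Longrightarrow> k < n \<Longrightarrow> l < n \<Longrightarrow> \<tau> i j k l \<in> R"
    and nil: "nilpotent n \<tau>"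
  shows "nilpotent n (\<lambda>i j k l. \<phi> (\<tau> i j k l))"
proof -
  obtain p where p: "\<And>x v i. i < n \<Longrightarrow> (jac n \<tau> x ^^ p) v i = 0"
    using nil unfolding nilpotent_def by blast
  have nat: "x \<in> R \<and> \<phi> x = x" if "x \<in> \<nat>" for x
    using that by (auto elim!: Nats_cases simp: of_nat_in hom_of_nat)
  show ?thesis
  proof (rule nilpotent_if_nat_points)
    fix x v :: "nat \<Rightarrow> complex" and i assume *: "\<forall>j. x j \<in> \<nat>" "\<forall>j. v j \<in> \<nat>" "i < n"
    have "\<phi> ((jac n \<tau> x ^^ p) v i) =
        (jac n (\<lambda>i j k l. \<phi> (\<tau> i j k l)) (\<lambda>j. \<phi> (x j)) ^^ p) (\<lambda>j. \<phi> (v j)) i"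
      using * nat by (intro hom_jac_pow \<tau>) auto
    moreover have "(\<lambda>j. \<phi> (x j)) = x" "(\<lambda>j. \<phi> (v j)) = v" using * nat by auto
    ultimately show "(jac n (\<lambda>i j k l. \<phi> (\<tau> i j k l)) x ^^ p) v i = 0"
      using p[OF *(3)] by (simp add: hom_zero)
  qed
qed

end

text \<open>An index \<open>J\<close> below \<open>n * e\<close> encodes the coordinate
  \<open>J div e\<close> together with the basis element \<open>J mod e\<close>.\<close>

lemma sum_div_mod:
  fixes f :: "nat \<Rightarrow> 'a::comm_monoid_add"
  assumes "i < n"
  shows "(\<Sum>J<n * e. if J div e = i then f (J mod e) else 0) = (\<Sum>m<e. f m)"
proof -
  have "(\<Sum>J<n * e. if J div e = i then f (J mod e) else 0) = (\<Sum>J\<in>{J. J < n * e \<and> J div e = i}. f (J mod e))"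
    by (simp add: sum.If_cases Int_def)
  also have "\<dots> = (\<Sum>m<e. f m)"
  proof (rule sum.reindex_bij_witness[of _ "\<lambda>m. i * e + m" "\<lambda>J. J mod e"])
    fix m assume m: "m \<in> {..<e}"
    then have "i * e + m < Suc i * e" by simp
    also have "\<dots> \<le> n * e" using assms by (intro mult_le_mono1) simp
    finally show "i * e + m \<in> {J. J < n * e \<and> J div e = i}" using m by simp
  next
    fix J assume J: "J \<in> {J. J < n * e \<and> J div e = i}"
    then have "0 < e" by (cases e) auto
    then show "J mod e \<in> {..<e}" by simp
    show "i * e + J mod e = J" using J div_mult_mod_eq[of J e] by simp
  qed auto
  finally show ?thesis .
qed

lemma common_denominator:
  assumes "finite S" "S \<subseteq> (\<rat> :: complex set)"
  shows "\<exists>d::nat. 0 < d \<and> (\<forall>x\<in>S. of_nat d * x \<in> \<int>)"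
  using assms
proof (induction S rule: finite_induct)
  case empty
  show ?case by (rule exI[of _ 1]) simp
next
  case (insert x S)
  then obtain d where d: "0 < d" "\<forall>x\<in>S. of_nat d * x \<in> \<int>" by auto
  obtain r where r: "x = of_rat r" using insert.prems by (auto elim: Rats_cases)
  obtain a b where ab: "r = Rat.Fract a b" "0 < b" by (cases r) auto
  have "of_nat (nat b) * x = of_int a" using ab by (simp add: r of_rat_rat)
  then have b: "of_nat (nat b) * x \<in> \<int>" by (simp only: Ints_of_int)
  have b0: "0 < nat b" using ab by simp
  show ?case
  proof (intro exI[of _ "d * nat b"] conjI ballI)
    fix z assume "z \<in> insert x S"
    then consider "z = x" | "z \<in> S" by blast
    then show "of_nat (d * nat b) * z \<in> \<int>"
    proof cases
      case 1
      have "of_nat d * (of_nat (nat b) * x) \<in> \<int>" by (rule Ints_mult[OF _ b]) simp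
      then show ?thesis by (simp only: 1 of_nat_mult mult.assoc)
    next
      case 2
      have "of_nat (nat b) * (of_nat d * z) \<in> \<int>" by (rule Ints_mult[OF _ d(2)[rule_format, OF 2]]) simp
      then show ?thesis by (simp only: of_nat_mult mult_ac)
    qed
  qed (use d b0 in auto)
qed

text \<open>The new tensor is the old one in coordinates with respect to a basis \<open>\<beta>\<close> of \<open>K\<close> over the
  rationals.  It is nilpotent because \<open>M\<close>, which is not injective, is injective on rational points.\<close>

lemma restriction_of_scalars:
  assumes K: "finite_rat_algebra K" and n: "0 < n" and nil: "nilpotent n \<tau>"
    and \<tau>: "\<And>i j k l. i < n \<Longrightarrow> j < n \<Longrightarrow> k < n \<Longrightarrow> l < n \<Longrightarrow> \<tau> i j k l \<in> K"
  obtains N \<sigma> d where "0 < N" "nilpotent N \<sigma>" "0 < (d::nat)" "\<And>i j k l. of_nat d * \<sigma> i j k l \<in> \<int>"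
    "formal_inverse_terminates N \<sigma> \<Longrightarrow> formal_inverse_terminates n \<tau>"
proof -
  interpret complex_subring K by unfold_locales (use K in \<open>simp add: finite_rat_algebra_def\<close>)
  obtain B where B: "finite B" "rat_complex.independent B" "K = rat_complex.span B"
    using finite_rat_algebra_basis[OF K] .
  define e where "e = card B"
  obtain \<beta> where \<beta>: "bij_betw \<beta> {..<e} B"
    unfolding e_def using ex_bij_betw_nat_finite[OF B(1)] by (auto simp: atLeast0LessThan)
  have \<beta>B: "\<beta> m \<in> B" if "m < e" for m using \<beta> that by (auto simp: bij_betw_def)
  have \<beta>K: "\<beta> m \<in> K" if "m < e" for m using \<beta>B[OF that] B(3) rat_complex.span_base by auto
  have sum_\<beta>: "(\<Sum>m<e. f (\<beta> m)) = (\<Sum>b\<in>B. f b)" for f :: "complex \<Rightarrow> complex"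
    using sum.reindex_bij_betw[OF \<beta>] .
  have coords: "\<exists>q. x = (\<Sum>m<e. of_rat (q m) * \<beta> m)" if "x \<in> K" for x
  proof -
    have "x \<in> range (\<lambda>u. \<Sum>b\<in>B. of_rat (u b) * b)"
      using that unfolding B(3) rat_complex.span_finite[OF B(1)] .
    then obtain u where "x = (\<Sum>b\<in>B. of_rat (u b) * b)" by blast
    then show ?thesis by (intro exI[of _ "\<lambda>m. u (\<beta> m)"]) (simp only: sum_\<beta>[of "\<lambda>b. of_rat (u b) * b"])
  qed
  have unique: "q m = 0" if "(\<Sum>m<e. of_rat (q m) * \<beta> m) = 0" "m < e" for q m
  proof -
    let ?inv = "the_inv_into {..<e} \<beta>"
    have inv: "?inv (\<beta> m) = m" if "m < e" for m
      using \<beta> that by (simp add: bij_betw_def the_inv_into_f_f)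
    have "(\<Sum>m<e. of_rat (q m) * \<beta> m) = (\<Sum>m<e. (\<lambda>b. of_rat (q (?inv b)) * b) (\<beta> m))"
      by (intro sum.cong) (auto simp: inv)
    also have "\<dots> = (\<Sum>b\<in>B. of_rat (q (?inv b)) * b)" by (rule sum_\<beta>)
    finally have "(\<Sum>b\<in>B. of_rat (q (?inv b)) * b) = 0" using that(1) by simp
    then have "\<forall>b\<in>B. q (?inv b) = 0"
      using B(2) unfolding rat_complex.dependent_finite[OF B(1)] by auto
    then show ?thesis using \<beta>B[OF that(2)] inv[OF that(2)] by force
  qed
  have e: "0 < e"
  proof (rule ccontr)
    assume "\<not> 0 < e"
    then have "B = {}" using B(1) by (simp add: e_def)
    then have "(1::complex) = 0" using one_in B(3) by simp
    then show False by simp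
  qed
  have \<beta>0: "\<beta> 0 \<noteq> 0"
    using B(2) \<beta>B[OF e] rat_complex.dependent_zero by metis
  obtain \<kappa> where \<kappa>: "\<And>x. x \<in> K \<Longrightarrow> x = (\<Sum>m<e. of_rat (\<kappa> x m) * \<beta> m)" using coords by metis
  define N where "N = n * e"
  \<comment> \<open>\<open>M\<close> assembles elements of \<open>K\<close> from their rational
    coordinates, \<open>X\<close> is the tensor after this substitution, and \<open>\<sigma>\<close>
    consists of the rational coordinates of \<open>X\<close>.\<close>
  define M where "M i J = (if J div e = i then \<beta> (J mod e) else 0)" for i J
  define X where "X i J L P = \<tau> i (J div e) (L div e) (P div e) * (\<beta> (J mod e) * (\<beta> (L mod e) * \<beta> (P mod e)))" for i J L P
  define \<sigma> where "\<sigma> I J L P = (if I < N \<and> J < N \<and> L < N \<and> P < N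
      then of_rat (\<kappa> (X (I div e) J L P) (I mod e)) else 0 :: complex)" for I J L P
  have div: "J div e < n" if "J < N" for J using that e by (simp add: N_def less_mult_imp_div_less)
  have XK: "X i J L P \<in> K" if "i < n" "J < N" "L < N" "P < N" for i J L P
    unfolding X_def using that div \<beta>K e by (intro mult_in \<tau>) auto
  have X\<sigma>: "(\<Sum>I<N. M i I * \<sigma> I J L P) = X i J L P" if "i < n" "J < N" "L < N" "P < N" for i J L P
  proof -
    have "(\<Sum>I<N. M i I * \<sigma> I J L P)
        = (\<Sum>I<n * e. if I div e = i then of_rat (\<kappa> (X i J L P) (I mod e)) * \<beta> (I mod e) else 0)"
      unfolding N_def by (intro sum.cong refl) (use that in \<open>auto simp: M_def \<sigma>_def N_def\<close>)
    also have "\<dots> = (\<Sum>m<e. of_rat (\<kappa> (X i J L P) m) * \<beta> m)" by (rule sum_div_mod[OF that(1)])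
    finally show ?thesis using \<kappa>[OF XK[OF that]] by simp
  qed
  have lin_M: "(\<Sum>j<n. G j * lin N M z j) = (\<Sum>J<N. G (J div e) * (\<beta> (J mod e) * z J))" for G z
  proof -
    have "(\<Sum>j<n. G j * lin N M z j) = (\<Sum>j<n. \<Sum>J<N. if J div e = j then G j * (\<beta> (J mod e) * z J) else 0)"
      unfolding lin_def sum_distrib_left by (intro sum.cong refl) (simp add: M_def)
    also have "\<dots> = (\<Sum>J<N. \<Sum>j<n. if J div e = j then G j * (\<beta> (J mod e) * z J) else 0)" by (rule sum.swap)
    also have "\<dots> = (\<Sum>J<N. G (J div e) * (\<beta> (J mod e) * z J))"
      by (intro sum.cong refl) (use div in simp)
    finally show ?thesis .
  qed
  interpret cubic_intertwining N \<sigma> n \<tau> M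
  proof
    fix z i assume i: "i < n"
    have "lin N M (tri N \<sigma> z z z) i
        = (\<Sum>I<N. \<Sum>J<N. \<Sum>L<N. \<Sum>P<N. M i I * \<sigma> I J L P * (z J * (z L * z P)))"
      by (simp add: lin_def tri_def sum_distrib_left mult.assoc)
    also have "\<dots> = (\<Sum>J<N. \<Sum>I<N. \<Sum>L<N. \<Sum>P<N. M i I * \<sigma> I J L P * (z J * (z L * z P)))"
      by (rule sum.swap)
    also have "\<dots> = (\<Sum>J<N. \<Sum>L<N. \<Sum>I<N. \<Sum>P<N. M i I * \<sigma> I J L P * (z J * (z L * z P)))"
      by (intro sum.cong refl sum.swap)
    also have "\<dots> = (\<Sum>J<N. \<Sum>L<N. \<Sum>P<N. \<Sum>I<N. M i I * \<sigma> I J L P * (z J * (z L * z P)))"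
      by (intro sum.cong refl sum.swap)
    also have "\<dots> = (\<Sum>J<N. \<Sum>L<N. \<Sum>P<N. X i J L P * (z J * (z L * z P)))"
      using i by (intro sum.cong refl) (simp add: X\<sigma> flip: sum_distrib_right)
    also have "\<dots> = (\<Sum>J<N. (\<Sum>L<N. (\<Sum>P<N. \<tau> i (J div e) (L div e) (P div e) * (\<beta> (P mod e) * z P))
        * (\<beta> (L mod e) * z L)) * (\<beta> (J mod e) * z J))"
      by (simp add: X_def sum_distrib_left sum_distrib_right mult_ac)
    also have "\<dots> = (\<Sum>j<n. (\<Sum>k<n. (\<Sum>l<n. \<tau> i j k l * lin N M z l) * lin N M z k) * lin N M z j)"
      by (simp only: lin_M)
    also have "\<dots> = tri n \<tau> (lin N M z) (lin N M z) (lin N M z) i"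
      by (simp add: tri_def sum_distrib_left sum_distrib_right mult_ac)
    finally show "lin N M (tri N \<sigma> z z z) i = tri n \<tau> (lin N M z) (lin N M z) (lin N M z) i" .
  qed
  interpret Q: complex_subring \<rat> by unfold_locales (simp add: is_subring_def)
  have \<sigma>Q: "\<sigma> I J L P \<in> \<rat>" for I J L P by (simp add: \<sigma>_def)
  have inj: "z J = 0" if z: "\<And>J. J < N \<Longrightarrow> z J \<in> \<rat>" "\<And>i. i < n \<Longrightarrow> lin N M z i = 0" and J: "J < N" for z J
  proof -
    have "\<forall>J. \<exists>q. J < N \<longrightarrow> z J = of_rat q" using z(1) by (auto elim: Rats_cases)
    then obtain q where q: "\<And>J. J < N \<Longrightarrow> z J = of_rat (q J)" by metis
    let ?i = "J div e"
    have "0 = lin N M z ?i" using z(2) div[OF J] by simp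
    also have "\<dots> = (\<Sum>J<n * e. if J div e = ?i then of_rat (q (?i * e + J mod e)) * \<beta> (J mod e) else 0)"
      unfolding lin_def N_def
    proof (intro sum.cong refl)
      fix I assume "I \<in> {..<n * e}"
      then show "M ?i I * z I = (if I div e = ?i then of_rat (q (?i * e + I mod e)) * \<beta> (I mod e) else 0)"
        using q[of I] div_mult_mod_eq[of I e] by (cases "I div e = ?i") (simp_all add: M_def N_def)
    qed
    also have "\<dots> = (\<Sum>m<e. of_rat (q (?i * e + m)) * \<beta> m)" by (rule sum_div_mod[OF div[OF J]])
    finally have "q (?i * e + J mod e) = 0" using unique[of "\<lambda>m. q (?i * e + m)" "J mod e"] e by simp
    then show ?thesis using q[OF J] by simp
  qed
  obtain p where p: "\<And>x v i. i < n \<Longrightarrow> (jac n \<tau> x ^^ p) v i = 0"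
    using nil unfolding nilpotent_def by blast
  have nil\<sigma>: "nilpotent N \<sigma>"
  \<comment> \<open>Since \<open>\<sigma>\<close> is rational, the iterates stay rational at natural
    points. \<open>M\<close> sends them to iterates for \<open>\<tau>\<close>, which vanish, and
    rational vectors in its kernel are zero.\<close>
  proof (rule nilpotent_if_nat_points)
    fix x v :: "nat \<Rightarrow> complex" and I assume *: "\<forall>j. x j \<in> \<nat>" "\<forall>j. v j \<in> \<nat>" "I < N"
    then have "x j \<in> \<rat>" "v j \<in> \<rat>" for j using Nats_subset_Rats by blast+
    then have "(jac N \<sigma> x ^^ p) v J \<in> \<rat>" if "J < N" for J using \<sigma>Q that by (intro Q.jac_pow_in) auto
    moreover have "lin N M ((jac N \<sigma> x ^^ p) v) i = 0" if "i < n" for i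
      using jac_pow_lin[where x = x and p = p and v = v] p that by simp
    ultimately show "(jac N \<sigma> x ^^ p) v I = 0" using *(3) by (rule inj)
  qed
  define V where "V = (\<lambda>(I, J, L, P). \<sigma> I J L P) ` ({..<N} \<times> {..<N} \<times> {..<N} \<times> {..<N})"
  have "finite V" "V \<subseteq> \<rat>" using \<sigma>Q by (auto simp: V_def)
  then obtain d :: nat where d: "0 < d" "\<forall>x\<in>V. of_nat d * x \<in> \<int>" using common_denominator by blast
  have dZ: "of_nat d * \<sigma> I J L P \<in> \<int>" for I J L P
  proof (cases "I < N \<and> J < N \<and> L < N \<and> P < N")
    case True
    then have "\<sigma> I J L P \<in> V" unfolding V_def by force
    then show ?thesis using d by blast
  next
    case False
    then have "\<sigma> I J L P = 0" by (auto simp: \<sigma>_def)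
    then show ?thesis by simp
  qed
  \<comment> \<open>A right inverse of \<open>M\<close>: the value is placed at the basis element
    \<open>\<beta> 0\<close>, which is nonzero by independence.\<close>
  define W where "W J i = (if J = i * e then inverse (\<beta> 0) else 0)" for J i
  have MW: "lin N M (lin n W y) i = y i" if i: "i < n" for y i
  proof -
    have W: "lin n W y J = (if J mod e = 0 then inverse (\<beta> 0) * y (J div e) else 0)" if "J < N" for J
    proof -
      have "lin n W y J = (\<Sum>i'<n. if i' = J div e then (if J mod e = 0 then inverse (\<beta> 0) * y (J div e) else 0) else 0)"
        unfolding lin_def
      proof (intro sum.cong refl)
        fix i'
        have "J = i' * e \<longleftrightarrow> i' = J div e \<and> J mod e = 0" using e div_mult_mod_eq[of J e] by auto
        then show "W J i' * y i' = (if i' = J div e then (if J mod e = 0 then inverse (\<beta> 0) * y (J div e) else 0) else 0)"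
          by (auto simp: W_def)
      qed
      then show ?thesis using div[OF that] by simp
    qed
    have "lin N M (lin n W y) i
        = (\<Sum>J<n * e. if J div e = i then (if J mod e = 0 then y i else 0) else 0)"
      unfolding lin_def[of N M] N_def[symmetric]
      by (intro sum.cong refl) (use W \<beta>0 in \<open>auto simp: M_def\<close>)
    also have "\<dots> = (\<Sum>m<e. if m = 0 then y i else 0)" by (rule sum_div_mod[OF i])
    finally show ?thesis using e by simp
  qed
  show thesis
  proof (rule that[OF _ nil\<sigma> d(1) dZ])
    show "0 < N" using n e by (simp add: N_def)
    show "formal_inverse_terminates n \<tau>" if "formal_inverse_terminates N \<sigma>"
      by (rule formal_inverse_descends[OF MW that])
  qed
qed

definition scale_tensor :: "complex \<Rightarrow> tensor \<Rightarrow> tensor" where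
  "scale_tensor c \<tau> i j k l = c * \<tau> i j k l"

lemma tri_scale_tensor: "tri n (scale_tensor c \<tau>) u v w i = c * tri n \<tau> u v w i"
  by (simp add: tri_def scale_tensor_def sum_distrib_left mult.assoc)

text \<open>The tensor \<open>c^2 T\<close> belongs to the conjugate \<open>F (c x) / c\<close>, and
  conjugation by a homothety multiplies the part of degree \<open>k + 1\<close> by
  \<open>c ^ k\<close>.\<close>

lemma formal_inverse_scale_tensor:
  "formal_inverse n (scale_tensor (c\<^sup>2) \<tau>) y k i = c ^ k * formal_inverse n \<tau> y k i"
proof (induction k arbitrary: i rule: less_induct)
  case (less k)
  let ?\<tau> = "scale_tensor (c\<^sup>2) \<tau>"
  consider "k = 0" | "k = 1" | k' where "k = Suc (Suc k')"
    by (metis One_nat_def old.nat.exhaust)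
  then show ?case
  proof cases
    case 3
    have "tri n ?\<tau> (formal_inverse n ?\<tau> y p) (formal_inverse n ?\<tau> y r) (formal_inverse n ?\<tau> y (k' - p - r)) i
      = c ^ k * tri n \<tau> (formal_inverse n \<tau> y p) (formal_inverse n \<tau> y r) (formal_inverse n \<tau> y (k' - p - r)) i"
      if "p \<le> k'" "r \<le> k' - p" for p r
    proof -
      have "tri n ?\<tau> (formal_inverse n ?\<tau> y p) (formal_inverse n ?\<tau> y r) (formal_inverse n ?\<tau> y (k' - p - r)) i
        = tri n ?\<tau> (\<lambda>j. c ^ p * formal_inverse n \<tau> y p j) (\<lambda>j. c ^ r * formal_inverse n \<tau> y r j)
            (\<lambda>j. c ^ (k' - p - r) * formal_inverse n \<tau> y (k' - p - r) j) i"
        using that 3 less.IH by (intro tri_cong) auto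
      also have "\<dots> = c\<^sup>2 * (c ^ p * c ^ r * c ^ (k' - p - r)) *
          tri n \<tau> (formal_inverse n \<tau> y p) (formal_inverse n \<tau> y r) (formal_inverse n \<tau> y (k' - p - r)) i"
        unfolding tri_scale_tensor tri_scale by simp
      also have "c\<^sup>2 * (c ^ p * c ^ r * c ^ (k' - p - r)) = c ^ k"
        using that by (simp add: 3 power2_eq_square flip: power_add)
      finally show ?thesis .
    qed
    then show ?thesis unfolding 3 formal_inverse.simps by (simp add: sum_distrib_left)
  qed auto
qed

lemma nilpotent_scale_tensor:
  assumes "nilpotent n \<tau>"
  shows "nilpotent n (scale_tensor c \<tau>)"
proof -
  have j: "jac n (scale_tensor c \<tau>) x v = (\<lambda>i. c * jac n \<tau> x v i)" for x v
    by (simp add: jac_def tri_scale_tensor algebra_simps fun_eq_iff)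
  have "(jac n (scale_tensor c \<tau>) x ^^ p) v = (\<lambda>i. c ^ p * (jac n \<tau> x ^^ p) v i)" for x v p
  proof (induction p)
    case (Suc p)
    show ?case unfolding funpow.simps o_apply Suc.IH by (simp add: j jac_cmult fun_eq_iff)
  qed simp
  then show ?thesis using assms unfolding nilpotent_def by (metis mult_zero_right)
qed

lemma nilpotent_invertible_if_integer:
  assumes int: "\<And>n A. 1 \<le> n \<Longrightarrow> druzkowski_mat n A \<Longrightarrow> elements_mat A \<subseteq> \<int> \<Longrightarrow>
    has_polynomial_inverse n (druzkowski_map A)"
  shows nilpotent_invertible
  unfolding nilpotent_invertible_def
proof (intro allI impI)
  fix n \<tau> assume nil: "nilpotent n \<tau>"
  have "formal_inverse n \<tau> y k i = 0" if k: "inverse_bound n \<le> k" and i: "i < n" for y k i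
  \<comment> \<open>Naturals lie in every subring, so at natural arguments the term lies in any ring
    that contains the entries of the tensor.\<close>
  proof (rule poly_fun_eq_0_if_nat_zeros[OF poly_fun_formal_inverse[OF i]])
    fix y :: "nat \<Rightarrow> complex" assume y: "\<forall>j. y j \<in> \<nat>"
    show "formal_inverse n \<tau> y k i = 0"
    proof (rule ccontr)
      assume nz: "formal_inverse n \<tau> y k i \<noteq> 0"
      let ?X = "(\<lambda>(i, j, k, l). \<tau> i j k l) ` ({..<n} \<times> {..<n} \<times> {..<n} \<times> {..<n})"
      obtain R where R: "is_subring R" "?X \<subseteq> R" "specializable R"
        using specializable_subring_exists[of ?X] by auto
      have \<tau>R: "\<tau> i j k l \<in> R" if "i < n" "j < n" "k < n" "l < n" for i j k l
        using R(2) that by force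
      interpret S: complex_subring R by unfold_locales (rule R)
      have yR: "y j \<in> R" for j using y S.of_nat_in by (metis Nats_cases)
      have "formal_inverse n \<tau> y k i \<in> R" by (rule S.formal_inverse_in[OF \<tau>R yR i])
      then obtain K \<phi> where K: "finite_rat_algebra K" "ring_hom_on R \<phi>" "\<phi> ` R \<subseteq> K"
        "\<phi> (formal_inverse n \<tau> y k i) \<noteq> 0"
        using R(3) nz unfolding specializable_def by blast
      interpret complex_subring_hom R \<phi> by unfold_locales (rule K)
      define \<rho> where "\<rho> i j k l = \<phi> (\<tau> i j k l)" for i j k l
      have \<rho>nil: "nilpotent n \<rho>" unfolding \<rho>_def[abs_def] by (rule nilpotent_hom[OF \<tau>R nil])
      have \<rho>K: "\<rho> i j k l \<in> K" if "i < n" "j < n" "k < n" "l < n" for i j k l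
        using \<tau>R that K(3) by (auto simp: \<rho>_def)
      have "0 < n" using i by simp
      obtain N \<sigma> d where N: "0 < N" "nilpotent N \<sigma>" "0 < (d::nat)" "\<And>i j k l. of_nat d * \<sigma> i j k l \<in> \<int>"
        and lift: "formal_inverse_terminates N \<sigma> \<Longrightarrow> formal_inverse_terminates n \<rho>"
        by (rule restriction_of_scalars[OF K(1) \<open>0 < n\<close> \<rho>nil], rule \<rho>K, assumption+, rule that)
      \<comment> \<open>Scaling multiplies the tensor by \<open>c^2\<close>, so that
        \<open>c^2 \<sigma> / 24\<close> is \<open>24 d\<close> times the integer
        \<open>d \<sigma>\<close>.\<close>
      define c :: complex where "c = 24 * of_nat d"
      have c0: "c \<noteq> 0" using N(3) by (simp add: c_def)
      let ?\<sigma> = "scale_tensor (c\<^sup>2) \<sigma>"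
      have \<sigma>Z: "?\<sigma> i j k l / 24 \<in> \<int>" for i j k l
      proof -
        have "of_nat (24 * d) * (of_nat d * \<sigma> i j k l) \<in> \<int>" by (rule Ints_mult[OF _ N(4)]) simp
        then show ?thesis by (simp add: scale_tensor_def c_def power2_eq_square mult_ac)
      qed
      obtain m A where m: "0 < m" "nilpotent m (cube_tensor A)"
        and lift': "formal_inverse_terminates m (cube_tensor A) \<Longrightarrow> formal_inverse_terminates N ?\<sigma>"
        and AZ: "(\<forall>i j k l. ?\<sigma> i j k l / 24 \<in> \<int>) \<longrightarrow> (\<forall>r s. A r s \<in> \<int>)"
        by (rule druzkowski_reduction[OF N(1) nilpotent_scale_tensor[OF N(2), of "c\<^sup>2"]]) (rule that)
      let ?A = "mat m m (\<lambda>(r, s). A r s)"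
      have "has_polynomial_inverse m (druzkowski_map ?A)"
        using m AZ \<sigma>Z by (intro int druzkowski_mat_if_nilpotent) (auto simp: elements_mat_def)
      then have "formal_inverse_terminates m (cube_tensor (\<lambda>r s. ?A $$ (r, s)))"
        by (intro formal_inverse_druzkowski) simp
      moreover have "formal_inverse_terminates m (cube_tensor (\<lambda>r s. ?A $$ (r, s)))
          \<longleftrightarrow> formal_inverse_terminates m (cube_tensor A)"
        by (rule formal_inverse_terminates_cong) (simp add: cube_tensor_def)
      ultimately have "formal_inverse_terminates N ?\<sigma>" using lift' by blast
      then have "formal_inverse_terminates n \<rho>"
        using c0 by (intro lift) (simp add: formal_inverse_terminates_def formal_inverse_scale_tensor)
      \<comment> \<open>Termination alone gives vanishing from some unknown index on; the uniform
        bound brings it down to the given \<open>k\<close>.\<close>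
      from formal_inverse_bound[OF this k i] have "formal_inverse n \<rho> (\<lambda>j. \<phi> (y j)) k i = 0" .
      then have "\<phi> (formal_inverse n \<tau> y k i) = 0"
        unfolding \<rho>_def[abs_def] using hom_formal_inverse[OF \<tau>R yR i] by simp
      then show False using K(4) by simp
    qed
  qed
  then show "formal_inverse_terminates n \<tau>" unfolding formal_inverse_terminates_def by blast
qed

theorem theorem1p4:
  shows "((\<forall>n\<ge>1. \<forall>A. druzkowski_mat n A \<and> elements_mat A \<subseteq> \<int>
             \<longrightarrow> has_polynomial_inverse n (druzkowski_map A))
           \<longrightarrow> JC_infinity)
       \<and> ((\<forall>n\<ge>1. dense_in_maps n
                    {F \<in> druzkowski_maps n. has_polynomial_inverse n F} (druzkowski_maps n))
           \<longrightarrow> JC_infinity)"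
  using JC_if_nilpotent_invertible nilpotent_invertible_if_integer nilpotent_invertible_if_dense
  unfolding JC_infinity_def by blast

end
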